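(* Let $M$ be a time-like surface in the Robertson-Walker space-time $L^4_1(f,c)$ such that the normal part $\eta$ of $\frac{\partial}{\partial t}|_M$ is nowhere zero. Let $\{e_1,e_2;e_3,e_4\}$ be a (local) orthonormal frame field along $M$, with $e_1,e_2$ tangent and $e_3,e_4$ normal to $M$, and $\theta$ a function, such that $$\left.\frac{\partial}{\partial t}\right|_M=\cosh\theta\, e_1+\sinh\theta\, e_3 .$$ Then $M$ has positive relative nullity if and only if \begin{align*} \widetilde\nabla_{e_1}e_1&=0, & \widetilde\nabla_{e_2}e_1&=\omega e_2,\\ \widetilde\nabla_{e_1}e_2&=0, & \widetilde\nabla_{e_2}e_2&=\omega e_1+h^3_{22}e_3+h^4_{22}e_4,\\ \widetilde\nabla_{e_1}e_3&=0, & \widetilde\nabla_{e_2}e_3&=-h^3_{22}e_2,\\ \widetilde\nabla_{e_1}e_4&=0, & \widetilde\nabla_{e_2}e_4&=-h^4_{22}e_2 \end{align*} for some smooth functions $\omega$, $h^3_{22}$ and $h^4_{22}$.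
   Context: For $c\in\{-1,0,1\}$ let $R^3(c)$ be $\mathbb H^3,\mathbb E^3,\mathbb S^3$ respectively with metric $g_c$. Let $I$ be an open interval and $f:I\to\mathbb R$ a smooth nowhere vanishing function. The Robertson-Walker space-time $L^4_1(f,c)$ is $I\times R^3(c)$ with metric $\langle\cdot,\cdot\rangle=-dt^2+f(t)^2g_c$; $\widetilde\nabla$ is its Levi-Civita connection. A surface $M$ in $L^4_1(f,c)$ is time-like if its induced metric is Lorentzian; $h$ is its second fundamental form. Write $\frac{\partial}{\partial t}|_M=T+\eta$ with $T$ tangent and $\eta$ normal to $M$. (Thus $e_1$ is the time-like unit vector proportional to $T$ and $e_3$ is a space-like unit normal proportional to $\eta$.) The relative null space at $p\in M$ is $\mathcal N_p=\{X\in T_pM: h_p(X,Y)=0\ \text{for all } Y\in T_pM\}$; $M$ has positive relative nullity if $\dim\mathcal N_p>0$ for all $p\in M$. Standing assumptions: (i) $\frac{f''(t)}{f(t)}-\frac{f'(t)^2+c}{f(t)^2}\neq0$ for all $t\in I$; (ii) $T$ does not vanish on $M$; (iii) when $M$ has positive relative nullity, the spaces $\mathcal N_p$ form a smooth 1-dimensional distribution; (iv) $M$ is connected and no open part of $M$ lies in a 3-dimensional totally geodesic hypersurface of $L^4_1(f,c)$. *)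

theory Defs
  imports "HOL-Analysis.Analysis"
begin

section \<open>Smooth maps between normed spaces\<close>

text \<open>Only meaningful for open \<open>S\<close>.\<close>

fun Ck_on :: "nat \<Rightarrow> 'a::real_normed_vector set \<Rightarrow> ('a \<Rightarrow> 'b::real_normed_vector) \<Rightarrow> bool" where
  "Ck_on 0 S F \<longleftrightarrow> continuous_on S F"
| "Ck_on (Suc k) S F \<longleftrightarrow>
     (\<forall>x\<in>S. F differentiable (at x)) \<and> (\<forall>v. Ck_on k S (\<lambda>x. frechet_derivative F (at x) v))"

definition smooth_on :: "'a::real_normed_vector set \<Rightarrow> ('a \<Rightarrow> 'b::real_normed_vector) \<Rightarrow> bool" where
  "smooth_on S F \<longleftrightarrow> (\<forall>k. Ck_on k S F)"

section \<open>Pseudo-Riemannian submanifolds of a vector space\<close>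

text \<open>
  The ambient manifold is a subset \<open>L\<close> of a vector space, and its metric is the restriction to
  the tangent spaces of \<open>L\<close> of a field \<open>G\<close> of bilinear forms on the vector space; \<open>G\<close> itself
  may be degenerate.
\<close>

definition tangent_space :: "'e::real_normed_vector set \<Rightarrow> 'e \<Rightarrow> 'e set" where
  "tangent_space S q = {v. \<exists>\<gamma> \<epsilon>. \<epsilon> > 0 \<and> smooth_on {-\<epsilon><..<\<epsilon>} \<gamma> \<and> \<gamma> ` {-\<epsilon><..<\<epsilon>} \<subseteq> S \<and>
     \<gamma> (0::real) = q \<and> (\<gamma> has_vector_derivative v) (at 0)}"

definition christoffel ::
  "('e::real_normed_vector \<Rightarrow> 'e \<Rightarrow> 'e \<Rightarrow> real) \<Rightarrow> 'e \<Rightarrow> 'e \<Rightarrow> 'e \<Rightarrow> 'e \<Rightarrow> real" where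
  "christoffel G q X Y Z =
     (frechet_derivative (\<lambda>r. G r Y Z) (at q) X + frechet_derivative (\<lambda>r. G r X Z) (at q) Y
      - frechet_derivative (\<lambda>r. G r X Y) (at q) Z) / 2"

text \<open>
  \<open>levi_civita L G q X Y Y'\<close> is the value at \<open>q\<close> of the Levi-Civita covariant derivative in
  direction \<open>X\<close> of a vector field tangent to \<open>L\<close> with value \<open>Y\<close> at \<open>q\<close> and componentwise
  derivative \<open>Y'\<close> in direction \<open>X\<close>.  Writing \<open>D\<close> for componentwise differentiation, the Koszul
  formula
  \<open>2 G(\<nabla>\<^sub>X Y, Z) = X G(Y,Z) + Y G(X,Z) - Z G(X,Y) + G([X,Y],Z) - G([X,Z],Y) - G([Y,Z],X)\<close>
  with \<open>[X,Y] = D\<^sub>X Y - D\<^sub>Y X\<close> becomes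
  \<open>G(\<nabla>\<^sub>X Y, Z) = G(D\<^sub>X Y, Z) + christoffel G q X Y Z\<close>.  Since only \<open>Y\<close> and \<open>Y'\<close> enter, the
  same expression serves for vector fields along a map into \<open>L\<close>.
\<close>

definition levi_civita ::
  "'e::real_normed_vector set \<Rightarrow> ('e \<Rightarrow> 'e \<Rightarrow> 'e \<Rightarrow> real) \<Rightarrow> 'e \<Rightarrow> 'e \<Rightarrow> 'e \<Rightarrow> 'e \<Rightarrow> 'e" where
  "levi_civita L G q X Y Y' =
     (THE V. V \<in> tangent_space L q \<and>
        (\<forall>Z\<in>tangent_space L q. G q V Z = G q Y' Z + christoffel G q X Y Z))"

definition hypersurface :: "'e::real_normed_vector set \<Rightarrow> 'e set \<Rightarrow> bool" where
  "hypersurface L S \<longleftrightarrow> S \<subseteq> L \<and>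
     (\<forall>q\<in>S. \<exists>B (F :: 'e \<Rightarrow> real). open B \<and> q \<in> B \<and> smooth_on B F \<and>
        S \<inter> B = {y \<in> L \<inter> B. F y = 0} \<and>
        (\<exists>v\<in>tangent_space L q. frechet_derivative F (at q) v \<noteq> 0))"

text \<open>Vanishing second fundamental form: \<open>\<nabla>\<^sub>X Y\<close> is tangent to \<open>S\<close> whenever \<open>X\<close> and \<open>Y\<close> are.\<close>

definition totally_geodesic ::
  "'e::real_normed_vector set \<Rightarrow> ('e \<Rightarrow> 'e \<Rightarrow> 'e \<Rightarrow> real) \<Rightarrow> 'e set \<Rightarrow> bool" where
  "totally_geodesic L G S \<longleftrightarrow>
     (\<forall>q\<in>S. \<forall>X\<in>tangent_space S q. \<forall>B Y. open B \<and> q \<in> B \<and> smooth_on B Y \<and>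
        (\<forall>y\<in>S \<inter> B. Y y \<in> tangent_space S y) \<longrightarrow>
        levi_civita L G q X (Y q) (frechet_derivative Y (at q) X) \<in> tangent_space S q)"

section \<open>Immersed surfaces\<close>

text \<open>
  A smooth surface is a topological space \<open>M\<close> with a set \<open>A\<close> of local parametrizations
  \<open>(U, \<phi>)\<close>, where \<open>\<phi>\<close> maps the open set \<open>U\<close> of the plane homeomorphically onto an open subset
  of \<open>M\<close>.
\<close>

type_synonym 'm atlas = "((real^2) set \<times> (real^2 \<Rightarrow> 'm)) set"

definition smooth_surface :: "'m topology \<Rightarrow> 'm atlas \<Rightarrow> bool" where
  "smooth_surface M A \<longleftrightarrow> Hausdorff_space M \<and> second_countable M \<and>
     topspace M = (\<Union>(U, \<phi>)\<in>A. \<phi> ` U) \<and>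
     (\<forall>(U, \<phi>)\<in>A. open U \<and> openin M (\<phi> ` U) \<and>
        homeomorphic_map (top_of_set U) (subtopology M (\<phi> ` U)) \<phi>) \<and>
     (\<forall>(U, \<phi>)\<in>A. \<forall>(V, \<psi>)\<in>A. smooth_on {u\<in>U. \<phi> u \<in> \<psi> ` V} (inv_into V \<psi> \<circ> \<phi>))"

definition smooth_map_on :: "'m atlas \<Rightarrow> 'm set \<Rightarrow> ('m \<Rightarrow> 'b::real_normed_vector) \<Rightarrow> bool" where
  "smooth_map_on A W F \<longleftrightarrow> (\<forall>(U, \<phi>)\<in>A. smooth_on {u\<in>U. \<phi> u \<in> W} (F \<circ> \<phi>))"

definition immersion ::
  "'m topology \<Rightarrow> 'm atlas \<Rightarrow> ('m \<Rightarrow> 'e::real_normed_vector) \<Rightarrow> 'e set \<Rightarrow> bool" where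
  "immersion M A x L \<longleftrightarrow> smooth_map_on A (topspace M) x \<and> x ` topspace M \<subseteq> L \<and>
     (\<forall>(U, \<phi>)\<in>A. \<forall>u\<in>U. inj (frechet_derivative (x \<circ> \<phi>) (at u)))"

text \<open>Tangent vectors of the surface are identified with their images under the differential of
  the immersion \<open>x\<close>.\<close>

definition tangent_plane ::
  "'m atlas \<Rightarrow> ('m \<Rightarrow> 'e::real_normed_vector) \<Rightarrow> 'm \<Rightarrow> 'e set" where
  "tangent_plane A x p =
     {v. \<exists>(U, \<phi>)\<in>A. \<exists>u\<in>U. \<exists>a. \<phi> u = p \<and> v = frechet_derivative (x \<circ> \<phi>) (at u) a}"

definition directional_derivative ::
  "'m atlas \<Rightarrow> ('m \<Rightarrow> 'e::real_normed_vector) \<Rightarrow> ('m \<Rightarrow> 'b::real_normed_vector) \<Rightarrow> 'm \<Rightarrow> 'e \<Rightarrow> 'b" where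
  "directional_derivative A x F p v =
     (THE d. \<forall>(U, \<phi>)\<in>A. \<forall>u\<in>U. \<forall>a. \<phi> u = p \<and> frechet_derivative (x \<circ> \<phi>) (at u) a = v \<longrightarrow>
        d = frechet_derivative (F \<circ> \<phi>) (at u) a)"

text \<open>\<open>nabla L G A x X V p\<close> is the Levi-Civita derivative, at \<open>p\<close>, of the vector field \<open>V\<close> of \<open>L\<close>
  along \<open>x\<close> with respect to the vector field \<open>X\<close> tangent to the surface.\<close>

definition nabla ::
  "'e::real_normed_vector set \<Rightarrow> ('e \<Rightarrow> 'e \<Rightarrow> 'e \<Rightarrow> real) \<Rightarrow> 'm atlas \<Rightarrow> ('m \<Rightarrow> 'e) \<Rightarrow>
   ('m \<Rightarrow> 'e) \<Rightarrow> ('m \<Rightarrow> 'e) \<Rightarrow> 'm \<Rightarrow> 'e" where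
  "nabla L G A x X V p =
     levi_civita L G (x p) (X p) (V p) (directional_derivative A x V p (X p))"

definition normal_plane ::
  "'e::real_normed_vector set \<Rightarrow> ('e \<Rightarrow> 'e \<Rightarrow> 'e \<Rightarrow> real) \<Rightarrow> 'm atlas \<Rightarrow> ('m \<Rightarrow> 'e) \<Rightarrow> 'm \<Rightarrow> 'e set" where
  "normal_plane L G A x p =
     {N \<in> tangent_space L (x p). \<forall>v\<in>tangent_plane A x p. G (x p) N v = 0}"

definition tangent_part ::
  "'e::real_normed_vector set \<Rightarrow> ('e \<Rightarrow> 'e \<Rightarrow> 'e \<Rightarrow> real) \<Rightarrow> 'm atlas \<Rightarrow> ('m \<Rightarrow> 'e) \<Rightarrow> 'm \<Rightarrow> 'e \<Rightarrow> 'e" where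
  "tangent_part L G A x p Z =
     (THE V. V \<in> tangent_plane A x p \<and> Z - V \<in> normal_plane L G A x p)"

definition normal_part ::
  "'e::real_normed_vector set \<Rightarrow> ('e \<Rightarrow> 'e \<Rightarrow> 'e \<Rightarrow> real) \<Rightarrow> 'm atlas \<Rightarrow> ('m \<Rightarrow> 'e) \<Rightarrow> 'm \<Rightarrow> 'e \<Rightarrow> 'e" where
  "normal_part L G A x p Z =
     (THE N. N \<in> normal_plane L G A x p \<and> Z - N \<in> tangent_plane A x p)"

definition timelike ::
  "('e::real_normed_vector \<Rightarrow> 'e \<Rightarrow> 'e \<Rightarrow> real) \<Rightarrow> 'm topology \<Rightarrow> 'm atlas \<Rightarrow> ('m \<Rightarrow> 'e) \<Rightarrow> bool" where
  "timelike G M A x \<longleftrightarrow>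
     (\<forall>p\<in>topspace M. \<exists>u v. tangent_plane A x p = span {u, v} \<and>
        G (x p) u u = -1 \<and> G (x p) v v = 1 \<and> G (x p) u v = 0)"

text \<open>The second fundamental form is the normal part of \<open>\<nabla>\<^sub>X Y\<close>, where \<open>Y\<close> is extended to an
  arbitrary smooth tangent vector field \<open>V\<close> near \<open>p\<close>.\<close>

definition second_fundamental_form ::
  "'e::real_normed_vector set \<Rightarrow> ('e \<Rightarrow> 'e \<Rightarrow> 'e \<Rightarrow> real) \<Rightarrow> 'm topology \<Rightarrow> 'm atlas \<Rightarrow> ('m \<Rightarrow> 'e) \<Rightarrow>
   'm \<Rightarrow> 'e \<Rightarrow> 'e \<Rightarrow> 'e" where
  "second_fundamental_form L G M A x p X Y =
     (THE N. \<forall>W V. openin M W \<and> p \<in> W \<and> smooth_map_on A W V \<and>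
        (\<forall>q\<in>W. V q \<in> tangent_plane A x q) \<and> V p = Y \<longrightarrow>
        N = normal_part L G A x p (nabla L G A x (\<lambda>_. X) V p))"

definition relative_null_space ::
  "'e::real_normed_vector set \<Rightarrow> ('e \<Rightarrow> 'e \<Rightarrow> 'e \<Rightarrow> real) \<Rightarrow> 'm topology \<Rightarrow> 'm atlas \<Rightarrow> ('m \<Rightarrow> 'e) \<Rightarrow>
   'm \<Rightarrow> 'e set" where
  "relative_null_space L G M A x p =
     {X \<in> tangent_plane A x p. \<forall>Y\<in>tangent_plane A x p. second_fundamental_form L G M A x p X Y = 0}"

definition positive_relative_nullity ::
  "'e::real_normed_vector set \<Rightarrow> ('e \<Rightarrow> 'e \<Rightarrow> 'e \<Rightarrow> real) \<Rightarrow> 'm topology \<Rightarrow> 'm atlas \<Rightarrow> ('m \<Rightarrow> 'e) \<Rightarrow>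
   bool" where
  "positive_relative_nullity L G M A x \<longleftrightarrow>
     (\<forall>p\<in>topspace M. dim (relative_null_space L G M A x p) > 0)"

definition smooth_line_distribution ::
  "'m topology \<Rightarrow> 'm atlas \<Rightarrow> ('m \<Rightarrow> 'e::real_normed_vector set) \<Rightarrow> bool" where
  "smooth_line_distribution M A N \<longleftrightarrow>
     (\<forall>p\<in>topspace M. \<exists>W X. openin M W \<and> p \<in> W \<and> smooth_map_on A W X \<and>
        (\<forall>q\<in>W. X q \<noteq> 0 \<and> N q = span {X q}))"

section \<open>Robertson-Walker space-times\<close>

type_synonym R4 = "real \<times> (real^3)"
type_synonym R5 = "real \<times> R4"

text \<open>
  Writing a point of \<open>\<real>\<^sup>4\<close> as \<open>(a, b)\<close> with \<open>b\<close> in \<open>\<real>\<^sup>3\<close>, the space form \<open>R\<^sup>3(c)\<close> is cut out by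
  \<open>a\<^sup>2 + c \<bar>b\<bar>\<^sup>2 = 1\<close> and carries the metric \<open>c da\<^sup>2 + \<bar>db\<bar>\<^sup>2\<close>: this is the unit sphere of Euclidean
  space for \<open>c = 1\<close>, the affine hyperplane \<open>a = 1\<close> for \<open>c = 0\<close>, and the upper sheet of the
  two-sheeted hyperboloid in Minkowski space for \<open>c = -1\<close>.
\<close>

definition space_form :: "real \<Rightarrow> R4 set" where
  "space_form c = {y. (fst y)\<^sup>2 + c * (snd y \<bullet> snd y) = 1 \<and> (c \<le> 0 \<longrightarrow> fst y > 0)}"

definition space_form_metric :: "real \<Rightarrow> R4 \<Rightarrow> R4 \<Rightarrow> real" where
  "space_form_metric c v w = c * fst v * fst w + snd v \<bullet> snd w"

definition rw_space :: "real set \<Rightarrow> real \<Rightarrow> R5 set" where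
  "rw_space I c = I \<times> space_form c"

definition rw_metric :: "(real \<Rightarrow> real) \<Rightarrow> real \<Rightarrow> R5 \<Rightarrow> R5 \<Rightarrow> R5 \<Rightarrow> real" where
  "rw_metric f c q v w =
     - fst v * fst w + (f (fst q))\<^sup>2 * space_form_metric c (snd v) (snd w)"

definition partial_t :: R5 where
  "partial_t = (1, 0)"

section \<open>The Levi-Civita connection of a Robertson-Walker space-time\<close>

text \<open>
  For Robertson-Walker space-times the vector in \<open>levi_civita\<close> exists and is unique, and the
  resulting connection is metric and torsion-free: lemmas \<open>levi_civita_ex1\<close>,
  \<open>levi_civita_metric\<close> and \<open>levi_civita_torsion\<close>.
\<close>

lemma Ck_on_trig_curve:
  fixes p a u w :: "'a::real_normed_vector"
  assumes C: "\<And>s. (C has_real_derivative \<sigma> * S s) (at s)"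
    and S: "\<And>s. (S has_real_derivative C s) (at s)"
  shows "Ck_on k T (\<lambda>s. p + s *\<^sub>R a + C s *\<^sub>R u + S s *\<^sub>R w)"
proof (induction k arbitrary: p a u w)
  case 0
  have "isCont C s" "isCont S s" for s using C S DERIV_isCont by blast+
  then have "continuous_on T C" "continuous_on T S"
    by (auto intro: continuous_at_imp_continuous_on)
  then show ?case by (auto intro!: continuous_intros)
next
  case (Suc k)
  have d: "((\<lambda>s. p + s *\<^sub>R a + C s *\<^sub>R u + S s *\<^sub>R w) has_derivative
      (\<lambda>r. r *\<^sub>R (a + C s *\<^sub>R w + S s *\<^sub>R (\<sigma> *\<^sub>R u)))) (at s)" for s
    by (rule has_derivative_eq_rhs, (rule derivative_intros C[THEN DERIV_compose_FDERIV] C[unfolded has_field_derivative_def] S[unfolded has_field_derivative_def])+)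
       (auto simp: fun_eq_iff algebra_simps)
  have eq: "(\<lambda>s. frechet_derivative (\<lambda>s. p + s *\<^sub>R a + C s *\<^sub>R u + S s *\<^sub>R w) (at s) r)
     = (\<lambda>s. r *\<^sub>R a + s *\<^sub>R 0 + C s *\<^sub>R (r *\<^sub>R w) + S s *\<^sub>R (r *\<^sub>R (\<sigma> *\<^sub>R u)))" for r
    unfolding frechet_derivative_at[OF d, symmetric] by (rule ext) (simp add: algebra_simps)
  show ?case
    unfolding Ck_on.simps eq using d Suc.IH differentiable_def by blast
qed

lemma tangent_space_trig:
  fixes p a u w :: "'a::real_normed_vector"
  assumes C: "\<And>s. (C has_real_derivative \<sigma> * S s) (at s)"
    and S: "\<And>s. (S has_real_derivative C s) (at s)"
    and "C 0 = 1" "S 0 = 0"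
    and ev: "eventually (\<lambda>s. p + s *\<^sub>R a + C s *\<^sub>R u + S s *\<^sub>R w \<in> L) (nhds 0)"
  shows "a + w \<in> tangent_space L (p + u)"
proof -
  obtain \<epsilon> where e: "\<epsilon> > 0" "\<And>s. \<bar>s\<bar> < \<epsilon> \<Longrightarrow> p + s *\<^sub>R a + C s *\<^sub>R u + S s *\<^sub>R w \<in> L"
    using ev unfolding eventually_nhds_metric by (auto simp: dist_real_def)
  have d: "((\<lambda>s. p + s *\<^sub>R a + C s *\<^sub>R u + S s *\<^sub>R w) has_vector_derivative (a + w)) (at 0)"
    unfolding has_vector_derivative_def
    by (rule has_derivative_eq_rhs, (rule derivative_intros C[unfolded has_field_derivative_def] S[unfolded has_field_derivative_def])+)
       (auto simp: fun_eq_iff algebra_simps assms)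
  show ?thesis unfolding tangent_space_def
    apply (rule CollectI, rule exI[of _ "\<lambda>s. p + s *\<^sub>R a + C s *\<^sub>R u + S s *\<^sub>R w"], rule exI[of _ \<epsilon>])
    using e d Ck_on_trig_curve[OF C S] by (auto simp: smooth_on_def assms)
qed

text \<open>The polarization of the quadric defining \<open>R\<^sup>3(c)\<close>.\<close>

definition pairing :: "real \<Rightarrow> R4 \<Rightarrow> R4 \<Rightarrow> real" where
  "pairing c v w = fst v * fst w + c * (snd v \<bullet> snd w)"

lemma sf_pos:
  assumes c: "c \<in> {-1,0,1}" and q: "y \<in> space_form c" and v: "pairing c y v = 0" "v \<noteq> 0"
  shows "space_form_metric c v v > 0"
proof -
  obtain a b where y: "y = (a,b)" by (cases y)
  obtain d e where vv: "v = (d,e)" by (cases v)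
  consider "c = 0" | "c = 1" | "c = -1" using c by auto
  then show ?thesis
  proof cases
    case 1
    then show ?thesis using q v by (auto simp: y vv space_form_def space_form_metric_def pairing_def zero_prod_def power2_eq_square)
  next
    case 2
    then show ?thesis using v by (auto simp: vv space_form_metric_def zero_prod_def  add_pos_nonneg add_nonneg_pos)
       (smt (verit) inner_ge_zero inner_gt_zero_iff not_real_square_gt_zero zero_le_square)
  next
    case 3
    have a: "a\<^sup>2 = 1 + b \<bullet> b" "a > 0" and ad: "a * d = b \<bullet> e"
      using q v 3 by (auto simp: y vv space_form_def pairing_def)
    have "(a*d)\<^sup>2 \<le> (b \<bullet> b) * (e \<bullet> e)" using Cauchy_Schwarz_ineq[of b e] ad by simp
    then have le: "a\<^sup>2 * d\<^sup>2 \<le> (a\<^sup>2 - 1) * (e \<bullet> e)" using a by (simp add: power_mult_distrib)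
    have e: "e \<noteq> 0" 
    proof
      assume "e = 0"
      then have "d = 0" using ad a by auto
      then show False using v \<open>e = 0\<close> by (simp add: vv zero_prod_def)
    qed
    then have "e \<bullet> e > 0" by simp
    then have "a\<^sup>2 * d\<^sup>2 < a\<^sup>2 * (e \<bullet> e)" using le by (simp add: algebra_simps del: inner_gt_zero_iff)
    then have "d\<^sup>2 < e \<bullet> e" using a by (simp add: mult_less_cancel_left)
    then show ?thesis using 3 by (simp add: vv space_form_metric_def power2_eq_square)
  qed
qed

lemma pairing_metric: assumes "c \<in> {-1,1}" shows "pairing c v w = c * space_form_metric c v w"
  using assms by (auto simp: pairing_def space_form_metric_def)

lemma space_form_sub: "y \<in> space_form c \<longleftrightarrow> pairing c y y = 1 \<and> (c \<le> 0 \<longrightarrow> fst y > 0)"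
  by (auto simp: pairing_def space_form_def power2_eq_square)

lemma tangent_rw_sup:
  assumes c: "c \<in> {-1,0,1}" and I: "open I" and q: "q \<in> rw_space I c" and v: "pairing c (snd q) (snd v) = 0"
  shows "v \<in> tangent_space (rw_space I c) q"
proof -
  obtain t y where qe: "q = (t,y)" by (cases q)
  obtain a w where ve: "v = (a,w)" by (cases v)
  have t: "t \<in> I" and y: "y \<in> space_form c" using q by (auto simp: qe rw_space_def)
  have yw: "pairing c y w = 0" using v by (simp add: qe ve)
  have evI: "eventually (\<lambda>s. t + s * a \<in> I) (nhds 0)"
  proof -
    have "((\<lambda>s. t + s * a) \<longlongrightarrow> t + 0 * a) (nhds 0)"
      by (intro tendsto_intros filterlim_ident)
    then show ?thesis using I t topological_tendstoD[of _ "t+0*a" _ I] by fastforce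
  qed
  show ?thesis
  proof (cases "c = 0 \<or> w = 0")
    case True
    have *: "eventually (\<lambda>s. q + s *\<^sub>R v + cosh s *\<^sub>R 0 + sinh s *\<^sub>R 0 \<in> rw_space I c) (nhds 0)"
      using evI
    proof eventually_elim
      case (elim s)
      have "y + s *\<^sub>R w \<in> space_form c"
        using y yw True by (auto simp: space_form_def pairing_def power2_eq_square)
      then show ?case using elim by (simp add: qe ve rw_space_def)
    qed
    have "v + 0 \<in> tangent_space (rw_space I c) (q + 0)"
      by (rule tangent_space_trig[where C=cosh and S=sinh and \<sigma>=1, OF _ _ _ _ *])
         (auto intro!: derivative_eq_intros)
    then show ?thesis by simp
  next
    case False
    then have c1: "c \<in> {-1,1}" using c by auto
    define \<kappa> where "\<kappa> = sqrt (space_form_metric c w w)"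
    have k: "\<kappa> > 0" "\<kappa>\<^sup>2 = space_form_metric c w w" using sf_pos[OF c y yw] False by (auto simp: \<kappa>_def)
    define C :: "real \<Rightarrow> real" where "C = (\<lambda>s. if c = 1 then cos (\<kappa> * s) else cosh (\<kappa> * s))"
    define S :: "real \<Rightarrow> real" where "S = (\<lambda>s. if c = 1 then sin (\<kappa> * s) / \<kappa> else sinh (\<kappa> * s) / \<kappa>)"
    have dC: "(C has_real_derivative (-c*\<kappa>\<^sup>2) * S s) (at s)" for s
      using c1 k(1) by (auto simp: C_def S_def power2_eq_square intro!: derivative_eq_intros)
    have dS: "(S has_real_derivative C s) (at s)" for s
      using c1 k by (auto simp: C_def S_def intro!: derivative_eq_intros)
    have one: "(C s)\<^sup>2 + c * (\<kappa>\<^sup>2) * (S s)\<^sup>2 = 1" for s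
      using c1 k cosh_square_eq[of "\<kappa> * s"] by (auto simp: C_def S_def power_divide)
    have n: "pairing c (C s *\<^sub>R y + S s *\<^sub>R w) (C s *\<^sub>R y + S s *\<^sub>R w) = 1" for s
    proof -
      have "pairing c (C s *\<^sub>R y + S s *\<^sub>R w) (C s *\<^sub>R y + S s *\<^sub>R w) =
        (C s)\<^sup>2 * pairing c y y + 2 * C s * S s * pairing c y w + (S s)\<^sup>2 * pairing c w w"
        by (simp add: pairing_def algebra_simps power2_eq_square inner_commute)
      then show ?thesis using y yw pairing_metric[OF c1, of w w] one[of s] k by (simp add: space_form_sub algebra_simps)
    qed
    have ev0: "eventually (\<lambda>s. c \<le> 0 \<longrightarrow> fst (C s *\<^sub>R y + S s *\<^sub>R w) > 0) (nhds 0)"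
    proof (cases "c \<le> 0")
      case True
      have "isCont C 0" "isCont S 0" using dC dS DERIV_isCont by blast+
      define g where "g = (\<lambda>s. fst (C s *\<^sub>R y + S s *\<^sub>R w))"
      have "isCont g 0" unfolding g_def using \<open>isCont C 0\<close> \<open>isCont S 0\<close> by (intro continuous_intros)
      then have *: "(g \<longlongrightarrow> g 0) (nhds 0)"
        unfolding isCont_def by (rule tendsto_at_iff_tendsto_nhds[THEN iffD1])
      have "g 0 > 0" using y True by (auto simp: g_def C_def S_def space_form_def)
      from order_tendstoD(1)[OF * this] show ?thesis by eventually_elim (simp add: g_def)
    qed simp
    have *: "eventually (\<lambda>s. (t,0) + s *\<^sub>R (a,0) + C s *\<^sub>R (0,y) + S s *\<^sub>R (0,w) \<in> rw_space I c) (nhds 0)"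
      using evI ev0
    proof eventually_elim
      case (elim s)
      then show ?case using n[of s] by (simp add: rw_space_def space_form_sub)
    qed
    have "(a,0) + (0,w) \<in> tangent_space (rw_space I c) ((t,0) + (0,y))"
      by (rule tangent_space_trig[OF dC dS _ _ *]) (auto simp: C_def S_def)
    then show ?thesis by (simp add: qe ve)
  qed
qed

lemma tangent_deriv:
  assumes "v \<in> tangent_space L q" and "(F has_derivative F') (at q)" and "open B" "q \<in> B" and "\<And>y. y \<in> L \<inter> B \<Longrightarrow> F y = (k::real)"
  shows "F' v = 0"
proof -
  from assms(1) obtain \<gamma> \<epsilon> where g: "\<epsilon> > 0" "\<gamma> ` {-\<epsilon><..<\<epsilon>} \<subseteq> L" "\<gamma> (0::real) = q" and d: "(\<gamma> has_vector_derivative v) (at 0)"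
    unfolding tangent_space_def by blast
  have D: "((F \<circ> \<gamma>) has_vector_derivative F' v) (at 0)"
    using vector_derivative_diff_chain_within[OF d, of F F'] assms(2) g
    by (simp add: has_derivative_at_withinI)
  have "isCont \<gamma> 0" using d has_vector_derivative_continuous by blast
  then have "\<forall>\<^sub>F s in nhds 0. \<gamma> s \<in> B" using assms(3,4) g
    by (metis continuous_at_open eventually_nhds isCont_def tendsto_at_iff_tendsto_nhds topological_tendstoD)
  moreover have "\<forall>\<^sub>F s in nhds (0::real). s \<in> {-\<epsilon><..<\<epsilon>}" using g eventually_nhds_in_open[of "{-\<epsilon><..<\<epsilon>}" 0] by auto
  ultimately have "\<forall>\<^sub>F s in nhds 0. (F \<circ> \<gamma>) s = k"
    by eventually_elim (use g(2) assms(5) in \<open>auto simp: image_subset_iff\<close>)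
  then obtain d where d: "d > 0" "\<And>s. dist s 0 < d \<Longrightarrow> (F \<circ> \<gamma>) s = k"
    unfolding eventually_nhds_metric by blast
  have "((\<lambda>s::real. k) has_vector_derivative 0) (at 0)" by simp
  then have "((F \<circ> \<gamma>) has_vector_derivative 0) (at 0)"
    by (rule has_vector_derivative_transform_within[OF _ d(1)]) (simp_all add: d(2)[simplified])
  then show ?thesis using D vector_derivative_unique_at by blast
qed

lemma tangent_rw:
  assumes c: "c \<in> {-1,0,1}" and I: "open I" and q: "q \<in> rw_space I c"
  shows "tangent_space (rw_space I c) q = {v. pairing c (snd q) (snd v) = 0}"
proof (intro equalityI subsetI CollectI)
  fix v assume v: "v \<in> tangent_space (rw_space I c) q"
  have d: "((\<lambda>y. pairing c (snd y) (snd y)) has_derivative (\<lambda>v. 2 * pairing c (snd q) (snd v))) (at q)"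
    unfolding pairing_def by (auto intro!: derivative_eq_intros simp: fun_eq_iff algebra_simps inner_commute)
  have "2 * pairing c (snd q) (snd v) = 0"
    by (rule tangent_deriv[OF v d open_UNIV]) (auto simp: rw_space_def space_form_sub)
  then show "pairing c (snd q) (snd v) = 0" by simp
qed (use tangent_rw_sup[OF c I q] in auto)

lemma christoffel_rw:
  assumes "f differentiable (at (fst q))"
  shows "christoffel (rw_metric f c) q X Y Z = f (fst q) * deriv f (fst q) *
    (fst X * space_form_metric c (snd Y) (snd Z) + fst Y * space_form_metric c (snd X) (snd Z)
     - fst Z * space_form_metric c (snd X) (snd Y))"
proof -
  have "(f has_real_derivative deriv f (fst q)) (at (fst q))"
    using assms by (metis DERIV_deriv_iff_real_differentiable)
  then have ff: "((\<lambda>r. f (fst r)) has_derivative (\<lambda>h. deriv f (fst q) * fst h)) (at q)"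
    by (rule has_derivative_eq_rhs[OF DERIV_compose_FDERIV[where g=fst]]) (auto intro!: derivative_intros simp: fun_eq_iff)
  have d: "((\<lambda>r. rw_metric f c r v w) has_derivative
     (\<lambda>h. 2 * f (fst q) * deriv f (fst q) * fst h * space_form_metric c (snd v) (snd w))) (at q)" for v w
    unfolding rw_metric_def
    by (rule has_derivative_eq_rhs, (rule derivative_intros ff)+) (auto simp: fun_eq_iff power2_eq_square algebra_simps)
  show ?thesis
    by (simp add: christoffel_def frechet_derivative_at[OF d, symmetric] algebra_simps add_divide_distrib diff_divide_distrib)
qed

lemma projection:
  assumes c: "c \<in> {-1,0,1}" and y: "y \<in> space_form c"
  shows "\<exists>z. pairing c y z = 0 \<and> (\<forall>w. pairing c y w = 0 \<longrightarrow> space_form_metric c z w = space_form_metric c d w)"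
proof (cases "c = 0")
  case True
  then show ?thesis by (intro exI[of _ "(0, snd d)"]) (simp add: pairing_def space_form_metric_def)
next
  case False
  then have c1: "c \<in> {-1,1}" using c by auto
  have 1: "pairing c y (d - pairing c y d *\<^sub>R y) = pairing c y d - pairing c y d * pairing c y y"
    by (simp add: pairing_def algebra_simps)
  have 2: "space_form_metric c (d - pairing c y d *\<^sub>R y) w = space_form_metric c d w - pairing c y d * space_form_metric c y w" for w
    by (simp add: space_form_metric_def algebra_simps)
  show ?thesis using y 1 2 pairing_metric[OF c1, of y] c1
    by (intro exI[of _ "d - pairing c y d *\<^sub>R y"]) (auto simp: space_form_sub)
qed

lemma levi_civita_ex1:
  assumes c: "c \<in> {-1,0,1}" and I: "open I" and f: "smooth_on I f" "\<forall>t\<in>I. f t \<noteq> 0"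
    and q: "q \<in> rw_space I c"
  shows "\<exists>!V. V \<in> tangent_space (rw_space I c) q \<and> (\<forall>Z\<in>tangent_space (rw_space I c) q.
     rw_metric f c q V Z = rw_metric f c q Y' Z + christoffel (rw_metric f c) q X Y Z)"
proof -
  have qI: "fst q \<in> I" "snd q \<in> space_form c" using q by (auto simp: rw_space_def)
  have fd: "f differentiable (at (fst q))" using f(1) qI unfolding smooth_on_def
    by (metis Ck_on.simps(2))
  have f0: "f (fst q) \<noteq> 0" using f qI by auto
  obtain z where z: "pairing c (snd q) z = 0" "\<And>w. pairing c (snd q) w = 0 \<Longrightarrow> space_form_metric c z w =
     space_form_metric c (snd Y' + (deriv f (fst q) / f (fst q)) *\<^sub>R (fst X *\<^sub>R snd Y + fst Y *\<^sub>R snd X)) w"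
    using projection[OF c qI(2)] by blast
  define V where "V = (fst Y' + f (fst q) * deriv f (fst q) * space_form_metric c (snd X) (snd Y), z)"
  have VZ: "rw_metric f c q V Z = rw_metric f c q Y' Z + f (fst q) * deriv f (fst q) *
    (fst X * space_form_metric c (snd Y) (snd Z) + fst Y * space_form_metric c (snd X) (snd Z)
     - fst Z * space_form_metric c (snd X) (snd Y))" if "pairing c (snd q) (snd Z) = 0" for Z
    using f0 by (simp add: rw_metric_def V_def z(2)[OF that])
      (simp add: space_form_metric_def inner_add_left field_simps power2_eq_square)
  show ?thesis
    unfolding tangent_rw[OF c I q] christoffel_rw[OF fd]
  proof (rule ex1I[of _ V], safe)
    show "pairing c (snd q) (snd V) = 0" by (simp add: V_def z)
  next
    fix Z :: R5 assume "pairing c (snd q) (snd Z) = 0"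
    then show "rw_metric f c q V Z = rw_metric f c q Y' Z + f (fst q) * deriv f (fst q) *
    (fst X * space_form_metric c (snd Y) (snd Z) + fst Y * space_form_metric c (snd X) (snd Z)
     - fst Z * space_form_metric c (snd X) (snd Y))" by (rule VZ)
  next
    fix V' assume a: "pairing c (snd q) (snd V') = 0" and b: "\<forall>Z\<in>{v. pairing c (snd q) (snd v) = 0}. rw_metric f c q V' Z = rw_metric f c q Y' Z + f (fst q) * deriv f (fst q) *
    (fst X * space_form_metric c (snd Y) (snd Z) + fst Y * space_form_metric c (snd X) (snd Z)
     - fst Z * space_form_metric c (snd X) (snd Y))"
    have p0: "pairing c (snd q) 0 = 0" by (simp add: pairing_def)
    have "rw_metric f c q V' (1,0) = rw_metric f c q Y' (1,0) + f (fst q) * deriv f (fst q) * (- space_form_metric c (snd X) (snd Y))"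
      using b[rule_format, of "(1,0)"] p0 by (simp add: space_form_metric_def)
    then have 1: "fst V' = fst V" by (simp add: rw_metric_def V_def space_form_metric_def algebra_simps)
    have p1: "pairing c (snd q) (snd V' - z) = 0" using a z(1) by (simp add: pairing_def algebra_simps)
    have "(f (fst q))\<^sup>2 * space_form_metric c (snd V') (snd V' - z) = (f (fst q))\<^sup>2 * space_form_metric c z (snd V' - z)"
      using b[rule_format, of "(0, snd V' - z)"] p1 VZ[of "(0, snd V' - z)"]
      by (simp add: rw_metric_def V_def)
    then have "space_form_metric c (snd V') (snd V' - z) = space_form_metric c z (snd V' - z)"
      using f0 by simp
    then have "space_form_metric c (snd V' - z) (snd V' - z) = 0"
      by (simp add: space_form_metric_def inner_diff_left left_diff_distrib right_diff_distrib)
    then have "snd V' - z = 0" using sf_pos[OF c qI(2) p1] by force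
    then show "V' = V" using 1 by (simp add: V_def prod_eq_iff)
  qed
qed

lemma levi_civita_metric:
  assumes c: "c \<in> {-1,0,1}" and I: "open I" and f: "smooth_on I f" "\<forall>t\<in>I. f t \<noteq> 0"
    and q: "q \<in> L" and L: "L = rw_space I c" and G: "G = rw_metric f c"
    and "X \<in> tangent_space L q" "Y q \<in> tangent_space L q" "Z q \<in> tangent_space L q"
    and Y: "(Y has_derivative Y') (at q)" and Z: "(Z has_derivative Z') (at q)"
  shows "frechet_derivative (\<lambda>r. G r (Y r) (Z r)) (at q) X =
     G q (levi_civita L G q X (Y q) (Y' X)) (Z q) + G q (Y q) (levi_civita L G q X (Z q) (Z' X))"
proof -
  have qI: "fst q \<in> I" "snd q \<in> space_form c" using q by (auto simp: L rw_space_def)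
  have fd: "f differentiable (at (fst q))" using f(1) qI unfolding smooth_on_def
    by (metis Ck_on.simps(2))
  have lc: "levi_civita L G q X A A' \<in> tangent_space L q \<and> (\<forall>B\<in>tangent_space L q.
     G q (levi_civita L G q X A A') B = G q A' B + christoffel G q X A B)" for A A'
    unfolding levi_civita_def using theI'[OF levi_civita_ex1[OF c I f q[unfolded L], folded L G, of A' X A]] by blast
  have sym: "G q a b = G q b a" for a b by (simp add: G rw_metric_def space_form_metric_def inner_commute)
  have df: "(f has_real_derivative deriv f (fst q)) (at (fst q))"
    using fd by (metis DERIV_deriv_iff_real_differentiable)
  have Yd: "((\<lambda>r. fst (Y r)) has_derivative (\<lambda>h. fst (Y' h))) (at q)" "((\<lambda>r. snd (Y r)) has_derivative (\<lambda>h. snd (Y' h))) (at q)"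
    "((\<lambda>r. fst (Z r)) has_derivative (\<lambda>h. fst (Z' h))) (at q)" "((\<lambda>r. snd (Z r)) has_derivative (\<lambda>h. snd (Z' h))) (at q)"
    using Y Z by (auto intro!: derivative_intros)
  have ff: "((\<lambda>r. f (fst r)) has_derivative (\<lambda>h. deriv f (fst q) * fst h)) (at q)"
    by (rule has_derivative_eq_rhs[OF DERIV_compose_FDERIV[where g=fst, OF df]]) (auto intro!: derivative_intros simp: fun_eq_iff)
  have "((\<lambda>r. G r (Y r) (Z r)) has_derivative
     (\<lambda>h. G q (Y' h) (Z q) + G q (Y q) (Z' h) + 2 * f (fst q) * deriv f (fst q) * fst h * space_form_metric c (snd (Y q)) (snd (Z q)))) (at q)"
    unfolding G rw_metric_def space_form_metric_def
    by (rule has_derivative_eq_rhs, (rule derivative_intros Yd ff)+)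
       (auto simp: fun_eq_iff algebra_simps power2_eq_square)
  note fr = frechet_derivative_at[OF this, symmetric]
  have "christoffel G q X (Y q) (Z q) + christoffel G q X (Z q) (Y q) =
    2 * f (fst q) * deriv f (fst q) * fst X * space_form_metric c (snd (Y q)) (snd (Z q))"
    unfolding G christoffel_rw[OF fd] by (simp add: space_form_metric_def algebra_simps inner_commute)
  moreover have "G q (levi_civita L G q X (Y q) (Y' X)) (Z q) = G q (Y' X) (Z q) + christoffel G q X (Y q) (Z q)"
    "G q (levi_civita L G q X (Z q) (Z' X)) (Y q) = G q (Z' X) (Y q) + christoffel G q X (Z q) (Y q)"
    using lc assms(9,10) by blast+
  ultimately show ?thesis unfolding fr sym[of "Y q"] by simp
qed

lemma levi_civita_torsion:
  assumes c: "c \<in> {-1,0,1}" and I: "open I" and f: "smooth_on I f" "\<forall>t\<in>I. f t \<noteq> 0"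
    and q: "q \<in> L" and L: "L = rw_space I c" and G: "G = rw_metric f c"
    and B: "open B" "q \<in> B"
    and tX: "\<And>y. y \<in> L \<inter> B \<Longrightarrow> X y \<in> tangent_space L y" and tY: "\<And>y. y \<in> L \<inter> B \<Longrightarrow> Y y \<in> tangent_space L y"
    and X: "(X has_derivative X') (at q)" and Y: "(Y has_derivative Y') (at q)"
  shows "levi_civita L G q (X q) (Y q) (Y' (X q)) - levi_civita L G q (Y q) (X q) (X' (Y q)) = Y' (X q) - X' (Y q)"
proof -
  have qI: "fst q \<in> I" "snd q \<in> space_form c" using q by (auto simp: L rw_space_def)
  have fd: "f differentiable (at (fst q))" using f(1) qI unfolding smooth_on_def
    by (metis Ck_on.simps(2))
  have ex: "\<exists>!V. V \<in> tangent_space L q \<and> (\<forall>B\<in>tangent_space L q.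
     G q V B = G q A' B + christoffel G q X A B)" for X A A'
    unfolding L G by (rule levi_civita_ex1[OF c I f q[unfolded L]])
  have lc: "levi_civita L G q X A A' \<in> tangent_space L q \<and> (\<forall>B\<in>tangent_space L q.
     G q (levi_civita L G q X A A') B = G q A' B + christoffel G q X A B)" for X A A'
    unfolding levi_civita_def using theI'[OF ex] by blast
  have tan: "tangent_space L y = {v. pairing c (snd y) (snd v) = 0}" if "y \<in> L" for y
    using tangent_rw[OF c I] that by (simp add: L)
  have br: "pairing c (snd A) (snd (Z q)) + pairing c (snd q) (snd (Z' A)) = 0"
    if "(Z has_derivative Z') (at q)" "A \<in> tangent_space L q" "\<And>y. y \<in> L \<inter> B \<Longrightarrow> Z y \<in> tangent_space L y" for A Z Z'
  proof (rule tangent_deriv[OF that(2) _ B])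
    show "((\<lambda>y. pairing c (snd y) (snd (Z y))) has_derivative (\<lambda>A. pairing c (snd A) (snd (Z q)) + pairing c (snd q) (snd (Z' A)))) (at q)"
      unfolding pairing_def by (rule has_derivative_eq_rhs, (rule derivative_intros that(1))+) (auto simp: algebra_simps)
    show "pairing c (snd y) (snd (Z y)) = 0" if "y \<in> L \<inter> B" for y
      using that tan \<open>\<And>y. y \<in> L \<inter> B \<Longrightarrow> Z y \<in> tangent_space L y\<close> by auto
  qed
  have "pairing c (snd q) (snd (Y' (X q) - X' (Y q))) = 0"
    using br[OF Y _ tY, of "X q"] br[OF X _ tX, of "Y q"] tX tY q B
    by (simp add: pairing_def algebra_simps inner_commute)
  then have "levi_civita L G q (Y q) (X q) (X' (Y q)) + (Y' (X q) - X' (Y q)) \<in> tangent_space L q"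
    using lc[of "Y q" "X q" "X' (Y q)"] q by (simp add: tan pairing_def algebra_simps)
  moreover have "G q (levi_civita L G q (Y q) (X q) (X' (Y q)) + (Y' (X q) - X' (Y q))) Z =
     G q (Y' (X q)) Z + christoffel G q (X q) (Y q) Z" if "Z \<in> tangent_space L q" for Z
  proof -
    have "G q (a + (b - e)) Z = G q a Z + G q b Z - G q e Z" for a b e
      by (simp add: G rw_metric_def space_form_metric_def algebra_simps)
    then show ?thesis using lc[of "Y q" "X q" "X' (Y q)"] that
      by (simp add: G christoffel_rw[OF fd]) (simp add: space_form_metric_def algebra_simps inner_commute)
  qed
  ultimately have "levi_civita L G q (X q) (Y q) (Y' (X q)) = levi_civita L G q (Y q) (X q) (X' (Y q)) + (Y' (X q) - X' (Y q))"
    using ex lc[of "X q" "Y q" "Y' (X q)"] by blast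
  then show ?thesis by simp
qed

end

theory Submission
  imports Defs
begin

text \<open>
  The component of \<open>\<nabla>\<^sub>X \<partial>\<^sub>t = (f'/f)(X - X\<^sub>t \<partial>\<^sub>t)\<close> along a frame vector orthogonal to \<open>\<partial>\<^sub>t\<close> ties the
  normal connection to the second fundamental form, so that \<open>X\<close> is a relative null vector iff
  \<open>\<nabla>\<^sub>X e\<^sub>3 = \<nabla>\<^sub>X e\<^sub>4 = 0\<close>.  If \<open>e\<^sub>1\<close> spans the null space, metric compatibility and the symmetry of the
  second fundamental form leave only the coefficients \<open>\<omega>, h\<^sup>3\<^sub>2\<^sub>2, h\<^sup>4\<^sub>2\<^sub>2\<close>.

  Suppose that the null field \<open>N\<close> is not a multiple of \<open>e\<^sub>1\<close> at some point, hence on an open set.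
  For \<open>V \<in> {e\<^sub>3, e\<^sub>4}\<close> one has \<open>\<nabla>\<^sub>N V = 0\<close> and \<open>\<langle>\<nabla>\<^sub>Z V, N\<rangle> = 0\<close>, so
  \<open>\<langle>R(N, e\<^sub>1)V, N\<rangle> = - \<langle>\<nabla>\<^bsub>e\<^sub>1\<^esub> V, \<nabla>\<^sub>N N\<rangle>\<close>, while the curvature of the space-time gives
  \<open>\<langle>R(N, e\<^sub>1)V, N\<rangle> = - V\<^sub>t K cosh \<theta> \<langle>N, e\<^sub>2\<rangle>\<^sup>2\<close> with \<open>K = f''/f - (f'\<^sup>2 + c)/f\<^sup>2\<close>.  For \<open>V = e\<^sub>3\<close> this
  is nonzero, so \<open>\<nabla>\<^sub>N N\<close> is not a multiple of \<open>N\<close>; for \<open>V = e\<^sub>4\<close> it is zero, so \<open>e\<^sub>4\<close> is parallel.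
  Then \<open>f e\<^sub>4\<close> is constant in \<open>\<real>\<^sup>4\<close>, and an open part of the surface lies in the totally geodesic
  hypersurface normal to it.
\<close>

section \<open>Calculus of smooth maps\<close>

lemma has_frechet_derivative:
  "F differentiable net \<Longrightarrow> (F has_derivative frechet_derivative F net) net"
  by (simp add: frechet_derivative_works)

declare Ck_on.simps(2) [simp del]

text \<open>Both notions are built from \<open>has_derivative\<close>, which is local. The equality
  asks for no differentiability: where no derivative exists, the two choice terms still choose from
  the same predicate.\<close>

lemma frechet_derivative_cong_open:
  assumes "open S" "u \<in> S" "\<And>v. v \<in> S \<Longrightarrow> F v = H v"
  shows "frechet_derivative F (at u) = frechet_derivative H (at u)"
    and "F differentiable (at u) \<longleftrightarrow> H differentiable (at u)"
proof -
  have "(F has_derivative D) (at u) \<longleftrightarrow> (H has_derivative D) (at u)" for D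
    using has_derivative_transform_within_open[OF _ assms(1,2)] assms(3) by metis
  then show "frechet_derivative F (at u) = frechet_derivative H (at u)"
    and "F differentiable (at u) \<longleftrightarrow> H differentiable (at u)"
    by (simp_all add: frechet_derivative_def differentiable_def)
qed

lemma Ck_on_cong:
  assumes "open S" "\<And>u. u \<in> S \<Longrightarrow> F u = H u"
  shows "Ck_on k S F \<longleftrightarrow> Ck_on k S H"
  using assms(2)
proof (induction k arbitrary: F H)
  case 0
  then show ?case by (simp cong: continuous_on_cong)
next
  case (Suc k)
  have "frechet_derivative F (at u) = frechet_derivative H (at u)"
       "F differentiable (at u) \<longleftrightarrow> H differentiable (at u)" if "u \<in> S" for u
    using frechet_derivative_cong_open[OF assms(1) that] Suc.prems by auto
  moreover from this have "Ck_on k S (\<lambda>u. frechet_derivative F (at u) v) \<longleftrightarrow> Ck_on k S (\<lambda>u. frechet_derivative H (at u) v)" for v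
    by (intro Suc.IH) simp
  ultimately show ?case by (simp add: Ck_on.simps(2))
qed

lemma smooth_on_cong:
  assumes "open S" "\<And>u. u \<in> S \<Longrightarrow> F u = H u"
  shows "smooth_on S F \<longleftrightarrow> smooth_on S H"
  unfolding smooth_on_def using Ck_on_cong[OF assms] by simp

lemma Ck_on_subset:
  "Ck_on k S F \<Longrightarrow> T \<subseteq> S \<Longrightarrow> Ck_on k T F"
  by (induction k arbitrary: F) (auto simp: Ck_on.simps(2) intro: continuous_on_subset)

lemma smooth_on_subset:
  "smooth_on S F \<Longrightarrow> T \<subseteq> S \<Longrightarrow> smooth_on T F"
  unfolding smooth_on_def using Ck_on_subset by blast

lemma Ck_on_SucD:
  assumes "Ck_on (Suc k) S F"
  shows "u \<in> S \<Longrightarrow> (F has_derivative frechet_derivative F (at u)) (at u)"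
    and "Ck_on k S (\<lambda>u. frechet_derivative F (at u) v)"
  using assms by (auto simp: Ck_on.simps(2) intro: has_frechet_derivative)

text \<open>Lets an explicit derivative \<open>D\<close> stand for
  \<open>frechet_derivative\<close>, so that each closure property below is one derivative rule plus
  the induction hypothesis. Openness of \<open>S\<close> is what permits the exchange under
  \<open>Ck_on\<close>.\<close>

lemma Ck_on_SucI:
  assumes S: "open S" and d: "\<And>u. u \<in> S \<Longrightarrow> (F has_derivative D u) (at u)"
    and D: "\<And>v. Ck_on k S (\<lambda>u. D u v)"
  shows "Ck_on (Suc k) S F"
proof -
  have "Ck_on k S (\<lambda>u. frechet_derivative F (at u) v)" for v
    by (rule Ck_on_cong[OF S, THEN iffD1, OF _ D]) (simp add: frechet_derivative_at[OF d])
  then show ?thesis unfolding Ck_on.simps(2) using d differentiable_def by blast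
qed

lemma Ck_on_mono:
  "Ck_on (Suc k) S F \<Longrightarrow> Ck_on k S F"
proof (induction k arbitrary: F)
  case 0
  then show ?case
    by (simp add: Ck_on.simps(2) continuous_at_imp_continuous_on differentiable_imp_continuous_within)
next
  case (Suc k)
  show ?case
    unfolding Ck_on.simps(2)[of k] using Suc.prems[unfolded Ck_on.simps(2)[of "Suc k"]] Suc.IH by blast
qed

lemma smooth_on_differentiable:
  "smooth_on S F \<Longrightarrow> u \<in> S \<Longrightarrow> F differentiable (at u)"
  unfolding smooth_on_def using Ck_on.simps(2)[of 0 S F] by blast

lemma smooth_on_has_derivative:
  "smooth_on S F \<Longrightarrow> u \<in> S \<Longrightarrow> (F has_derivative frechet_derivative F (at u)) (at u)"
  using smooth_on_differentiable has_frechet_derivative by blast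

lemma smooth_on_derivative:
  "smooth_on S F \<Longrightarrow> smooth_on S (\<lambda>u. frechet_derivative F (at u) v)"
  unfolding smooth_on_def using Ck_on.simps(2)[of _ S F] by blast

lemma smooth_on_continuous:
  "smooth_on S F \<Longrightarrow> continuous_on S F"
  unfolding smooth_on_def using Ck_on.simps(1)[of S F] by blast

lemma Ck_on_const: "Ck_on k S (\<lambda>u. d)"
  by (induction k arbitrary: d) (auto simp: Ck_on.simps(2) frechet_derivative_const)

lemma smooth_on_const [intro]: "smooth_on S (\<lambda>u. d)"
  by (simp add: smooth_on_def Ck_on_const)

lemma Ck_on_linear_compose:
  assumes S: "open S" and l: "bounded_linear l"
  shows "Ck_on k S F \<Longrightarrow> Ck_on k S (\<lambda>u. l (F u))"
proof (induction k arbitrary: F)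
  case 0
  then show ?case using l by (simp add: bounded_linear.continuous_on)
next
  case (Suc k)
  show ?case
    by (rule Ck_on_SucI[OF S bounded_linear.has_derivative[OF l Ck_on_SucD(1)[OF Suc.prems]]
          Suc.IH[OF Ck_on_SucD(2)[OF Suc.prems]]])
qed

lemma smooth_on_linear_compose:
  "open S \<Longrightarrow> bounded_linear l \<Longrightarrow> smooth_on S F \<Longrightarrow> smooth_on S (\<lambda>u. l (F u))"
  by (simp add: smooth_on_def Ck_on_linear_compose)

lemma Ck_on_add:
  assumes S: "open S"
  shows "Ck_on k S F \<Longrightarrow> Ck_on k S H \<Longrightarrow> Ck_on k S (\<lambda>u. F u + H u)"
proof (induction k arbitrary: F H)
  case 0
  then show ?case by (simp add: continuous_on_add)
next
  case (Suc k)
  show ?case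
    by (rule Ck_on_SucI[OF S has_derivative_add[OF Suc.prems[THEN Ck_on_SucD(1)]]
          Suc.IH[OF Suc.prems[THEN Ck_on_SucD(2)]]])
qed

text \<open>The product rule pairs each factor with the derivative of the other, so the induction
  step also uses the undifferentiated factors one order lower (\<open>Ck_on_mono\<close>) and
  closure under sums.\<close>

lemma Ck_on_bilinear:
  assumes S: "open S" and b: "bounded_bilinear b"
  shows "Ck_on k S F \<Longrightarrow> Ck_on k S H \<Longrightarrow> Ck_on k S (\<lambda>u. b (F u) (H u))"
proof (induction k arbitrary: F H)
  case 0
  then show ?case using b by (simp add: bounded_bilinear.continuous_on)
next
  case (Suc k)
  show ?case
    by (rule Ck_on_SucI[OF S bounded_bilinear.FDERIV[OF b Suc.prems[THEN Ck_on_SucD(1)]]])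
       (assumption | rule Ck_on_add[OF S] Suc.IH Suc.prems[THEN Ck_on_mono] Suc.prems[THEN Ck_on_SucD(2)])+
qed

lemma smooth_on_add:
  "open S \<Longrightarrow> smooth_on S F \<Longrightarrow> smooth_on S H \<Longrightarrow> smooth_on S (\<lambda>u. F u + H u)"
  by (simp add: smooth_on_def Ck_on_add)

lemma smooth_on_bilinear:
  "open S \<Longrightarrow> bounded_bilinear b \<Longrightarrow> smooth_on S F \<Longrightarrow> smooth_on S H \<Longrightarrow> smooth_on S (\<lambda>u. b (F u) (H u))"
  by (simp add: smooth_on_def Ck_on_bilinear)

lemmas smooth_on_mult = smooth_on_bilinear[OF _ bounded_bilinear_mult]
  and smooth_on_scaleR = smooth_on_bilinear[OF _ bounded_bilinear_scaleR]
  and smooth_on_inner = smooth_on_bilinear[OF _ bounded_bilinear_inner]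
  and smooth_on_fst = smooth_on_linear_compose[OF _ bounded_linear_fst]
  and smooth_on_snd = smooth_on_linear_compose[OF _ bounded_linear_snd]
  and smooth_on_minus = smooth_on_linear_compose[OF _ bounded_linear_minus[OF bounded_linear_ident]]

lemma smooth_on_diff:
  assumes "open S" "smooth_on S F" "smooth_on S H" shows "smooth_on S (\<lambda>u. F u - H u)"
  using smooth_on_add[OF assms(1,2) smooth_on_minus[OF assms(1,3)]] by simp

lemma smooth_on_Pair:
  fixes F :: "'a::real_normed_vector \<Rightarrow> 'b::real_normed_vector" and H :: "'a \<Rightarrow> 'c::real_normed_vector"
  assumes "open S" "smooth_on S F" "smooth_on S H" shows "smooth_on S (\<lambda>u. (F u, H u))"
proof -
  have "bounded_linear (\<lambda>a :: 'b. (a, 0 :: 'c))" "bounded_linear (\<lambda>b :: 'c. (0 :: 'b, b))"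
    by (simp_all add: bounded_linear_Pair bounded_linear_ident bounded_linear_zero)
  from smooth_on_add[OF assms(1) smooth_on_linear_compose[OF assms(1) this(1) assms(2)]
      smooth_on_linear_compose[OF assms(1) this(2) assms(3)]]
  show ?thesis by simp
qed

lemma frechet_derivative_real:
  fixes g :: "real \<Rightarrow> real"
  assumes "g differentiable (at t)"
  shows "(g has_real_derivative frechet_derivative g (at t) 1) (at t)"
    and "deriv g t = frechet_derivative g (at t) 1"
proof -
  show "(g has_real_derivative frechet_derivative g (at t) 1) (at t)"
    unfolding has_field_derivative_def
  proof (rule has_derivative_eq_rhs[OF has_frechet_derivative[OF assms]], rule ext)
    fix h
    show "frechet_derivative g (at t) h = frechet_derivative g (at t) 1 * h"
      using linear_cmul[OF linear_frechet_derivative[OF assms], of h 1] by simp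
  qed
  then show "deriv g t = frechet_derivative g (at t) 1" by (rule DERIV_imp_deriv)
qed

text \<open>Outer functions of one real variable are enough for \<open>f\<close>, its derivatives
  and \<open>inverse\<close>. The derivative of the composite is a product whose second factor is
  again a composite with the same \<open>h\<close>, so the induction varies only
  \<open>g\<close>.\<close>

lemma Ck_on_compose_real:
  fixes g :: "real \<Rightarrow> real"
  assumes S: "open S"
  shows "Ck_on k I g \<Longrightarrow> Ck_on k S h \<Longrightarrow> h ` S \<subseteq> I \<Longrightarrow> Ck_on k S (\<lambda>u. g (h u))"
proof (induction k arbitrary: g)
  case 0
  then show ?case by (auto intro: continuous_on_compose2)
next
  case (Suc k)
  have d: "((\<lambda>u. g (h u)) has_derivative
      (\<lambda>v. frechet_derivative h (at u) v * frechet_derivative g (at (h u)) 1)) (at u)" if "u \<in> S" for u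
    using Suc.prems(3) that Ck_on_SucD(1)[OF Suc.prems(1)] differentiableI[of g]
    by (intro DERIV_compose_FDERIV frechet_derivative_real Ck_on_SucD(1)[OF Suc.prems(2)]) auto
  show ?case
    by (rule Ck_on_SucI[OF S d])
       (auto intro!: Ck_on_bilinear[OF S bounded_bilinear_mult] Ck_on_SucD(2)[OF Suc.prems(2)] Suc.prems(3)
         Suc.IH[of "\<lambda>t. frechet_derivative g (at t) 1"] Ck_on_SucD(2)[OF Suc.prems(1)] Ck_on_mono[OF Suc.prems(2)])
qed

lemma smooth_on_compose_real:
  fixes g :: "real \<Rightarrow> real"
  shows "open S \<Longrightarrow> smooth_on I g \<Longrightarrow> smooth_on S h \<Longrightarrow> h ` S \<subseteq> I \<Longrightarrow> smooth_on S (\<lambda>u. g (h u))"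
  unfolding smooth_on_def using Ck_on_compose_real by blast

text \<open>The derivative of \<open>inverse\<close> is a constant multiple of
  \<open>inverse\<close> times itself, so the induction closes under products alone.\<close>

lemma Ck_on_inverse: "Ck_on k (- {0}) (inverse :: real \<Rightarrow> real)"
proof (induction k)
  case 0
  show ?case by (auto intro!: continuous_intros)
next
  case (Suc k)
  have S: "open (- {0::real})" by auto
  have d: "((inverse :: real \<Rightarrow> real) has_derivative (\<lambda>v. (inverse u * inverse u) * (- v))) (at u)" if "u \<in> - {0}" for u
    by (rule has_derivative_eq_rhs[OF has_derivative_inverse'[OF _]]) (use that in \<open>auto simp: fun_eq_iff\<close>)
  show ?case
    by (rule Ck_on_SucI[OF S d])
       (assumption | rule Ck_on_bilinear[OF S bounded_bilinear_mult] Suc.IH Ck_on_const)+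
qed

lemma smooth_on_inverse:
  fixes h :: "'a::real_normed_vector \<Rightarrow> real"
  assumes "open S" "smooth_on S h" "\<And>u. u \<in> S \<Longrightarrow> h u \<noteq> 0"
  shows "smooth_on S (\<lambda>u. inverse (h u))"
  by (rule smooth_on_compose_real[OF assms(1) _ assms(2)]) (use assms(3) Ck_on_inverse in \<open>auto simp: smooth_on_def\<close>)

lemma smooth_on_divide:
  fixes g h :: "'a::real_normed_vector \<Rightarrow> real"
  assumes "open S" "smooth_on S g" "smooth_on S h" "\<And>u. u \<in> S \<Longrightarrow> h u \<noteq> 0"
  shows "smooth_on S (\<lambda>u. g u / h u)"
  unfolding divide_inverse using assms by (intro smooth_on_mult smooth_on_inverse) auto

lemma smooth_on_deriv:
  fixes g :: "real \<Rightarrow> real"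
  assumes "open S" "smooth_on S g" shows "smooth_on S (deriv g)"
  using smooth_on_derivative[OF assms(2), of 1]
  by (subst smooth_on_cong[OF assms(1)])
     (auto intro: frechet_derivative_real smooth_on_differentiable[OF assms(2)])

section \<open>Mean values and the symmetry of second derivatives\<close>

lemma directional_mean_value:
  fixes F :: "'a::real_normed_vector \<Rightarrow> real"
  assumes d: "\<And>s. 0 \<le> s \<Longrightarrow> s \<le> r \<Longrightarrow> (F has_derivative F' s) (at (u + s *\<^sub>R a))" and r: "r > 0"
  shows "\<exists>s. 0 < s \<and> s < r \<and> F (u + r *\<^sub>R a) - F u = r * F' s a"
proof -
  have D: "((\<lambda>s. F (u + s *\<^sub>R a)) has_real_derivative F' s a) (at s)" if s: "0 \<le> s" "s \<le> r" for s
  proof -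
    have "((\<lambda>s. u + s *\<^sub>R a) has_derivative (\<lambda>h. h *\<^sub>R a)) (at s)"
      by (auto intro!: derivative_eq_intros)
    from has_derivative_compose[OF this d[OF s]]
    show ?thesis
      using linear_cmul[OF has_derivative_linear[OF d[OF s]]]
      by (simp add: has_field_derivative_def mult_commute_abs)
  qed
  from MVT2[OF r D] show ?thesis by auto
qed

text \<open>Schwarz: the second difference along \<open>a\<close> and \<open>b\<close> is, by two applications of the mean value
  theorem, a value near \<open>u\<close> of either mixed derivative.\<close>

lemma second_difference:
  fixes F :: "'a::real_normed_vector \<Rightarrow> real"
  assumes F: "smooth_on S F" and r: "r > 0"
    and S: "\<And>s t. 0 \<le> s \<Longrightarrow> s \<le> r \<Longrightarrow> 0 \<le> t \<Longrightarrow> t \<le> r \<Longrightarrow> u + s *\<^sub>R a + t *\<^sub>R b \<in> S"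
  shows "\<exists>s t. 0 \<le> s \<and> s \<le> r \<and> 0 \<le> t \<and> t \<le> r \<and>
    F (u + r *\<^sub>R a + r *\<^sub>R b) - F (u + r *\<^sub>R a) - (F (u + r *\<^sub>R b) - F u) =
    r * r * frechet_derivative (\<lambda>v. frechet_derivative F (at v) a) (at (u + s *\<^sub>R a + t *\<^sub>R b)) b"
proof -
  define H where "H = (\<lambda>v. F (v + r *\<^sub>R b) - F v)"
  have "(H has_derivative (\<lambda>h. frechet_derivative F (at (u + s *\<^sub>R a + r *\<^sub>R b)) h - frechet_derivative F (at (u + s *\<^sub>R a)) h)) (at (u + s *\<^sub>R a))"
    if "0 \<le> s" "s \<le> r" for s
  proof -
    have "((\<lambda>v. v + r *\<^sub>R b) has_derivative (\<lambda>h. h)) (at (u + s *\<^sub>R a))"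
      by (auto intro!: derivative_eq_intros)
    from has_derivative_compose[OF this smooth_on_has_derivative[OF F]]
    show ?thesis unfolding H_def using that r S[of s 0] S[of s r]
      by (intro has_derivative_diff smooth_on_has_derivative[OF F]) auto
  qed
  from directional_mean_value[OF this r] obtain s where s: "0 < s" "s < r"
    and 1: "H (u + r *\<^sub>R a) - H u = r * (frechet_derivative F (at (u + s *\<^sub>R a + r *\<^sub>R b)) a - frechet_derivative F (at (u + s *\<^sub>R a)) a)"
    by blast
  have "\<exists>t. 0 < t \<and> t < r \<and> frechet_derivative F (at (u + s *\<^sub>R a + r *\<^sub>R b)) a - frechet_derivative F (at (u + s *\<^sub>R a)) a
    = r * frechet_derivative (\<lambda>v. frechet_derivative F (at v) a) (at (u + s *\<^sub>R a + t *\<^sub>R b)) b"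
    by (rule directional_mean_value[OF smooth_on_has_derivative[OF smooth_on_derivative[OF F]] r])
       (use s S in auto)
  then obtain t where t: "0 < t" "t < r" and 2: "frechet_derivative F (at (u + s *\<^sub>R a + r *\<^sub>R b)) a - frechet_derivative F (at (u + s *\<^sub>R a)) a
    = r * frechet_derivative (\<lambda>v. frechet_derivative F (at v) a) (at (u + s *\<^sub>R a + t *\<^sub>R b)) b"
    by blast
  show ?thesis using s t 1 2 by (intro exI[of _ s] exI[of _ t]) (simp add: H_def)
qed

text \<open>The second difference is symmetric in \<open>a\<close> and \<open>b\<close>, so the two
  mixed derivatives agree at two points near \<open>u\<close>; by continuity their values at
  \<open>u\<close> then differ by at most any positive \<open>e\<close>.\<close>

lemma symmetric_second_derivative_real:
  fixes F :: "'a::real_normed_vector \<Rightarrow> real"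
  assumes "open S" and F: "smooth_on S F" and u: "u \<in> S"
  shows "frechet_derivative (\<lambda>v. frechet_derivative F (at v) a) (at u) b =
    frechet_derivative (\<lambda>v. frechet_derivative F (at v) b) (at u) a"
proof -
  define D where "D = (\<lambda>a b v. frechet_derivative (\<lambda>v. frechet_derivative F (at v) a) (at v) b)"
  have "isCont (D a b) u" for a b
    using smooth_on_continuous[OF smooth_on_derivative[OF smooth_on_derivative[OF F]]] assms(1) u
    by (simp add: D_def continuous_on_eq_continuous_at)
  then have cont: "\<exists>\<delta>>0. \<forall>v. norm (v - u) < \<delta> \<longrightarrow> \<bar>D a b v - D a b u\<bar> < e" if "e > 0" for a b e
    using that by (auto simp: continuous_at_eps_delta dist_norm)
  obtain \<rho> where \<rho>: "\<rho> > 0" "\<And>v. norm (v - u) < \<rho> \<Longrightarrow> v \<in> S"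
    using assms(1) u by (metis open_dist dist_norm)
  have "\<bar>D a b u - D b a u\<bar> \<le> e" if e: "e > 0" for e
  proof -
    obtain \<delta>1 where 1: "\<delta>1 > 0" "\<And>v. norm (v - u) < \<delta>1 \<Longrightarrow> \<bar>D a b v - D a b u\<bar> < e/2"
      using cont[OF half_gt_zero[OF e]] by blast
    obtain \<delta>2 where 2: "\<delta>2 > 0" "\<And>v. norm (v - u) < \<delta>2 \<Longrightarrow> \<bar>D b a v - D b a u\<bar> < e/2"
      using cont[OF half_gt_zero[OF e]] by blast
    define d where "d = min \<rho> (min \<delta>1 \<delta>2)"
    \<comment> \<open>The step \<open>r\<close> is small enough for the parallelogram with sides
      \<open>r *\<^sub>R a\<close> and \<open>r *\<^sub>R b\<close> at \<open>u\<close> to stay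
      within \<open>d\<close>; the summand 1 keeps \<open>K\<close> positive when \<open>a\<close>
      and \<open>b\<close> vanish.\<close>
    define K where "K = norm a + norm b + 1"
    define r where "r = d / (2 * K)"
    have K: "K > 0" by (simp add: K_def add_nonneg_pos)
    have d: "d > 0" and r: "r > 0" using \<rho> 1 2 K by (auto simp: d_def r_def)
    have near: "norm (s *\<^sub>R a + t *\<^sub>R b) < d" if "0 \<le> s" "s \<le> r" "0 \<le> t" "t \<le> r" for s t
    proof -
      have "norm (s *\<^sub>R a + t *\<^sub>R b) \<le> s * norm a + t * norm b"
        using that norm_triangle_ineq[of "s *\<^sub>R a" "t *\<^sub>R b"] by simp
      also have "\<dots> \<le> r * norm a + r * norm b" using that by (intro add_mono mult_right_mono) auto
      also have "\<dots> \<le> r * K" using r by (simp add: K_def algebra_simps)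
      also have "\<dots> = d / 2"
        using K by (simp add: r_def)
      finally show ?thesis using d by simp
    qed
    have S1: "u + s *\<^sub>R a + t *\<^sub>R b \<in> S" if "0 \<le> s" "s \<le> r" "0 \<le> t" "t \<le> r" for s t
      by (rule \<rho>(2)) (use near[OF that] in \<open>simp add: d_def add.assoc\<close>)
    have S2: "u + s *\<^sub>R b + t *\<^sub>R a \<in> S" if "0 \<le> s" "s \<le> r" "0 \<le> t" "t \<le> r" for s t
      using S1[OF that(3,4,1,2)] by (simp add: algebra_simps)
    from second_difference[OF F r S1] obtain s t where st: "0 \<le> s" "s \<le> r" "0 \<le> t" "t \<le> r"
      "F (u + r *\<^sub>R a + r *\<^sub>R b) - F (u + r *\<^sub>R a) - (F (u + r *\<^sub>R b) - F u) = r * r * D a b (u + s *\<^sub>R a + t *\<^sub>R b)"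
      unfolding D_def by blast
    from second_difference[OF F r S2] obtain s' t' where st': "0 \<le> s'" "s' \<le> r" "0 \<le> t'" "t' \<le> r"
      "F (u + r *\<^sub>R b + r *\<^sub>R a) - F (u + r *\<^sub>R b) - (F (u + r *\<^sub>R a) - F u) = r * r * D b a (u + s' *\<^sub>R b + t' *\<^sub>R a)"
      unfolding D_def by blast
    have "r * r * D a b (u + s *\<^sub>R a + t *\<^sub>R b) = r * r * D b a (u + s' *\<^sub>R b + t' *\<^sub>R a)"
      using st(5) st'(5) by (simp add: algebra_simps)
    then have "D a b (u + s *\<^sub>R a + t *\<^sub>R b) = D b a (u + s' *\<^sub>R b + t' *\<^sub>R a)" using r by simp
    moreover have "\<bar>D a b (u + s *\<^sub>R a + t *\<^sub>R b) - D a b u\<bar> < e/2"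
      using near[OF st(1-4)] by (intro 1) (simp add: d_def add.assoc)
    moreover have "\<bar>D b a (u + s' *\<^sub>R b + t' *\<^sub>R a) - D b a u\<bar> < e/2"
      using near[OF st'(3,4,1,2)] by (intro 2) (simp add: d_def algebra_simps)
    ultimately show ?thesis by linarith
  qed
  then have "\<bar>D a b u - D b a u\<bar> \<le> 0" by (meson dense_ge)
  then show ?thesis by (simp add: D_def)
qed

lemma symmetric_second_derivative:
  fixes F :: "'a::real_normed_vector \<Rightarrow> 'b::euclidean_space"
  assumes S: "open S" and F: "smooth_on S F" and u: "u \<in> S"
  shows "frechet_derivative (\<lambda>v. frechet_derivative F (at v) a) (at u) b =
    frechet_derivative (\<lambda>v. frechet_derivative F (at v) b) (at u) a"
proof (rule euclidean_eqI)
  fix i :: 'b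
  have d: "frechet_derivative (\<lambda>v. H v \<bullet> i) (at v) = (\<lambda>h. frechet_derivative H (at v) h \<bullet> i)"
    if "smooth_on S H" "v \<in> S" for H :: "'a \<Rightarrow> 'b" and v
    by (rule frechet_derivative_at[symmetric])
       (auto intro!: derivative_eq_intros smooth_on_has_derivative[OF that])
  have "frechet_derivative (\<lambda>v. frechet_derivative (\<lambda>v. F v \<bullet> i) (at v) a) (at u) b =
    frechet_derivative (\<lambda>v. frechet_derivative F (at v) a) (at u) b \<bullet> i" for a b
  proof -
    have "frechet_derivative (\<lambda>v. frechet_derivative (\<lambda>v. F v \<bullet> i) (at v) a) (at u) =
      frechet_derivative (\<lambda>v. frechet_derivative F (at v) a \<bullet> i) (at u)"
      by (rule frechet_derivative_cong_open[OF S u]) (simp add: d[OF F])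
    then show ?thesis using d[OF smooth_on_derivative[OF F] u] by simp
  qed
  then show "frechet_derivative (\<lambda>v. frechet_derivative F (at v) a) (at u) b \<bullet> i =
    frechet_derivative (\<lambda>v. frechet_derivative F (at v) b) (at u) a \<bullet> i"
    using symmetric_second_derivative_real[OF S _ u, of "\<lambda>v. F v \<bullet> i" a b]
      smooth_on_linear_compose[OF S bounded_linear_inner_left F, of i] by simp
qed

section \<open>The quadric pairing and the space form metric as bounded bilinear maps\<close>

lemma pairing_simps [simp]:
  "pairing c (v + v') w = pairing c v w + pairing c v' w"
  "pairing c w (v + v') = pairing c w v + pairing c w v'"
  "pairing c (v - v') w = pairing c v w - pairing c v' w"
  "pairing c w (v - v') = pairing c w v - pairing c w v'"
  "pairing c (r *\<^sub>R v) w = r * pairing c v w"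
  "pairing c w (r *\<^sub>R v) = r * pairing c w v"
  "pairing c 0 w = 0" "pairing c w 0 = 0"
  by (simp_all add: pairing_def algebra_simps)

lemma pairing_commute: "pairing c v w = pairing c w v"
  by (simp add: pairing_def inner_commute)

lemma space_form_metric_simps [simp]:
  "space_form_metric c (v + v') w = space_form_metric c v w + space_form_metric c v' w"
  "space_form_metric c w (v + v') = space_form_metric c w v + space_form_metric c w v'"
  "space_form_metric c (v - v') w = space_form_metric c v w - space_form_metric c v' w"
  "space_form_metric c w (v - v') = space_form_metric c w v - space_form_metric c w v'"
  "space_form_metric c (r *\<^sub>R v) w = r * space_form_metric c v w"
  "space_form_metric c w (r *\<^sub>R v) = r * space_form_metric c w v"
  "space_form_metric c 0 w = 0" "space_form_metric c w 0 = 0"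
  by (simp_all add: space_form_metric_def algebra_simps)

lemma space_form_metric_commute: "space_form_metric c v w = space_form_metric c w v"
  by (simp add: space_form_metric_def inner_commute)

lemma bounded_bilinear_pairing: "bounded_bilinear (pairing c)"
proof -
  have "pairing c = (\<lambda>v w. v \<bullet> (fst w, c *\<^sub>R snd w))"
    by (auto simp: fun_eq_iff pairing_def inner_prod_def)
  moreover have "bounded_linear (\<lambda>w :: R4. (fst w, c *\<^sub>R snd w))"
    by (intro bounded_linear_intros)
  ultimately show ?thesis
    using bounded_bilinear.comp[OF bounded_bilinear_inner bounded_linear_ident] by simp
qed

lemma bounded_bilinear_space_form_metric: "bounded_bilinear (space_form_metric c)"
proof -
  have "space_form_metric c = (\<lambda>v w. v \<bullet> (c * fst w, snd w))"
    by (auto simp: fun_eq_iff space_form_metric_def inner_prod_def)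
  moreover have "bounded_linear (\<lambda>w :: R4. (c * fst w, snd w))"
    by (intro bounded_linear_intros)
  ultimately show ?thesis
    using bounded_bilinear.comp[OF bounded_bilinear_inner bounded_linear_ident] by simp
qed

lemmas has_derivative_pairing = bounded_bilinear.FDERIV[OF bounded_bilinear_pairing]
  and has_derivative_metric = bounded_bilinear.FDERIV[OF bounded_bilinear_space_form_metric]

section \<open>The connection and curvature of Robertson-Walker space-times\<close>

locale robertson_walker =
  fixes c :: real and I :: "real set" and f :: "real \<Rightarrow> real"
    and L :: "R5 set" and G :: "R5 \<Rightarrow> R5 \<Rightarrow> R5 \<Rightarrow> real"
  assumes c: "c \<in> {-1, 0, 1}" and I: "open I"
    and f: "smooth_on I f" "\<forall>t\<in>I. f t \<noteq> 0"
    and L: "L = rw_space I c" and G: "G = rw_metric f c"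
begin

abbreviation m :: "R4 \<Rightarrow> R4 \<Rightarrow> real" where "m \<equiv> space_form_metric c"
abbreviation pr :: "R4 \<Rightarrow> R4 \<Rightarrow> real" where "pr \<equiv> pairing c"

lemma fst_L: "q \<in> L \<Longrightarrow> fst q \<in> I"
  and snd_L: "q \<in> L \<Longrightarrow> snd q \<in> space_form c"
  by (auto simp: L rw_space_def)

lemma pr_position: "q \<in> L \<Longrightarrow> pr (snd q) (snd q) = 1"
  using snd_L by (simp add: space_form_sub)

lemma f_nonzero: "q \<in> L \<Longrightarrow> f (fst q) \<noteq> 0"
  using f fst_L by auto

lemma tangent_L: "q \<in> L \<Longrightarrow> v \<in> tangent_space L q \<longleftrightarrow> pr (snd q) (snd v) = 0"
  unfolding L by (subst tangent_rw[OF c I]) simp_all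

lemma subspace_tangent_L: "q \<in> L \<Longrightarrow> subspace (tangent_space L q)"
  by (simp add: subspace_def tangent_L)

lemma partial_t_tangent: "q \<in> L \<Longrightarrow> partial_t \<in> tangent_space L q"
  by (simp add: tangent_L partial_t_def)

lemma f_deriv: "t \<in> I \<Longrightarrow> (f has_real_derivative deriv f t) (at t)"
  and f_deriv2: "t \<in> I \<Longrightarrow> (deriv f has_real_derivative deriv (deriv f) t) (at t)"
  using smooth_on_differentiable[OF f(1)] smooth_on_differentiable[OF smooth_on_deriv[OF I f(1)]]
  by (metis DERIV_deriv_iff_real_differentiable)+

lemma G_simps [simp]:
  "G q (v + v') w = G q v w + G q v' w"
  "G q w (v + v') = G q w v + G q w v'"
  "G q (v - v') w = G q v w - G q v' w"
  "G q w (v - v') = G q w v - G q w v'"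
  "G q (r *\<^sub>R v) w = r * G q v w"
  "G q w (r *\<^sub>R v) = r * G q w v"
  "G q (- v) w = - G q v w"
  "G q w (- v) = - G q w v"
  "G q 0 w = 0" "G q w 0 = 0"
  by (simp_all add: G rw_metric_def algebra_simps space_form_metric_def)

lemma G_commute: "G q v w = G q w v"
  by (simp add: G rw_metric_def space_form_metric_commute)

lemma G_partial_t: "G q v partial_t = - fst v"
  by (simp add: G rw_metric_def partial_t_def)

text \<open>For \<open>c = 0\<close> the position vector is not \<open>m\<close>-orthogonal to the space form, but then the
  first factor vanishes.\<close>

lemma pr_m_position:
  assumes "q \<in> L" "v \<in> tangent_space L q" "w \<in> tangent_space L q" "z \<in> tangent_space L q"
  shows "pr (snd v) (snd w) * m (snd q) (snd z) = 0"
proof (cases "c = 0")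
  case True
  then show ?thesis using assms snd_L[OF assms(1)] by (auto simp: tangent_L pairing_def space_form_def)
next
  case False
  then have "c \<in> {-1, 1}" using c by auto
  from pairing_metric[OF this, of "snd q" "snd z"] False show ?thesis
    using assms by (simp add: tangent_L)
qed

text \<open>For \<open>c = 0\<close> tangency forces the first coordinates to vanish, and with them
  both sides; otherwise this is \<open>pairing_metric\<close>. It is how the constant
  \<open>c\<close> enters the curvature.\<close>

lemma pr_eq_m:
  assumes "q \<in> L" "v \<in> tangent_space L q" "w \<in> tangent_space L q"
  shows "pr (snd v) (snd w) = c * m (snd v) (snd w)"
proof (cases "c = 0")
  case True
  then show ?thesis using assms snd_L[OF assms(1)] by (auto simp: tangent_L pairing_def space_form_def)
next
  case False
  then show ?thesis using c pairing_metric by auto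
qed

text \<open>The connection form: componentwise derivatives are corrected by \<open>Gam\<close>, whose
  multiple of \<open>snd q\<close> compensates the curvature of the space form in \<open>\<real>\<^sup>4\<close>.\<close>

definition Gam :: "R5 \<Rightarrow> R5 \<Rightarrow> R5 \<Rightarrow> R5" where
  "Gam q X V = (f (fst q) * deriv f (fst q) * m (snd X) (snd V),
     pr (snd X) (snd V) *\<^sub>R snd q +
     (deriv f (fst q) / f (fst q)) *\<^sub>R (fst X *\<^sub>R snd V + fst V *\<^sub>R snd X))"

lemma Gam_commute: "Gam q X V = Gam q V X"
  by (simp add: Gam_def space_form_metric_commute pairing_commute add.commute)

lemma Gam_linear [simp]:
  "Gam q X (V + V') = Gam q X V + Gam q X V'" "Gam q X (r *\<^sub>R V) = r *\<^sub>R Gam q X V"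
  "Gam q (X + X') V = Gam q X V + Gam q X' V" "Gam q (r *\<^sub>R X) V = r *\<^sub>R Gam q X V"
  by (simp_all add: Gam_def algebra_simps)

lemma pr_Gam:
  assumes "q \<in> L" "X \<in> tangent_space L q" "V \<in> tangent_space L q"
  shows "pr (snd q) (snd (Gam q X V)) = pr (snd X) (snd V)"
  using assms by (simp add: Gam_def tangent_L pr_position)

text \<open>The warping terms of \<open>Gam\<close> reproduce the Christoffel form; the multiple of
  the position vector contributes nothing, by \<open>pr_m_position\<close>.\<close>

lemma G_Gam:
  assumes q: "q \<in> L" and t: "X \<in> tangent_space L q" "V \<in> tangent_space L q" "Z \<in> tangent_space L q"
  shows "G q (Gam q X V) Z = christoffel G q X V Z"
proof -
  have fd: "f differentiable (at (fst q))" using f_deriv[OF fst_L[OF q]] real_differentiable_def by blast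
  show ?thesis
    using pr_m_position[OF q t] f_nonzero[OF q] unfolding G christoffel_rw[OF fd]
    by (simp add: Gam_def rw_metric_def algebra_simps power2_eq_square)
qed

text \<open>The last hypothesis is the differentiated tangency equation. By \<open>pr_Gam\<close> it
  makes \<open>V' + Gam q X V\<close> tangent, and uniqueness identifies this vector with the
  definite description.\<close>

lemma levi_civita_eq:
  assumes q: "q \<in> L" and t: "X \<in> tangent_space L q" "V \<in> tangent_space L q"
    and V': "pr (snd X) (snd V) + pr (snd q) (snd V') = 0"
  shows "levi_civita L G q X V V' = V' + Gam q X V"
  unfolding levi_civita_def
proof (rule the1_equality)
  show "\<exists>!W. W \<in> tangent_space L q \<and> (\<forall>Z\<in>tangent_space L q. G q W Z = G q V' Z + christoffel G q X V Z)"
    unfolding L G by (rule levi_civita_ex1[OF c I f q[unfolded L]])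
  show "V' + Gam q X V \<in> tangent_space L q \<and> (\<forall>Z\<in>tangent_space L q. G q (V' + Gam q X V) Z = G q V' Z + christoffel G q X V Z)"
    using V' pr_Gam[OF q t] G_Gam[OF q t] by (simp add: tangent_L[OF q])
qed

text \<open>Metric compatibility at a point: the right-hand side is the contribution of the
  derivative of the warping factor \<open>(f (fst q))\<^sup>2\<close> in direction
  \<open>X\<close>.\<close>

lemma G_Gam_add:
  assumes q: "q \<in> L" and t: "X \<in> tangent_space L q" "V \<in> tangent_space L q" "W \<in> tangent_space L q"
  shows "G q (Gam q X V) W + G q V (Gam q X W) =
    2 * f (fst q) * deriv f (fst q) * fst X * m (snd V) (snd W)"
proof -
  have fd: "f differentiable (at (fst q))" using f_deriv[OF fst_L[OF q]] real_differentiable_def by blast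
  show ?thesis
    unfolding G_commute[of q V] G_Gam[OF q t(1,2,3)] G_Gam[OF q t(1,3,2)] unfolding G christoffel_rw[OF fd]
    by (simp add: space_form_metric_commute algebra_simps)
qed

text \<open>The curvature tensor R(X,Y)V of the warped product in closed form, with the sign of
  \<nabla>_X \<nabla>_Y - \<nabla>_Y \<nabla>_X; the \<open>pr\<close> terms carry the curvature of
  the space form.\<close>

definition curv :: "R5 \<Rightarrow> R5 \<Rightarrow> R5 \<Rightarrow> R5 \<Rightarrow> R5" where
  "curv q X Y V =
    (f (fst q) * deriv (deriv f) (fst q) *
       (fst X * m (snd Y) (snd V) - fst Y * m (snd X) (snd V)),
     (pr (snd Y) (snd V) + (deriv f (fst q))\<^sup>2 * m (snd Y) (snd V)) *\<^sub>R snd X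
     - (pr (snd X) (snd V) + (deriv f (fst q))\<^sup>2 * m (snd X) (snd V)) *\<^sub>R snd Y
     + (deriv (deriv f) (fst q) / f (fst q) * fst V) *\<^sub>R (fst X *\<^sub>R snd Y - fst Y *\<^sub>R snd X))"

text \<open>Orthogonality to \<open>V\<close> turns \<open>m (snd X) (snd V)\<close> into
  \<open>fst X * fst V / F\<^sup>2\<close>, and likewise for \<open>Y\<close>. The time component of
  \<open>curv\<close> then cancels, every other term acquires the factor \<open>fst V\<close>, and
  the coefficients collect into the second factor.\<close>

lemma G_curv_normal:
  assumes q: "q \<in> L" and t: "X \<in> tangent_space L q" "Y \<in> tangent_space L q" "V \<in> tangent_space L q"
    and n: "G q X V = 0" "G q Y V = 0"
  shows "G q (curv q X Y V) X =
    fst V * (deriv (deriv f) (fst q) / f (fst q) - ((deriv f (fst q))\<^sup>2 + c) / (f (fst q))\<^sup>2) *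
    (fst X * G q X Y - fst Y * G q X X)"
proof -
  define F F1 F2 where F: "F = f (fst q)" "F1 = deriv f (fst q)" "F2 = deriv (deriv f) (fst q)"
  have F0: "F \<noteq> 0" using f_nonzero[OF q] F by simp
  have mX: "m (snd X) (snd V) = fst X * fst V / F\<^sup>2" and mY: "m (snd Y) (snd V) = fst Y * fst V / F\<^sup>2"
    using n F0 by (simp_all add: G rw_metric_def F field_simps)
  have p: "pr (snd X) (snd V) = c * m (snd X) (snd V)" "pr (snd Y) (snd V) = c * m (snd Y) (snd V)"
    using pr_eq_m[OF q] t by blast+
  define A B where AB: "A = m (snd X) (snd X)" "B = m (snd X) (snd Y)"
  show ?thesis
    unfolding G rw_metric_def curv_def fst_conv snd_conv p space_form_metric_simps F[symmetric] mX mY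
      space_form_metric_commute[of c "snd Y" "snd X"] AB[symmetric]
    using F0 by (simp add: field_simps power2_eq_square)
qed

text \<open>The product rule applied to \<open>Gam\<close>: \<open>h\<close> is the velocity of the
  base point, \<open>X'\<close> and \<open>V'\<close> are the derivatives of the two
  arguments.\<close>

definition dGam :: "R5 \<Rightarrow> R5 \<Rightarrow> R5 \<Rightarrow> R5 \<Rightarrow> R5 \<Rightarrow> R5 \<Rightarrow> R5" where
  "dGam q h X X' V V' =
    (((deriv f (fst q))\<^sup>2 + f (fst q) * deriv (deriv f) (fst q)) * fst h * m (snd X) (snd V)
       + f (fst q) * deriv f (fst q) * (m (snd X') (snd V) + m (snd X) (snd V')),
     (pr (snd X') (snd V) + pr (snd X) (snd V')) *\<^sub>R snd q + pr (snd X) (snd V) *\<^sub>R snd h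
     + ((deriv (deriv f) (fst q) / f (fst q) - (deriv f (fst q) / f (fst q))\<^sup>2) * fst h) *\<^sub>R
         (fst X *\<^sub>R snd V + fst V *\<^sub>R snd X)
     + (deriv f (fst q) / f (fst q)) *\<^sub>R
         (fst X' *\<^sub>R snd V + fst X *\<^sub>R snd V' + fst V' *\<^sub>R snd X + fst V *\<^sub>R snd X'))"

text \<open>\<open>E\<close> stands for the common mixed second derivative of the map,
  \<open>Vx\<close> and \<open>Vy\<close> for the derivatives of \<open>V\<close> along
  \<open>X\<close> and \<open>Y\<close>. All of them cancel, which is the tensoriality of
  curvature.\<close>

lemma curvature_algebra:
  assumes q: "q \<in> L" and t: "X \<in> tangent_space L q" "Y \<in> tangent_space L q" "V \<in> tangent_space L q"
  shows "dGam q X Y E V Vx + Gam q X (Vy + Gam q Y V) - (dGam q Y X E V Vy + Gam q Y (Vx + Gam q X V))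
    = curv q X Y V"
proof -
  define F F1 F2 where F: "F = f (fst q)" "F1 = deriv f (fst q)" "F2 = deriv (deriv f) (fst q)"
  have F0: "F \<noteq> 0" using f_nonzero[OF q] F by simp
  \<comment> \<open>The outer \<open>Gam\<close> is applied to the position-vector part of the inner
    one. Tangency removes the resulting \<open>pr\<close> terms and \<open>pr_m_position\<close> the
    \<open>m\<close> terms.\<close>
  have p: "pr (snd X) (snd q) = 0" "pr (snd Y) (snd q) = 0"
    using t pairing_commute by (simp_all add: tangent_L[OF q])
  have m0: "pr (snd Y) (snd V) * m (snd X) (snd q) = 0" "pr (snd X) (snd V) * m (snd Y) (snd q) = 0"
    using pr_m_position[OF q] t space_form_metric_commute by metis+
  have 1: "pr (snd Y) (snd V) * m (snd X) (snd q) = pr (snd X) (snd V) * m (snd Y) (snd q)"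
    by (simp only: m0)
  show ?thesis
    unfolding dGam_def Gam_def curv_def F[symmetric] prod_eq_iff
    using F0 1 p
    by (simp add: algebra_simps power2_eq_square space_form_metric_commute[of c "snd Y" "snd X"]
         pairing_commute[of c "snd Y" "snd X"] add_divide_distrib diff_divide_distrib)
qed

end

section \<open>The covariant derivative along a map into the space-time\<close>

locale rw_map = robertson_walker +
  fixes U :: "'a::real_normed_vector set" and x :: "'a \<Rightarrow> R5"
  assumes U: "open U" and x: "smooth_on U x" "x ` U \<subseteq> L"
begin

definition vfield :: "('a \<Rightarrow> R5) \<Rightarrow> bool" where
  "vfield V \<longleftrightarrow> smooth_on U V \<and> (\<forall>u\<in>U. V u \<in> tangent_space L (x u))"

abbreviation dx :: "'a \<Rightarrow> 'a \<Rightarrow> R5" where "dx u a \<equiv> frechet_derivative x (at u) a"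

text \<open>For tangent fields this is the Levi-Civita derivative (\<open>levi_civita_cov\<close>).
  Being an explicit formula rather than a definite description, it can be differentiated
  again.\<close>

definition cov :: "('a \<Rightarrow> R5) \<Rightarrow> 'a \<Rightarrow> 'a \<Rightarrow> R5" where
  "cov V u a = frechet_derivative V (at u) a + Gam (x u) (dx u a) (V u)"

lemma x_L: "u \<in> U \<Longrightarrow> x u \<in> L" using x by auto

lemma vfield_smooth: "vfield V \<Longrightarrow> smooth_on U V"
  and vfield_tangent: "vfield V \<Longrightarrow> u \<in> U \<Longrightarrow> V u \<in> tangent_space L (x u)"
  by (auto simp: vfield_def)

lemma dx_has_derivative: "u \<in> U \<Longrightarrow> (x has_derivative dx u) (at u)"
  using smooth_on_has_derivative[OF x(1)] .

lemma vfield_has_derivative: "vfield V \<Longrightarrow> u \<in> U \<Longrightarrow> (V has_derivative frechet_derivative V (at u)) (at u)"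
  using smooth_on_has_derivative[OF vfield_smooth] .

lemma derivative_eq_0:
  fixes F :: "'a \<Rightarrow> 'b::real_normed_vector"
  assumes u: "u \<in> U" and d: "(F has_derivative F') (at u)" and k: "\<And>v. v \<in> U \<Longrightarrow> F v = k"
  shows "F' a = 0"
proof -
  have "(F has_derivative (\<lambda>a. 0)) (at u)"
    using has_derivative_transform_within_open[OF has_derivative_const U u, of k F] k by simp
  then show ?thesis using has_derivative_unique[OF d] by metis
qed

lemma snd_has_derivative: "(F has_derivative F') (at u) \<Longrightarrow> ((\<lambda>v. snd (F v)) has_derivative (\<lambda>a. snd (F' a))) (at u)"
  and fst_has_derivative: "(F has_derivative F') (at u) \<Longrightarrow> ((\<lambda>v. fst (F v)) has_derivative (\<lambda>a. fst (F' a))) (at u)"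
  by (auto intro!: derivative_intros)

lemma dx_tangent: assumes u: "u \<in> U" shows "dx u a \<in> tangent_space L (x u)"
proof -
  have "((\<lambda>v. pr (snd (x v)) (snd (x v))) has_derivative (\<lambda>a. pr (snd (x u)) (snd (dx u a)) + pr (snd (dx u a)) (snd (x u)))) (at u)"
    by (intro has_derivative_pairing snd_has_derivative dx_has_derivative u)
  from derivative_eq_0[OF u this, of 1 a] show ?thesis
    using u pr_position[OF x_L] by (simp add: tangent_L x_L pairing_commute[of c "snd (dx u a)"])
qed

lemma vfield_dx: "vfield (\<lambda>u. dx u a)"
  using dx_tangent by (auto simp: vfield_def intro: smooth_on_derivative x)

text \<open>Differentiating the tangency equation of \<open>V\<close> gives exactly what
  \<open>levi_civita_eq\<close> asks for.\<close>

lemma pr_derivative: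
  assumes u: "u \<in> U" and V: "vfield V"
  shows "pr (snd (dx u a)) (snd (V u)) + pr (snd (x u)) (snd (frechet_derivative V (at u) a)) = 0"
proof -
  have "((\<lambda>v. pr (snd (x v)) (snd (V v))) has_derivative (\<lambda>a. pr (snd (x u)) (snd (frechet_derivative V (at u) a)) + pr (snd (dx u a)) (snd (V u)))) (at u)"
    by (intro has_derivative_pairing snd_has_derivative dx_has_derivative vfield_has_derivative u V)
  from derivative_eq_0[OF u this, of 0 a] show ?thesis
    using vfield_tangent[OF V] by (simp add: tangent_L x_L)
qed

lemma levi_civita_cov:
  assumes "u \<in> U" "vfield V"
  shows "levi_civita L G (x u) (dx u a) (V u) (frechet_derivative V (at u) a) = cov V u a"
  unfolding cov_def
  by (intro levi_civita_eq x_L dx_tangent vfield_tangent pr_derivative assms)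

lemma cov_tangent:
  assumes u: "u \<in> U" and V: "vfield V"
  shows "cov V u a \<in> tangent_space L (x u)"
  using pr_derivative[OF u V, of a] pr_Gam[OF x_L dx_tangent vfield_tangent] u V
  by (simp add: cov_def tangent_L x_L)

lemma linear_cov:
  assumes u: "u \<in> U" and V: "vfield V"
  shows "linear (cov V u)"
proof -
  have "linear (frechet_derivative V (at u))" "linear (dx u)"
    using has_derivative_linear vfield_has_derivative[OF V u] dx_has_derivative[OF u] by blast+
  then show ?thesis by (auto simp: linear_iff cov_def algebra_simps)
qed

lemma cov_partial_t:
  assumes u: "u \<in> U"
  shows "cov (\<lambda>u. partial_t) u a =
    (deriv f (fst (x u)) / f (fst (x u))) *\<^sub>R (dx u a - fst (dx u a) *\<^sub>R partial_t)"
  by (simp add: cov_def frechet_derivative_const Gam_def partial_t_def prod_eq_iff)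

lemma G_has_derivative:
  assumes u: "u \<in> U" and V: "vfield V" and W: "vfield W"
  shows "((\<lambda>v. G (x v) (V v) (W v)) has_derivative
    (\<lambda>a. G (x u) (cov V u a) (W u) + G (x u) (V u) (cov W u a))) (at u)"
proof -
  note d = dx_has_derivative[OF u] vfield_has_derivative[OF V u] vfield_has_derivative[OF W u]
  have fx: "((\<lambda>v. f (fst (x v))) has_derivative (\<lambda>a. fst (dx u a) * deriv f (fst (x u)))) (at u)"
    using DERIV_compose_FDERIV[OF f_deriv[OF fst_L[OF x_L[OF u]]] fst_has_derivative[OF d(1)]] .
  have "((\<lambda>v. - fst (V v) * fst (W v) + (f (fst (x v)) * f (fst (x v))) * m (snd (V v)) (snd (W v))) has_derivative
     (\<lambda>a. G (x u) (frechet_derivative V (at u) a) (W u) + G (x u) (V u) (frechet_derivative W (at u) a) +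
        2 * f (fst (x u)) * deriv f (fst (x u)) * fst (dx u a) * m (snd (V u)) (snd (W u)))) (at u)"
    by (rule has_derivative_eq_rhs, (rule derivative_intros has_derivative_metric fx d)+)
       (simp add: fun_eq_iff G rw_metric_def algebra_simps power2_eq_square)
  then have "((\<lambda>v. G (x v) (V v) (W v)) has_derivative
     (\<lambda>a. G (x u) (frechet_derivative V (at u) a) (W u) + G (x u) (V u) (frechet_derivative W (at u) a) +
        2 * f (fst (x u)) * deriv f (fst (x u)) * fst (dx u a) * m (snd (V u)) (snd (W u)))) (at u)"
    by (simp add: G rw_metric_def power2_eq_square)
  then show ?thesis
    by (rule has_derivative_eq_rhs)
       (use G_Gam_add[OF x_L[OF u] dx_tangent[OF u] vfield_tangent[OF V u] vfield_tangent[OF W u]]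
        in \<open>simp add: fun_eq_iff cov_def algebra_simps\<close>)
qed

lemma cov_compatible:
  assumes u: "u \<in> U" and V: "vfield V" and W: "vfield W" and k: "\<And>v. v \<in> U \<Longrightarrow> G (x v) (V v) (W v) = k"
  shows "G (x u) (cov V u a) (W u) = - G (x u) (V u) (cov W u a)"
  using derivative_eq_0[OF u G_has_derivative[OF u V W], of k a] k by simp

lemma cov_torsion_free:
  assumes u: "u \<in> U"
  shows "cov (\<lambda>v. dx v a) u b = cov (\<lambda>v. dx v b) u a"
  using symmetric_second_derivative[OF U x(1) u, of a b] Gam_commute by (simp add: cov_def)

lemma smooth_on_f:
  fixes g :: "real \<Rightarrow> real"
  assumes "smooth_on I g" shows "smooth_on U (\<lambda>u. g (fst (x u)))"
  by (rule smooth_on_compose_real[OF U assms smooth_on_fst[OF U x(1)]]) (use x_L fst_L in blast)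

lemma smooth_on_G:
  assumes "smooth_on U V" "smooth_on U W"
  shows "smooth_on U (\<lambda>u. G (x u) (V u) (W u))"
  unfolding G rw_metric_def power2_eq_square using assms
  by (intro smooth_on_add smooth_on_mult smooth_on_minus smooth_on_fst smooth_on_snd smooth_on_f f U
      smooth_on_bilinear[OF U bounded_bilinear_space_form_metric])

lemma vfield_cov:
  assumes V: "vfield V"
  shows "vfield (\<lambda>u. cov V u a)"
proof -
  have "smooth_on I (\<lambda>t. deriv f t / f t)"
    using f by (intro smooth_on_divide smooth_on_deriv I) auto
  then have "smooth_on U (\<lambda>u. cov V u a)"
    unfolding cov_def Gam_def
    by (intro smooth_on_f[where g="\<lambda>t. deriv f t / f t"] smooth_on_add smooth_on_mult smooth_on_scaleR smooth_on_fst smooth_on_snd smooth_on_f f U I x smooth_on_deriv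
      smooth_on_derivative vfield_smooth[OF V] smooth_on_Pair smooth_on_bilinear[OF U bounded_bilinear_space_form_metric]
      smooth_on_bilinear[OF U bounded_bilinear_pairing])
  then show ?thesis using cov_tangent V by (auto simp: vfield_def)
qed

lemma Gam_has_derivative:
  assumes u: "u \<in> U" and B: "(B has_derivative B') (at u)" and V: "(V has_derivative V') (at u)"
  shows "((\<lambda>v. Gam (x v) (B v) (V v)) has_derivative
    (\<lambda>h. dGam (x u) (dx u h) (B u) (B' h) (V u) (V' h))) (at u)"
proof -
  note d = dx_has_derivative[OF u] B V
  have t: "fst (x u) \<in> I" using fst_L x_L u by blast
  have f0: "f (fst (x u)) \<noteq> 0" using f_nonzero x_L u by blast
  have fx: "((\<lambda>v. f (fst (x v))) has_derivative (\<lambda>a. fst (dx u a) * deriv f (fst (x u)))) (at u)"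
    using DERIV_compose_FDERIV[OF f_deriv[OF t] fst_has_derivative[OF d(1)]] .
  have f1x: "((\<lambda>v. deriv f (fst (x v))) has_derivative (\<lambda>a. fst (dx u a) * deriv (deriv f) (fst (x u)))) (at u)"
    using DERIV_compose_FDERIV[OF f_deriv2[OF t] fst_has_derivative[OF d(1)]] .
  show ?thesis
    unfolding Gam_def
    by (rule has_derivative_eq_rhs,
        (rule derivative_intros has_derivative_metric has_derivative_pairing fx f1x f0 d)+)
       (use f0 in \<open>simp add: fun_eq_iff dGam_def algebra_simps power2_eq_square divide_inverse\<close>)
qed

text \<open>The fields \<open>dx v a\<close> and \<open>dx v b\<close> commute, so no bracket term
  appears. The second derivatives of \<open>V\<close> cancel by symmetry, those of \<open>x\<close>
  coincide and become \<open>E\<close> in \<open>curvature_algebra\<close>.\<close>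

lemma curvature:
  assumes u: "u \<in> U" and V: "vfield V"
  shows "cov (\<lambda>v. cov V v b) u a - cov (\<lambda>v. cov V v a) u b = curv (x u) (dx u a) (dx u b) (V u)"
proof -
  have "frechet_derivative (\<lambda>v. cov V v b) (at u) a =
      frechet_derivative (\<lambda>v. frechet_derivative V (at v) b) (at u) a +
      dGam (x u) (dx u a) (dx u b) (frechet_derivative (\<lambda>v. dx v b) (at u) a) (V u) (frechet_derivative V (at u) a)" for a b
  proof -
    have "((\<lambda>v. cov V v b) has_derivative (\<lambda>a. frechet_derivative (\<lambda>v. frechet_derivative V (at v) b) (at u) a +
      dGam (x u) (dx u a) (dx u b) (frechet_derivative (\<lambda>v. dx v b) (at u) a) (V u) (frechet_derivative V (at u) a))) (at u)"
      unfolding cov_def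
      by (intro has_derivative_add Gam_has_derivative u vfield_has_derivative V
          smooth_on_has_derivative[OF smooth_on_derivative[OF vfield_smooth[OF V]]]
          smooth_on_has_derivative[OF smooth_on_derivative[OF x(1)]])
    from frechet_derivative_at[OF this, symmetric] show ?thesis by simp
  qed
  then show ?thesis
    using curvature_algebra[OF x_L[OF u] dx_tangent[OF u] dx_tangent[OF u] vfield_tangent[OF V u],
      of a b "frechet_derivative (\<lambda>v. dx v b) (at u) a" "frechet_derivative V (at u) a" "frechet_derivative V (at u) b"]
      symmetric_second_derivative[OF U x(1) u, of a b] symmetric_second_derivative[OF U vfield_smooth[OF V] u, of a b]
    by (simp add: cov_def[of "\<lambda>v. cov V v _"]) (simp add: cov_def algebra_simps)
qed

end

section \<open>Totally geodesic slices\<close>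

context robertson_walker
begin

text \<open>The product of \<open>I\<close> with a section of the space form by a hyperplane. For
  \<open>c \<noteq> 0\<close> the sections considered below are the linear ones,
  \<open>k = 0\<close>; for \<open>c = 0\<close> they are affine planes of Euclidean space.\<close>

definition slice :: "R4 \<Rightarrow> real \<Rightarrow> R5 set" where
  "slice n k = {q \<in> L. m (snd q) n = k}"

lemma m_has_derivative: "((\<lambda>q :: R5. m (snd q) n) has_derivative (\<lambda>v. m (snd v) n)) (at q)"
  by (rule has_derivative_eq_rhs, (rule has_derivative_metric derivative_intros)+) simp

text \<open>Circular or hyperbolic functions according to the sign of \<open>c\<close>, with
  \<open>S\<close> divided by \<open>\<kappa>\<close> so that \<open>C\<close> is its derivative.
  They parametrize the geodesics \<open>C s *\<^sub>R y + S s *\<^sub>R w\<close> of the space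
  form.\<close>

lemma trigonometric_pair:
  assumes "c \<noteq> 0" "\<kappa> > 0"
  obtains C S :: "real \<Rightarrow> real" where "\<And>s. (C has_real_derivative (-c*\<kappa>\<^sup>2) * S s) (at s)"
    "\<And>s. (S has_real_derivative C s) (at s)" "C 0 = 1" "S 0 = 0" "\<And>s. (C s)\<^sup>2 + c * \<kappa>\<^sup>2 * (S s)\<^sup>2 = 1"
proof -
  have c1: "c = 1 \<or> c = -1" using c assms by auto
  define C :: "real \<Rightarrow> real" where "C = (\<lambda>s. if c = 1 then cos (\<kappa> * s) else cosh (\<kappa> * s))"
  define S :: "real \<Rightarrow> real" where "S = (\<lambda>s. if c = 1 then sin (\<kappa> * s) / \<kappa> else sinh (\<kappa> * s) / \<kappa>)"
  show thesis
  proof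
    show "(C has_real_derivative (-c*\<kappa>\<^sup>2) * S s) (at s)" "(S has_real_derivative C s) (at s)" for s
      using c1 assms(2) by (auto simp: C_def S_def power2_eq_square intro!: derivative_eq_intros)
    show "C 0 = 1" "S 0 = 0" by (auto simp: C_def S_def)
    show "(C s)\<^sup>2 + c * \<kappa>\<^sup>2 * (S s)\<^sup>2 = 1" for s
      using c1 assms(2) cosh_square_eq[of "\<kappa> * s"] by (auto simp: C_def S_def power_divide)
  qed
qed

text \<open>A curve with velocity \<open>v\<close> moves linearly in time and along a geodesic in
  space. For \<open>c \<noteq> 0\<close> it stays in the slice because the section is linear and
  contains both \<open>y\<close> and \<open>w\<close>.\<close>

lemma tangent_slice_sup:
  assumes k: "c \<noteq> 0 \<Longrightarrow> k = 0" and q: "q \<in> slice n k"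
    and v: "v \<in> tangent_space L q" "m (snd v) n = 0"
  shows "v \<in> tangent_space (slice n k) q"
proof -
  have qL: "q \<in> L" and mn: "m (snd q) n = k" using q by (auto simp: slice_def)
  obtain t y where qe: "q = (t, y)" by (cases q)
  obtain a w where ve: "v = (a, w)" by (cases v)
  have t: "t \<in> I" and y: "y \<in> space_form c" using fst_L[OF qL] snd_L[OF qL] by (auto simp: qe)
  have yw: "pr y w = 0" using v qL by (simp add: qe ve tangent_L)
  have evI: "\<forall>\<^sub>F s in nhds 0. t + s * a \<in> I"
  proof -
    have "((\<lambda>s. t + s * a) \<longlongrightarrow> t + 0 * a) (nhds 0)" by (intro tendsto_intros filterlim_ident)
    then show ?thesis using I t topological_tendstoD[of _ "t + 0 * a" _ I] by fastforce
  qed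
  show ?thesis
  proof (cases "c = 0 \<or> w = 0")
    \<comment> \<open>A straight line works here; the trigonometric terms carry zero vectors and
      only fit \<open>tangent_space_trig\<close>.\<close>
    case True
    have "\<forall>\<^sub>F s in nhds 0. q + s *\<^sub>R v + cosh s *\<^sub>R 0 + sinh s *\<^sub>R 0 \<in> slice n k"
      using evI
    proof eventually_elim
      case (elim s)
      have "y + s *\<^sub>R w \<in> space_form c"
        using y yw True by (auto simp: space_form_def pairing_def power2_eq_square)
      then show ?case using elim mn v(2) by (simp add: qe ve slice_def) (simp add: L rw_space_def)
    qed
    then have "v + 0 \<in> tangent_space (slice n k) (q + 0)"
      by (intro tangent_space_trig[where C=cosh and S=sinh and \<sigma>=1]) (auto intro!: derivative_eq_intros)
    then show ?thesis by simp
  next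
    case False
    then have c0: "c \<noteq> 0" and c1: "c \<in> {-1,1}" using c by auto
    define \<kappa> where "\<kappa> = sqrt (m w w)"
    have \<kappa>: "\<kappa> > 0" "\<kappa>\<^sup>2 = m w w" using sf_pos[OF c y yw] False by (auto simp: \<kappa>_def)
    obtain C S :: "real \<Rightarrow> real" where dC: "\<And>s. (C has_real_derivative (-c*\<kappa>\<^sup>2) * S s) (at s)"
      and dS: "\<And>s. (S has_real_derivative C s) (at s)" and C0: "C 0 = 1" "S 0 = 0"
      and one: "\<And>s. (C s)\<^sup>2 + c * \<kappa>\<^sup>2 * (S s)\<^sup>2 = 1"
      using trigonometric_pair[OF c0 \<kappa>(1)] by blast
    have norm1: "pr (C s *\<^sub>R y + S s *\<^sub>R w) (C s *\<^sub>R y + S s *\<^sub>R w) = 1" for s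
      using y yw pairing_metric[OF c1, of w w] one[of s, unfolded \<kappa>(2)] pairing_commute[of c w y]
      by (simp add: space_form_sub power2_eq_square algebra_simps)
    have mS: "m (C s *\<^sub>R y + S s *\<^sub>R w) n = k" for s
      using mn v(2) k[OF c0] by (simp add: qe ve)
    \<comment> \<open>The quadric equation does not select the sheet; positivity of the first
      coordinate persists near 0 by continuity.\<close>
    have evp: "\<forall>\<^sub>F s in nhds 0. c \<le> 0 \<longrightarrow> fst (C s *\<^sub>R y + S s *\<^sub>R w) > 0"
    proof (cases "c \<le> 0")
      case True
      define g where "g = (\<lambda>s. fst (C s *\<^sub>R y + S s *\<^sub>R w))"
      have "isCont C 0" "isCont S 0" using dC dS DERIV_isCont by blast+
      then have "isCont g 0" unfolding g_def by (intro continuous_intros)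
      then have "(g \<longlongrightarrow> g 0) (nhds 0)"
        unfolding isCont_def by (rule tendsto_at_iff_tendsto_nhds[THEN iffD1])
      moreover have "g 0 > 0" using y True by (auto simp: g_def C0 space_form_def)
      ultimately have "\<forall>\<^sub>F s in nhds 0. g s > 0" by (rule order_tendstoD(1))
      then show ?thesis by eventually_elim (simp add: g_def)
    qed simp
    have "\<forall>\<^sub>F s in nhds 0. (t,0) + s *\<^sub>R (a,0) + C s *\<^sub>R (0,y) + S s *\<^sub>R (0,w) \<in> slice n k"
      using evI evp
    proof eventually_elim
      case (elim s)
      then show ?case using norm1[of s] mS[of s] by (simp add: slice_def) (simp add: L rw_space_def space_form_sub)
    qed
    from tangent_space_trig[OF dC dS C0 this]
    show ?thesis by (simp add: qe ve)
  qed
qed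

lemma tangent_slice:
  assumes k: "c \<noteq> 0 \<Longrightarrow> k = 0" and q: "q \<in> slice n k"
  shows "tangent_space (slice n k) q = {v \<in> tangent_space L q. m (snd v) n = 0}"
proof -
  have "m (snd v) n = 0" if "v \<in> tangent_space (slice n k) q" for v
    by (rule tangent_deriv[OF that m_has_derivative open_UNIV, where k=k]) (auto simp: slice_def)
  moreover have "tangent_space (slice n k) q \<subseteq> tangent_space L q"
    unfolding tangent_space_def slice_def by blast
  ultimately show ?thesis using tangent_slice_sup[OF k q] by blast
qed

text \<open>The fixed vector \<open>n\<close> is tangent to the space form all along the section:
  for \<open>c \<noteq> 0\<close> because \<open>pr\<close> is \<open>c\<close> times
  \<open>m\<close> and \<open>k = 0\<close>, for \<open>c = 0\<close> because \<open>pr\<close> sees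
  only first coordinates.\<close>

lemma slice_normal:
  assumes k: "c \<noteq> 0 \<Longrightarrow> k = 0" "c = 0 \<Longrightarrow> fst n = 0" and q: "q \<in> slice n k"
  shows "(0, n) \<in> tangent_space L q"
proof -
  have "q \<in> L" "m (snd q) n = k" using q by (simp_all add: slice_def)
  moreover have "pr (snd q) n = c * m (snd q) n \<or> fst n = 0 \<and> c = 0"
    using c k(2) pairing_metric[of c "snd q" n] by auto
  ultimately show ?thesis using k(1) by (cases "c = 0") (auto simp: tangent_L pairing_def)
qed

lemma hypersurface_slice:
  assumes n: "m n n = 1" and k: "c \<noteq> 0 \<Longrightarrow> k = 0" "c = 0 \<Longrightarrow> fst n = 0"
  shows "hypersurface L (slice n k)"
  unfolding hypersurface_def
proof (intro conjI ballI)
  show "slice n k \<subseteq> L" by (auto simp: slice_def)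
  fix q assume q: "q \<in> slice n k"
  have bl: "bounded_linear (\<lambda>q :: R5. m (snd q) n)"
    using m_has_derivative has_derivative_bounded_linear by blast
  have d: "((\<lambda>q :: R5. m (snd q) n - k) has_derivative (\<lambda>v. m (snd v) n)) (at q)" for q
    by (rule has_derivative_eq_rhs, (rule m_has_derivative derivative_intros)+) simp
  have "Ck_on j UNIV (\<lambda>q :: R5. q)" for j
  proof (cases j)
    case (Suc i)
    then show ?thesis by (auto intro!: Ck_on_SucI[where D="\<lambda>u v. v"] Ck_on_const has_derivative_ident)
  qed simp
  then have "smooth_on UNIV (\<lambda>q :: R5. q)" by (simp add: smooth_on_def)
  then have s: "smooth_on UNIV (\<lambda>q :: R5. m (snd q) n - k)"
    by (intro smooth_on_diff smooth_on_linear_compose[OF _ bl] smooth_on_const open_UNIV)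
  \<comment> \<open>One global defining function serves all points; its derivative in the normal
    direction \<open>(0, n)\<close> is \<open>m n n = 1\<close>.\<close>
  show "\<exists>B F. open B \<and> q \<in> B \<and> smooth_on B F \<and> slice n k \<inter> B = {y \<in> L \<inter> B. F y = (0::real)} \<and>
     (\<exists>v\<in>tangent_space L q. frechet_derivative F (at q) v \<noteq> 0)"
    by (rule exI[of _ UNIV], rule exI[of _ "\<lambda>q. m (snd q) n - k"])
       (use s slice_normal[OF k q] n q in \<open>auto simp: slice_def simp flip: frechet_derivative_at[OF d] intro!: bexI[of _ "(0, n)"]\<close>)
qed

text \<open>Differentiating \<open>m (snd (Y y)) n = 0\<close> along the slice keeps
  \<open>Y' X\<close> orthogonal to \<open>n\<close>. So does \<open>Gam\<close>: its space part
  combines \<open>X\<close>, \<open>Y q\<close> and the position vector, and the last term dies by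
  \<open>pr_m_position\<close> applied to the tangent vector \<open>(0, n)\<close>.\<close>

lemma totally_geodesic_slice:
  assumes k: "c \<noteq> 0 \<Longrightarrow> k = 0" "c = 0 \<Longrightarrow> fst n = 0"
  shows "totally_geodesic L G (slice n k)"
  unfolding totally_geodesic_def
proof (intro ballI allI impI, elim conjE)
  fix q X B Y
  assume q: "q \<in> slice n k" and X: "X \<in> tangent_space (slice n k) q" and B: "open B" "q \<in> B"
    and Y: "smooth_on B Y" and tY: "\<forall>y\<in>slice n k \<inter> B. Y y \<in> tangent_space (slice n k) y"
  define Y' where "Y' = frechet_derivative Y (at q)"
  have qL: "q \<in> L" using q by (simp add: slice_def)
  have XL: "X \<in> tangent_space L q" "m (snd X) n = 0" and YL: "Y q \<in> tangent_space L q" "m (snd (Y q)) n = 0"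
    using X tY q B tangent_slice[OF k(1) q] by auto
  have dY: "((\<lambda>y. snd (Y y)) has_derivative (\<lambda>v. snd (Y' v))) (at q)"
    using smooth_on_has_derivative[OF Y B(2)] by (auto simp: Y'_def intro!: derivative_intros)
  have 1: "m (snd (Y' X)) n = 0"
  proof (rule tangent_deriv[OF X _ B])
    show "((\<lambda>y. m (snd (Y y)) n) has_derivative (\<lambda>v. m (snd (Y' v)) n)) (at q)"
      by (rule has_derivative_eq_rhs, (rule has_derivative_metric dY has_derivative_const)+) simp
    show "m (snd (Y y)) n = 0" if "y \<in> slice n k \<inter> B" for y
      using tY that tangent_slice[OF k(1), of y n] by auto
  qed
  have 2: "pr (snd q) (snd (Y' X)) + pr (snd X) (snd (Y q)) = 0"
  proof (rule tangent_deriv[OF X _ B])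
    show "((\<lambda>y. pr (snd y) (snd (Y y))) has_derivative (\<lambda>v. pr (snd q) (snd (Y' v)) + pr (snd v) (snd (Y q)))) (at q)"
      by (intro has_derivative_pairing dY has_derivative_snd has_derivative_ident)
    show "pr (snd y) (snd (Y y)) = 0" if "y \<in> slice n k \<inter> B" for y
    proof -
      have "y \<in> L" using that by (simp add: slice_def)
      then show ?thesis using tY that tangent_slice[OF k(1), of y n] tangent_L[of y "Y y"] by auto
    qed
  qed
  have 3: "levi_civita L G q X (Y q) (Y' X) = Y' X + Gam q X (Y q)"
    by (rule levi_civita_eq[OF qL XL(1) YL(1)]) (use 2 in simp)
  have 4: "Y' X + Gam q X (Y q) \<in> tangent_space L q"
    using 2 pr_Gam[OF qL XL(1) YL(1)] by (simp add: tangent_L[OF qL])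
  have 5: "m (snd (Gam q X (Y q))) n = 0"
    using pr_m_position[OF qL XL(1) YL(1) slice_normal[OF k q]] XL(2) YL(2)
    by (simp add: Gam_def)
  show "levi_civita L G q X (Y q) (frechet_derivative Y (at q) X) \<in> tangent_space (slice n k) q"
    using 1 3 4 5 tangent_slice[OF k(1) q] by (simp add: Y'_def)
qed

section \<open>Orthonormal frames of the space-time\<close>

definition frame :: "R5 \<Rightarrow> R5 \<Rightarrow> R5 \<Rightarrow> R5 \<Rightarrow> R5 \<Rightarrow> bool" where
  "frame q v1 v2 v3 v4 \<longleftrightarrow> {v1, v2, v3, v4} \<subseteq> tangent_space L q \<and>
     G q v1 v1 = -1 \<and> G q v2 v2 = 1 \<and> G q v3 v3 = 1 \<and> G q v4 v4 = 1 \<and>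
     G q v1 v2 = 0 \<and> G q v1 v3 = 0 \<and> G q v1 v4 = 0 \<and> G q v2 v3 = 0 \<and> G q v2 v4 = 0 \<and> G q v3 v4 = 0"

lemma dim_tangent_L:
  assumes q: "q \<in> L" shows "dim (tangent_space L q) = 4"
proof -
  \<comment> \<open>The Euclidean normal of the tangent space in \<real>^5, obtained by writing
    \<open>pr (snd q)\<close> as an inner product.\<close>
  define z :: R5 where "z = (0, fst (snd q), c *\<^sub>R snd (snd q))"
  have "z \<bullet> (0, snd q) = 1" using pr_position[OF q] by (simp add: z_def inner_prod_def pairing_def)
  then have "z \<noteq> 0" by auto
  moreover have "tangent_space L q = {v. z \<bullet> v = 0}"
    using tangent_L[OF q] by (auto simp: z_def inner_prod_def pairing_def)
  ultimately show ?thesis using dim_hyperplane[of z] by simp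
qed

lemma G_span_eq_0: "v \<in> span S \<Longrightarrow> (\<And>s. s \<in> S \<Longrightarrow> G q s w = 0) \<Longrightarrow> G q v w = 0"
  by (induction rule: span_induct_alt) simp_all

text \<open>Four orthogonal non-null vectors are independent, hence span the four-dimensional
  tangent space. The remainder \<open>w\<close> lies in their span and is orthogonal to each of
  them, so its coefficients vanish. The minus sign comes from \<open>G q v1 v1 = -1\<close>.\<close>

lemma frame_expansion:
  assumes q: "q \<in> L" and F: "frame q v1 v2 v3 v4" and v: "v \<in> tangent_space L q"
  shows "v = - G q v v1 *\<^sub>R v1 + G q v v2 *\<^sub>R v2 + G q v v3 *\<^sub>R v3 + G q v v4 *\<^sub>R v4"
proof -
  have t: "{v1, v2, v3, v4} \<subseteq> tangent_space L q" and g: "G q v1 v1 = -1" "G q v2 v2 = 1" "G q v3 v3 = 1" "G q v4 v4 = 1"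
     "G q v1 v2 = 0" "G q v1 v3 = 0" "G q v1 v4 = 0" "G q v2 v3 = 0" "G q v2 v4 = 0" "G q v3 v4 = 0"
     "G q v2 v1 = 0" "G q v3 v1 = 0" "G q v4 v1 = 0" "G q v3 v2 = 0" "G q v4 v2 = 0" "G q v4 v3 = 0"
    using F G_commute by (auto simp: frame_def)
  have "v1 \<noteq> v2" "v1 \<noteq> v3" "v1 \<noteq> v4" "v2 \<noteq> v3" "v2 \<noteq> v4" "v3 \<noteq> v4" "v4 \<noteq> 0" using g by auto
  moreover have "v3 \<notin> span {v4}" using G_span_eq_0[of v3 "{v4}" q v3] g by auto
  moreover have "v2 \<notin> span {v3, v4}" using G_span_eq_0[of v2 "{v3, v4}" q v2] g by auto
  moreover have "v1 \<notin> span {v2, v3, v4}" using G_span_eq_0[of v1 "{v2, v3, v4}" q v1] g by auto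
  ultimately have "independent {v1, v2, v3, v4}" "card {v1, v2, v3, v4} = 4"
    by (auto simp: independent_insert)
  then have sp: "tangent_space L q \<subseteq> span {v1, v2, v3, v4}"
    using card_ge_dim_independent[OF t] dim_tangent_L[OF q] by simp
  define w where "w = v - (- G q v v1 *\<^sub>R v1 + G q v v2 *\<^sub>R v2 + G q v v3 *\<^sub>R v3 + G q v v4 *\<^sub>R v4)"
  have w0: "G q w v1 = 0" "G q w v2 = 0" "G q w v3 = 0" "G q w v4 = 0"
    using g by (simp_all add: w_def)
  have "w \<in> tangent_space L q"
    using v t subspace_tangent_L[OF q] unfolding w_def
    by (intro subspace_diff subspace_add subspace_scale) auto
  with sp obtain a1 a2 a3 a4 where "w - a1 *\<^sub>R v1 - a2 *\<^sub>R v2 - a3 *\<^sub>R v3 - a4 *\<^sub>R v4 = 0"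
    unfolding span_breakdown_eq subset_iff span_empty by blast
  then have "w = a1 *\<^sub>R v1 + a2 *\<^sub>R v2 + a3 *\<^sub>R v3 + a4 *\<^sub>R v4"
    by (simp add: algebra_simps)
  with w0 g have "w = 0" by simp
  then show ?thesis by (simp add: w_def)
qed

end

context rw_map
begin

text \<open>\<open>V\<close> becomes constant in \<open>\<real>\<^sup>4\<close> after scaling by \<open>f\<close>, and then is the normal of the slice.\<close>

lemma parallel_normal_slice:
  assumes V: "vfield V" and con: "connected U" and ne: "U \<noteq> {}"
    and par: "\<And>u a. u \<in> U \<Longrightarrow> cov V u a = 0" and t: "\<And>u. u \<in> U \<Longrightarrow> fst (V u) = 0"
    and one: "\<And>u. u \<in> U \<Longrightarrow> G (x u) (V u) (V u) = 1"
    and orth: "\<And>u a. u \<in> U \<Longrightarrow> G (x u) (V u) (dx u a) = 0"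
  shows "\<exists>S. hypersurface L S \<and> totally_geodesic L G S \<and> x ` U \<subseteq> S"
proof -
  define n where "n = (\<lambda>u. f (fst (x u)) *\<^sub>R snd (V u))"
  have mX: "m (snd (dx u a)) (snd (V u)) = 0" if "u \<in> U" for u a
    using orth[OF that, of a] t[OF that] f_nonzero[OF x_L[OF that]]
    by (simp add: G rw_metric_def space_form_metric_commute)
  have dn: "(n has_derivative (\<lambda>a. 0)) (at u)" if u: "u \<in> U" for u
  proof -
    have fx: "((\<lambda>v. f (fst (x v))) has_derivative (\<lambda>a. fst (dx u a) * deriv f (fst (x u)))) (at u)"
      using DERIV_compose_FDERIV[OF f_deriv[OF fst_L[OF x_L[OF u]]] fst_has_derivative[OF dx_has_derivative[OF u]]] .
    \<comment> \<open>In \<open>Gam\<close> the position term vanishes since \<open>pr\<close> is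
      \<open>c\<close> times \<open>m\<close> and \<open>m\<close> is 0 by orthogonality; the term
      with \<open>fst V\<close> vanishes too. Multiplied by \<open>f\<close>, what is left is the
      derivative of \<open>n\<close>.\<close>
    have "snd (frechet_derivative V (at u) a) + (deriv f (fst (x u)) / f (fst (x u)) * fst (dx u a)) *\<^sub>R snd (V u) = 0" for a
      using par[OF u, of a] t[OF u] pr_eq_m[OF x_L[OF u] dx_tangent[OF u, of a] vfield_tangent[OF V u]] mX[OF u]
      by (simp add: cov_def Gam_def prod_eq_iff)
    then have "f (fst (x u)) *\<^sub>R (snd (frechet_derivative V (at u) a) + (deriv f (fst (x u)) / f (fst (x u)) * fst (dx u a)) *\<^sub>R snd (V u)) = 0" for a
      by simp
    then show ?thesis unfolding n_def
      by (intro has_derivative_eq_rhs[OF has_derivative_scaleR[OF fx snd_has_derivative[OF vfield_has_derivative[OF V u]]]])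
         (use f_nonzero[OF x_L[OF u]] in \<open>simp add: fun_eq_iff scaleR_add_right mult.commute\<close>)
  qed
  obtain u0 where u0: "u0 \<in> U" using ne by blast
  define n0 k where "n0 = n u0" and "k = m (snd (x u0)) n0"
  have n: "n u = n0" if "u \<in> U" for u
    unfolding n0_def using has_derivative_zero_unique_connected[OF U con dn that u0] .
  have "((\<lambda>v. m (snd (x v)) n0) has_derivative (\<lambda>a. 0)) (at u)" if u: "u \<in> U" for u
  proof -
    have "m (snd (dx u a)) n0 = 0" for a
      using mX[OF u, of a] n[OF u] by (metis n_def space_form_metric_simps(6) mult_zero_right)
    moreover have "((\<lambda>v. m (snd (x v)) n0) has_derivative (\<lambda>a. m (snd (x u)) 0 + m (snd (dx u a)) n0)) (at u)"
      by (intro has_derivative_metric snd_has_derivative dx_has_derivative u has_derivative_const)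
    ultimately show ?thesis by simp
  qed
  then have k: "m (snd (x u)) n0 = k" if "u \<in> U" for u
    unfolding k_def using has_derivative_zero_unique_connected[OF U con _ that u0, of "\<lambda>v. m (snd (x v)) n0"] by blast
  have nn: "m n0 n0 = 1"
    using one[OF u0] t[OF u0] by (simp add: n0_def n_def G rw_metric_def power2_eq_square)
  have p: "pr (snd (x u0)) n0 = 0"
    using vfield_tangent[OF V u0] by (simp add: n0_def n_def tangent_L[OF x_L[OF u0]])
  \<comment> \<open>Tangency of \<open>n0\<close> at a single point supplies the side conditions of
    the slice lemmas.\<close>
  have k0: "k = 0" if "c \<noteq> 0"
    using p pairing_metric[of c "snd (x u0)" n0] c that by (auto simp: k_def)
  have n1: "fst n0 = 0" if "c = 0"
    using p snd_L[OF x_L[OF u0]] that by (auto simp: pairing_def space_form_def)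
  have "x ` U \<subseteq> slice n0 k" using k x_L by (auto simp: slice_def)
  then show ?thesis
    using hypersurface_slice[OF nn k0 n1] totally_geodesic_slice[OF k0 n1] by blast
qed

end

section \<open>Surfaces\<close>

lemma smooth_map_on_subset:
  "smooth_map_on A W F \<Longrightarrow> W' \<subseteq> W \<Longrightarrow> smooth_map_on A W' F"
  unfolding smooth_map_on_def by (fastforce intro: smooth_on_subset)

locale surface =
  fixes M :: "'m topology" and A :: "'m atlas" and x :: "'m \<Rightarrow> 'e::real_normed_vector" and L :: "'e set"
  assumes M: "smooth_surface M A" and imm: "immersion M A x L"
begin

lemma chart_open: "(U, \<phi>) \<in> A \<Longrightarrow> open U"
  and chart_openin: "(U, \<phi>) \<in> A \<Longrightarrow> openin M (\<phi> ` U)"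
  and chart_homeomorphic: "(U, \<phi>) \<in> A \<Longrightarrow> homeomorphic_map (top_of_set U) (subtopology M (\<phi> ` U)) \<phi>"
  and chart_transition: "(U, \<phi>) \<in> A \<Longrightarrow> (V, \<psi>) \<in> A \<Longrightarrow> smooth_on {u\<in>U. \<phi> u \<in> \<psi> ` V} (inv_into V \<psi> \<circ> \<phi>)"
  using M unfolding smooth_surface_def by blast+

lemma chart_inj: "(U, \<phi>) \<in> A \<Longrightarrow> inj_on \<phi> U"
  using chart_homeomorphic homeomorphic_imp_injective_map by force

lemma chart_topspace: "(U, \<phi>) \<in> A \<Longrightarrow> u \<in> U \<Longrightarrow> \<phi> u \<in> topspace M"
  using chart_openin openin_subset by blast

lemma chart_exists:
  assumes "p \<in> topspace M"
  obtains U \<phi> u where "(U, \<phi>) \<in> A" "u \<in> U" "\<phi> u = p"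
proof -
  have "p \<in> (\<Union>(U, \<phi>)\<in>A. \<phi> ` U)" using assms M by (simp add: smooth_surface_def)
  then show ?thesis using that by auto
qed

lemma chart_preimage_open:
  assumes a: "(U, \<phi>) \<in> A" and W: "openin M W"
  shows "open {u\<in>U. \<phi> u \<in> W}"
proof -
  have "openin (subtopology M (\<phi> ` U)) (\<phi> ` U \<inter> W)"
    using W by (simp add: openin_subtopology_Int2)
  then have "openin (top_of_set U) {u \<in> topspace (top_of_set U). \<phi> u \<in> \<phi> ` U \<inter> W}"
    using homeomorphic_imp_continuous_map[OF chart_homeomorphic[OF a]] openin_continuous_map_preimage by blast
  moreover have "{u \<in> topspace (top_of_set U). \<phi> u \<in> \<phi> ` U \<inter> W} = {u\<in>U. \<phi> u \<in> W}" by auto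
  ultimately show ?thesis using chart_open[OF a] openin_open_trans by metis
qed

lemma chart_image_open:
  assumes a: "(U, \<phi>) \<in> A" and B: "open B" "B \<subseteq> U"
  shows "openin M (\<phi> ` B)"
proof -
  have "openin (subtopology M (\<phi> ` U)) (\<phi> ` B)"
    using homeomorphic_map_openness[OF chart_homeomorphic[OF a], of B] B
    by (simp add: openin_open_eq chart_open[OF a])
  then show ?thesis using chart_openin[OF a] openin_trans_full by blast
qed

lemma smooth_map_onD: "smooth_map_on A W F \<Longrightarrow> (U, \<phi>) \<in> A \<Longrightarrow> smooth_on {u\<in>U. \<phi> u \<in> W} (F \<circ> \<phi>)"
  unfolding smooth_map_on_def by blast

lemma smooth_map_on_x: "smooth_map_on A (topspace M) x"
  and x_in_L: "p \<in> topspace M \<Longrightarrow> x p \<in> L"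
  and immersion_inj: "(U, \<phi>) \<in> A \<Longrightarrow> u \<in> U \<Longrightarrow> inj (frechet_derivative (x \<circ> \<phi>) (at u))"
  using imm unfolding immersion_def by blast+

lemma smooth_on_x_chart: "(U, \<phi>) \<in> A \<Longrightarrow> smooth_on U (x \<circ> \<phi>)"
  by (rule smooth_on_subset[OF smooth_map_onD[OF smooth_map_on_x]]) (use chart_topspace in auto)

text \<open>The chain rule for a change of charts: the derivative \<open>\<tau>\<close> of the
  transition map serves all maps at once. The statement for \<open>x\<close> is separate because
  \<open>F\<close> ranges over one fixed target type.\<close>

lemma has_derivative_transition:
  fixes F :: "'m \<Rightarrow> 'b::real_normed_vector"
  assumes a: "(U, \<phi>) \<in> A" "u \<in> U" and b: "(V, \<psi>) \<in> A" "v \<in> V" and eq: "\<phi> u = \<psi> v"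
  obtains \<tau> where "linear \<tau>"
    "\<And>F D. ((F \<circ> \<phi>) has_derivative D) (at u) \<Longrightarrow>
        ((F :: 'm \<Rightarrow> 'b::real_normed_vector) \<circ> \<psi> has_derivative D \<circ> \<tau>) (at v)"
    "((x \<circ> \<psi>) has_derivative frechet_derivative (x \<circ> \<phi>) (at u) \<circ> \<tau>) (at v)"
proof -
  define S where "S = {v\<in>V. \<psi> v \<in> \<phi> ` U}"
  define h where "h = inv_into U \<phi> \<circ> \<psi>"
  have S: "open S" "v \<in> S"
    using chart_preimage_open[OF b(1) chart_openin[OF a(1)]] b(2) imageI[OF a(2), of \<phi>] eq by (simp_all add: S_def)
  have h: "smooth_on S h" using chart_transition[OF b(1) a(1)] by (simp add: S_def h_def)
  have hv: "h v = u" using a eq chart_inj[OF a(1)] by (metis comp_apply h_def inv_into_f_f)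
  have hS: "\<phi> (h w) = \<psi> w" if "w \<in> S" for w
    using that by (auto simp: S_def h_def f_inv_into_f)
  define \<tau> where "\<tau> = frechet_derivative h (at v)"
  have d\<tau>: "(h has_derivative \<tau>) (at v)" unfolding \<tau>_def using smooth_on_has_derivative[OF h S(2)] .
  have chain: "((F \<circ> \<psi>) has_derivative (D \<circ> \<tau>)) (at v)" if "((F \<circ> \<phi>) has_derivative D) (at u)"
    for F :: "'m \<Rightarrow> 'c::real_normed_vector" and D
  proof -
    have "((\<lambda>w. (F \<circ> \<phi>) (h w)) has_derivative (\<lambda>a. D (\<tau> a))) (at v)"
      using has_derivative_compose[OF d\<tau>, of "F \<circ> \<phi>" D] that by (simp only: hv)
    from has_derivative_transform_within_open[OF this S, of "F \<circ> \<psi>"] show ?thesis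
      by (simp add: hS comp_def[of D])
  qed
  show thesis
    by (rule that[OF has_derivative_linear[OF d\<tau>] chain chain])
       (use smooth_on_has_derivative[OF smooth_on_x_chart[OF a(1)] a(2)] in auto)
qed

text \<open>The definition collects vectors from all charts; a change of chart merely precomposes
  the differential with \<open>\<tau>\<close>, so a single chart already yields them all.\<close>

lemma tangent_plane_chart:
  assumes a: "(U, \<phi>) \<in> A" "u \<in> U"
  shows "tangent_plane A x (\<phi> u) = range (frechet_derivative (x \<circ> \<phi>) (at u))"
proof (intro equalityI subsetI)
  fix w assume "w \<in> tangent_plane A x (\<phi> u)"
  then obtain V \<psi> v b where b: "(V, \<psi>) \<in> A" "v \<in> V" "\<psi> v = \<phi> u" and w: "w = frechet_derivative (x \<circ> \<psi>) (at v) b"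
    by (auto simp: tangent_plane_def)
  obtain \<tau> where "((x \<circ> \<psi>) has_derivative frechet_derivative (x \<circ> \<phi>) (at u) \<circ> \<tau>) (at v)"
    using has_derivative_transition[OF a b(1,2) b(3)[symmetric]] by metis
  from frechet_derivative_at[OF this, symmetric] show "w \<in> range (frechet_derivative (x \<circ> \<phi>) (at u))"
    using w by simp
qed (use a in \<open>auto simp: tangent_plane_def\<close>)

text \<open>The definite description is met: if \<open>e\<close> in another chart represents the
  same tangent vector as \<open>b\<close>, injectivity of the differential forces
  \<open>\<tau> e = b\<close>, and the two derivatives of \<open>F\<close> agree.\<close>

lemma directional_derivative_chart:
  fixes F :: "'m \<Rightarrow> 'b::real_normed_vector"
  assumes a: "(U, \<phi>) \<in> A" "u \<in> U" and W: "openin M W" "\<phi> u \<in> W" and F: "smooth_map_on A W F"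
  shows "directional_derivative A x F (\<phi> u) (frechet_derivative (x \<circ> \<phi>) (at u) b) = frechet_derivative (F \<circ> \<phi>) (at u) b"
  unfolding directional_derivative_def
proof (rule the_equality)
  show "\<forall>(V, \<psi>)\<in>A. \<forall>v\<in>V. \<forall>e. \<psi> v = \<phi> u \<and> frechet_derivative (x \<circ> \<psi>) (at v) e = frechet_derivative (x \<circ> \<phi>) (at u) b \<longrightarrow>
     frechet_derivative (F \<circ> \<phi>) (at u) b = frechet_derivative (F \<circ> \<psi>) (at v) e"
  proof (intro ballI allI impI, clarify)
    fix V \<psi> v e
    assume b: "(V, \<psi>) \<in> A" "v \<in> V" "\<psi> v = \<phi> u" and e: "frechet_derivative (x \<circ> \<psi>) (at v) e = frechet_derivative (x \<circ> \<phi>) (at u) b"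
    have dF: "((F \<circ> \<phi>) has_derivative frechet_derivative (F \<circ> \<phi>) (at u)) (at u)"
      using smooth_on_has_derivative[OF smooth_map_onD[OF F a(1)]] a W by blast
    obtain \<tau> where 1: "((x \<circ> \<psi>) has_derivative frechet_derivative (x \<circ> \<phi>) (at u) \<circ> \<tau>) (at v)"
      and 2: "((F \<circ> \<psi>) has_derivative frechet_derivative (F \<circ> \<phi>) (at u) \<circ> \<tau>) (at v)"
      using has_derivative_transition[OF a b(1,2) b(3)[symmetric]] dF by metis
    have "frechet_derivative (x \<circ> \<phi>) (at u) (\<tau> e) = frechet_derivative (x \<circ> \<phi>) (at u) b"
      using e by (simp add: frechet_derivative_at[OF 1, symmetric])
    then have "\<tau> e = b" using immersion_inj[OF a] by (simp add: inj_eq)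
    then show "frechet_derivative (F \<circ> \<phi>) (at u) b = frechet_derivative (F \<circ> \<psi>) (at v) e"
      by (simp add: frechet_derivative_at[OF 2, symmetric])
  qed
next
  fix d assume "\<forall>(V, \<psi>)\<in>A. \<forall>v\<in>V. \<forall>e. \<psi> v = \<phi> u \<and> frechet_derivative (x \<circ> \<psi>) (at v) e = frechet_derivative (x \<circ> \<phi>) (at u) b \<longrightarrow>
     d = frechet_derivative (F \<circ> \<psi>) (at v) e"
  then show "d = frechet_derivative (F \<circ> \<phi>) (at u) b" using a by blast
qed

end

section \<open>Smooth coordinates of tangent fields\<close>

lemma linear_plane:
  assumes "linear (h :: real^2 \<Rightarrow> 'b::real_vector)"
  shows "h a = (a $ 1) *\<^sub>R h (axis 1 1) + (a $ 2) *\<^sub>R h (axis 2 1)"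
proof -
  have "a = (a $ 1) *\<^sub>R axis 1 1 + (a $ 2) *\<^sub>R axis 2 1"
    by (simp add: vec_eq_iff forall_2 axis_def)
  from arg_cong[OF this, of h] show ?thesis by (simp add: linear_add[OF assms] linear_cmul[OF assms])
qed

text \<open>Cramer's rule for the Gram system of \<open>X1\<close> and \<open>X2\<close>; it
  expresses coordinates through inner products, which depend smoothly on the point.\<close>

lemma gram_coordinates:
  fixes X1 X2 Y :: "'e::real_inner"
  assumes Y: "Y = a *\<^sub>R X1 + b *\<^sub>R X2"
  shows "((X2 \<bullet> X2) * (Y \<bullet> X1) - (X1 \<bullet> X2) * (Y \<bullet> X2)) = a * ((X1 \<bullet> X1) * (X2 \<bullet> X2) - (X1 \<bullet> X2)\<^sup>2)"
    and "((X1 \<bullet> X1) * (Y \<bullet> X2) - (X1 \<bullet> X2) * (Y \<bullet> X1)) = b * ((X1 \<bullet> X1) * (X2 \<bullet> X2) - (X1 \<bullet> X2)\<^sup>2)"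
  unfolding Y by (simp_all add: inner_add_left inner_commute[of X2 X1] power2_eq_square algebra_simps)

lemma gram_nonzero:
  fixes h :: "real^2 \<Rightarrow> 'e::real_inner"
  assumes h: "linear h" "inj h"
  defines "X1 \<equiv> h (axis 1 1)" and "X2 \<equiv> h (axis 2 1)"
  shows "(X1 \<bullet> X1) * (X2 \<bullet> X2) - (X1 \<bullet> X2)\<^sup>2 \<noteq> 0"
proof
  assume 0: "(X1 \<bullet> X1) * (X2 \<bullet> X2) - (X1 \<bullet> X2)\<^sup>2 = 0"
  \<comment> \<open>Chosen so that \<open>h w\<close> is \<open>X2 \<bullet> X2\<close> times the
    part of \<open>X1\<close> orthogonal to \<open>X2\<close>; its square is
    \<open>X2 \<bullet> X2\<close> times the Gram determinant.\<close>
  define w :: "real^2" where "w = (X2 \<bullet> X2) *\<^sub>R axis 1 1 - (X1 \<bullet> X2) *\<^sub>R axis 2 1"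
  have hw: "h w = (X2 \<bullet> X2) *\<^sub>R X1 - (X1 \<bullet> X2) *\<^sub>R X2"
    using h(1) by (simp add: w_def X1_def X2_def linear_diff linear_cmul)
  have "h w \<bullet> h w = (X2 \<bullet> X2) * ((X1 \<bullet> X1) * (X2 \<bullet> X2) - (X1 \<bullet> X2)\<^sup>2)"
    unfolding hw by (simp add: inner_diff_left inner_diff_right inner_commute[of X2 X1] power2_eq_square algebra_simps)
  with 0 have "h w = 0" by simp
  then have "w = 0" using h by (metis injD linear_0)
  then have "w $ 1 = 0" by simp
  then have "X2 = 0" by (simp add: w_def axis_def)
  then have "axis 2 1 = (0 :: real^2)" using h unfolding X2_def by (metis injD linear_0)
  then show False by (simp add: axis_eq_0_iff)
qed

text \<open>The Euclidean inner product of the ambient vector space is used, for which injectivity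
  of the differential alone makes the Gram determinant nonzero.\<close>

lemma smooth_on_coordinates:
  fixes y :: "real^2 \<Rightarrow> 'e::euclidean_space"
  assumes U: "open U" and y: "smooth_on U y" and inj: "\<And>u. u \<in> U \<Longrightarrow> inj (frechet_derivative y (at u))"
    and X: "smooth_on U X" "\<And>u. u \<in> U \<Longrightarrow> X u \<in> range (frechet_derivative y (at u))"
  obtains a b where "smooth_on U a" "smooth_on U b"
    "\<And>u. u \<in> U \<Longrightarrow> X u = frechet_derivative y (at u) (a u *\<^sub>R axis 1 1 + b u *\<^sub>R axis 2 1)"
proof -
  define X1 where "X1 = (\<lambda>u. frechet_derivative y (at u) (axis 1 1))"
  define X2 where "X2 = (\<lambda>u. frechet_derivative y (at u) (axis 2 1))"
  define g where "g = (\<lambda>u. (X1 u \<bullet> X1 u) * (X2 u \<bullet> X2 u) - (X1 u \<bullet> X2 u) * (X1 u \<bullet> X2 u))"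
  define a where "a = (\<lambda>u. ((X2 u \<bullet> X2 u) * (X u \<bullet> X1 u) - (X1 u \<bullet> X2 u) * (X u \<bullet> X2 u)) / g u)"
  define b where "b = (\<lambda>u. ((X1 u \<bullet> X1 u) * (X u \<bullet> X2 u) - (X1 u \<bullet> X2 u) * (X u \<bullet> X1 u)) / g u)"
  have lin: "linear (frechet_derivative y (at u))" if "u \<in> U" for u
    using smooth_on_has_derivative[OF y that] has_derivative_linear by blast
  have g: "g u \<noteq> 0" if "u \<in> U" for u
    using gram_nonzero[OF lin[OF that] inj[OF that]] by (simp add: g_def X1_def X2_def power2_eq_square)
  have s: "smooth_on U X1" "smooth_on U X2"
    unfolding X1_def X2_def by (intro smooth_on_derivative y)+
  have "smooth_on U g" unfolding g_def by (intro smooth_on_diff smooth_on_mult smooth_on_inner U s)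
  with g have ab: "smooth_on U a" "smooth_on U b" unfolding a_def b_def
    by (auto intro!: smooth_on_divide smooth_on_diff smooth_on_mult smooth_on_inner U s X(1))
  have "X u = frechet_derivative y (at u) (a u *\<^sub>R axis 1 1 + b u *\<^sub>R axis 2 1)" if u: "u \<in> U" for u
  proof -
    obtain e where e: "X u = frechet_derivative y (at u) e" using X(2)[OF u] by blast
    then have "X u = (e $ 1) *\<^sub>R X1 u + (e $ 2) *\<^sub>R X2 u"
      using linear_plane[OF lin[OF u], of e] by (simp add: X1_def X2_def)
    from gram_coordinates[OF this] g[OF u] have "a u = e $ 1" "b u = e $ 2"
      by (simp_all add: a_def b_def g_def power2_eq_square)
    then have "a u *\<^sub>R axis 1 1 + b u *\<^sub>R axis 2 1 = e" by (simp add: vec_eq_iff forall_2 axis_def)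
    then show ?thesis using e by simp
  qed
  with ab show thesis using that by blast
qed

section \<open>Vector fields along a surface in the space-time\<close>

locale rw_surface = robertson_walker c I f L G + surface M A x L
  for c I f L G and M :: "'m topology" and A x
begin

lemma chart_rw_map:
  assumes "(U, \<phi>) \<in> A" "openin M W"
  shows "rw_map c I f L G {u\<in>U. \<phi> u \<in> W} (x \<circ> \<phi>)"
proof
  show "open {u\<in>U. \<phi> u \<in> W}" using chart_preimage_open[OF assms] .
  show "smooth_on {u\<in>U. \<phi> u \<in> W} (x \<circ> \<phi>)"
    using smooth_on_x_chart[OF assms(1)] by (rule smooth_on_subset) auto
  show "(x \<circ> \<phi>) ` {u\<in>U. \<phi> u \<in> W} \<subseteq> L" using x_in_L chart_topspace[OF assms(1)] by auto
qed

definition tfield :: "'m set \<Rightarrow> ('m \<Rightarrow> R5) \<Rightarrow> bool" where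
  "tfield W V \<longleftrightarrow> openin M W \<and> smooth_map_on A W V \<and> (\<forall>q\<in>W. V q \<in> tangent_space L (x q))"

text \<open>\<open>nabla\<close> sees its first field only through the value at the point, so a
  single vector can take the place of that field.\<close>

abbreviation nab :: "('m \<Rightarrow> R5) \<Rightarrow> 'm \<Rightarrow> R5 \<Rightarrow> R5" where
  "nab V p X \<equiv> nabla L G A x (\<lambda>_. X) V p"

lemma nabla_eq_nab: "nabla L G A x X V p = nab V p (X p)"
  by (simp add: nabla_def)

lemma tfield_subset: "tfield W V \<Longrightarrow> openin M W' \<Longrightarrow> W' \<subseteq> W \<Longrightarrow> tfield W' V"
  unfolding tfield_def using smooth_map_on_subset by blast

lemma tfield_topspace: "tfield W V \<Longrightarrow> p \<in> W \<Longrightarrow> p \<in> topspace M"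
  unfolding tfield_def using openin_subset by blast

lemma tfield_partial_t: "openin M W \<Longrightarrow> tfield W (\<lambda>_. partial_t)"
  unfolding tfield_def smooth_map_on_def o_def
  using partial_t_tangent[OF x_in_L] openin_subset[of M W] by blast

lemma tfield_chart:
  assumes "tfield W V" "(U, \<phi>) \<in> A"
  shows "rw_map.vfield L {u\<in>U. \<phi> u \<in> W} (x \<circ> \<phi>) (V \<circ> \<phi>)"
proof -
  have "openin M W" using assms by (simp add: tfield_def)
  interpret rw_map c I f L G "{u\<in>U. \<phi> u \<in> W}" "x \<circ> \<phi>"
    by (rule chart_rw_map) fact+
  show ?thesis using assms by (auto simp: vfield_def tfield_def intro: smooth_map_onD)
qed

text \<open>The bridge from the connection on the surface to the explicit \<open>cov\<close> in a
  chart; the rules for \<open>nab\<close> are transported across it.\<close>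

lemma nab_chart:
  assumes V: "tfield W V" and a: "(U, \<phi>) \<in> A" "u \<in> U" "\<phi> u \<in> W"
  shows "nab V (\<phi> u) (frechet_derivative (x \<circ> \<phi>) (at u) b) =
    rw_map.cov c f (x \<circ> \<phi>) (V \<circ> \<phi>) u b"
proof -
  have W: "openin M W" and V': "smooth_map_on A W V" using V by (auto simp: tfield_def)
  interpret rw_map c I f L G "{u\<in>U. \<phi> u \<in> W}" "x \<circ> \<phi>"
    by (rule chart_rw_map) fact+
  show ?thesis
    using levi_civita_cov[OF _ tfield_chart[OF V a(1)], of u b] a directional_derivative_chart[OF a(1,2) W a(3) V']
    by (simp add: nabla_def)
qed

lemma subspace_tangent_plane:
  assumes "p \<in> topspace M"
  shows "subspace (tangent_plane A x p)" "tangent_plane A x p \<subseteq> tangent_space L (x p)"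
proof -
  obtain U \<phi> u where a: "(U, \<phi>) \<in> A" "u \<in> U" "\<phi> u = p" using chart_exists[OF assms] by blast
  interpret rw_map c I f L G "{u\<in>U. \<phi> u \<in> topspace M}" "x \<circ> \<phi>"
    by (rule chart_rw_map) (use a in auto)
  have u: "u \<in> {u\<in>U. \<phi> u \<in> topspace M}" using a assms by simp
  have "linear (frechet_derivative (x \<circ> \<phi>) (at u))"
    using dx_has_derivative[OF u] has_derivative_linear by blast
  then show "subspace (tangent_plane A x p)" "tangent_plane A x p \<subseteq> tangent_space L (x p)"
    using tangent_plane_chart[OF a(1,2)] a(3) linear_subspace_image[OF _ subspace_UNIV] dx_tangent[OF u]
    by auto
qed

lemma nab_obtain_chart:
  assumes "tfield W V" "p \<in> W" and X: "X \<in> tangent_plane A x p"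
  obtains U \<phi> u b where "(U, \<phi>) \<in> A" "u \<in> U" "\<phi> u = p" "X = frechet_derivative (x \<circ> \<phi>) (at u) b"
proof -
  obtain U \<phi> u where a: "(U, \<phi>) \<in> A" "u \<in> U" "\<phi> u = p"
    using chart_exists tfield_topspace assms by metis
  then show ?thesis using that X tangent_plane_chart[OF a(1,2)] by blast
qed

lemma nab_tangent:
  assumes V: "tfield W V" "p \<in> W" and X: "X \<in> tangent_plane A x p"
  shows "nab V p X \<in> tangent_space L (x p)"
proof -
  obtain U \<phi> u b where a: "(U, \<phi>) \<in> A" "u \<in> U" "\<phi> u = p" "X = frechet_derivative (x \<circ> \<phi>) (at u) b"
    using nab_obtain_chart[OF assms] by blast
  have W: "openin M W" using V by (simp add: tfield_def)
  interpret rw_map c I f L G "{u\<in>U. \<phi> u \<in> W}" "x \<circ> \<phi>"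
    by (rule chart_rw_map) fact+
  show ?thesis using cov_tangent[OF _ tfield_chart[OF V(1) a(1)], of u b] nab_chart[OF V(1) a(1,2)] a V by simp
qed

lemma nab_compatible:
  assumes V: "tfield W V" "p \<in> W" and Z: "tfield W Z" and X: "X \<in> tangent_plane A x p"
    and k: "\<And>q. q \<in> W \<Longrightarrow> G (x q) (V q) (Z q) = k"
  shows "G (x p) (nab V p X) (Z p) = - G (x p) (V p) (nab Z p X)"
proof -
  obtain U \<phi> u b where a: "(U, \<phi>) \<in> A" "u \<in> U" "\<phi> u = p" "X = frechet_derivative (x \<circ> \<phi>) (at u) b"
    using nab_obtain_chart[OF V X] by blast
  have W: "openin M W" using V by (simp add: tfield_def)
  interpret rw_map c I f L G "{u\<in>U. \<phi> u \<in> W}" "x \<circ> \<phi>"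
    by (rule chart_rw_map) fact+
  show ?thesis
    using cov_compatible[OF _ tfield_chart[OF V(1) a(1)] tfield_chart[OF Z a(1)], of u k b]
      nab_chart[OF V(1) a(1,2)] nab_chart[OF Z a(1,2)] a V k by simp
qed

lemma nab_partial_t:
  assumes p: "p \<in> topspace M" and X: "X \<in> tangent_plane A x p"
  shows "nab (\<lambda>_. partial_t) p X = (deriv f (fst (x p)) / f (fst (x p))) *\<^sub>R (X - fst X *\<^sub>R partial_t)"
proof -
  have V: "tfield (topspace M) (\<lambda>_. partial_t)" by (rule tfield_partial_t) simp
  obtain U \<phi> u b where a: "(U, \<phi>) \<in> A" "u \<in> U" "\<phi> u = p" "X = frechet_derivative (x \<circ> \<phi>) (at u) b"
    using nab_obtain_chart[OF V p X] by blast
  interpret rw_map c I f L G "{u\<in>U. \<phi> u \<in> topspace M}" "x \<circ> \<phi>"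
    by (rule chart_rw_map) (use a in auto)
  show ?thesis
    using cov_partial_t[of u b] nab_chart[OF V a(1,2)] a p by (simp add: o_def)
qed

text \<open>The direction \<open>X q\<close> varies, while \<open>cov\<close> is known to be smooth
  in fixed directions. Smooth coordinates of \<open>X\<close> and linearity in the direction reduce
  one to the other.\<close>

lemma smooth_map_on_G_nab:
  assumes W: "openin M W" and X: "smooth_map_on A W X" "\<And>q. q \<in> W \<Longrightarrow> X q \<in> tangent_plane A x q"
    and V: "tfield W V" and Z: "tfield W Z"
  shows "smooth_map_on A W (\<lambda>q. G (x q) (nab V q (X q)) (Z q))"
  unfolding smooth_map_on_def
proof safe
  fix U \<phi> assume a: "(U, \<phi>) \<in> A"
  let ?U = "{u\<in>U. \<phi> u \<in> W}"
  interpret rw_map c I f L G ?U "x \<circ> \<phi>"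
    by (rule chart_rw_map) fact+
  note V' = tfield_chart[OF V a] and Z' = tfield_chart[OF Z a]
  have "smooth_on ?U (X \<circ> \<phi>)" "\<And>u. u \<in> ?U \<Longrightarrow> (X \<circ> \<phi>) u \<in> range (dx u)" "\<And>u. u \<in> ?U \<Longrightarrow> inj (dx u)"
    using smooth_map_onD[OF X(1) a] X(2) tangent_plane_chart[OF a] immersion_inj[OF a] by auto
  from smooth_on_coordinates[OF U x(1) this(3,1,2)]
  obtain \<alpha> \<beta> where s: "smooth_on ?U \<alpha>" "smooth_on ?U \<beta>"
    and eq: "\<And>u. u \<in> ?U \<Longrightarrow> (X \<circ> \<phi>) u = dx u (\<alpha> u *\<^sub>R axis 1 1 + \<beta> u *\<^sub>R axis 2 1)"
    by blast
  have "smooth_on ?U (\<lambda>u. \<alpha> u * G ((x \<circ> \<phi>) u) (cov (V \<circ> \<phi>) u (axis 1 1)) ((Z \<circ> \<phi>) u) +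
      \<beta> u * G ((x \<circ> \<phi>) u) (cov (V \<circ> \<phi>) u (axis 2 1)) ((Z \<circ> \<phi>) u))"
    by (intro smooth_on_add smooth_on_mult smooth_on_G U s vfield_smooth[OF vfield_cov[OF V']] vfield_smooth[OF Z'])
  moreover have "\<alpha> u * G ((x \<circ> \<phi>) u) (cov (V \<circ> \<phi>) u (axis 1 1)) ((Z \<circ> \<phi>) u) +
      \<beta> u * G ((x \<circ> \<phi>) u) (cov (V \<circ> \<phi>) u (axis 2 1)) ((Z \<circ> \<phi>) u) =
      ((\<lambda>q. G (x q) (nab V q (X q)) (Z q)) \<circ> \<phi>) u" if u: "u \<in> ?U" for u
    using eq[OF u] nab_chart[OF V a, of u] u linear_cov[OF u V'] by (simp add: linear_add linear_cmul)
  ultimately show "smooth_on ?U ((\<lambda>q. G (x q) (nab V q (X q)) (Z q)) \<circ> \<phi>)"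
    by (rule smooth_on_cong[OF U, THEN iffD1, rotated])
qed

lemma tangent_tfield:
  assumes "openin M W" "smooth_map_on A W V" "\<And>q. q \<in> W \<Longrightarrow> V q \<in> tangent_plane A x q"
  shows "tfield W V"
  using assms subspace_tangent_plane(2) openin_subset[OF assms(1)] unfolding tfield_def by blast

text \<open>Symmetry of the second fundamental form, read off the shape operator of \<open>V\<close>.\<close>

lemma nab_normal_symmetric:
  assumes V: "tfield W V" "p \<in> W" and X: "X \<in> tangent_plane A x p" and Y: "Y \<in> tangent_plane A x p"
    and n: "\<And>q v. q \<in> W \<Longrightarrow> v \<in> tangent_plane A x q \<Longrightarrow> G (x q) (V q) v = 0"
  shows "G (x p) (nab V p X) Y = G (x p) (nab V p Y) X"
proof -
  obtain U \<phi> u a where ch: "(U, \<phi>) \<in> A" "u \<in> U" "\<phi> u = p" and a: "X = frechet_derivative (x \<circ> \<phi>) (at u) a"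
    using nab_obtain_chart[OF V X] by blast
  obtain b where b: "Y = frechet_derivative (x \<circ> \<phi>) (at u) b"
    using Y tangent_plane_chart[OF ch(1,2)] ch(3) by blast
  have W: "openin M W" using V by (simp add: tfield_def)
  interpret rw_map c I f L G "{u\<in>U. \<phi> u \<in> W}" "x \<circ> \<phi>"
    by (rule chart_rw_map) fact+
  have u: "u \<in> {u\<in>U. \<phi> u \<in> W}" using ch V by simp
  have 0: "G ((x \<circ> \<phi>) v) ((V \<circ> \<phi>) v) (dx v e) = 0" if "v \<in> {u\<in>U. \<phi> u \<in> W}" for v e
    using n[of "\<phi> v" "dx v e"] that tangent_plane_chart[OF ch(1), of v] by auto
  \<comment> \<open>Since \<open>V\<close> is normal, the derivative moves onto the coordinate
    field, where torsion-freeness exchanges \<open>d\<close> and \<open>e\<close>.\<close>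
  have "G (x p) (cov (V \<circ> \<phi>) u e) (dx u d) = - G (x p) (V p) (cov (\<lambda>v. dx v d) u e)" for e d
    using cov_compatible[where V="V \<circ> \<phi>" and W="\<lambda>v. dx v d" and k=0 and a=e,
        OF u tfield_chart[OF V(1) ch(1)] vfield_dx 0] ch(3) by simp
  then show ?thesis
    using nab_chart[OF V(1) ch(1,2)] ch(3) V(2) a b cov_torsion_free[OF u, of a b] by simp
qed

end

section \<open>Adapted frames\<close>

locale rw_frame = rw_surface c I f L G M A x
  for c I f L G and M :: "'m topology" and A x +
  fixes W :: "'m set" and e1 e2 e3 e4 :: "'m \<Rightarrow> R5" and \<theta> :: "'m \<Rightarrow> real"
  assumes W: "openin M W"
    and smooth: "\<forall>e\<in>{e1, e2, e3, e4}. smooth_map_on A W e"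
    and tangent: "\<forall>p\<in>W. e1 p \<in> tangent_plane A x p \<and> e2 p \<in> tangent_plane A x p"
    and normal: "\<forall>p\<in>W. e3 p \<in> normal_plane L G A x p \<and> e4 p \<in> normal_plane L G A x p"
    and unit: "\<forall>p\<in>W. G (x p) (e1 p) (e1 p) = -1 \<and> G (x p) (e2 p) (e2 p) = 1 \<and>
      G (x p) (e3 p) (e3 p) = 1 \<and> G (x p) (e4 p) (e4 p) = 1"
    and orthogonal: "\<forall>p\<in>W. G (x p) (e1 p) (e2 p) = 0 \<and> G (x p) (e3 p) (e4 p) = 0"
    and angle: "\<forall>p\<in>W. partial_t = cosh (\<theta> p) *\<^sub>R e1 p + sinh (\<theta> p) *\<^sub>R e3 p"
    and \<eta>: "\<forall>p\<in>W. normal_part L G A x p partial_t \<noteq> 0"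
begin

lemma W_topspace: "p \<in> W \<Longrightarrow> p \<in> topspace M"
  using W openin_subset by blast

lemma W_L: "p \<in> W \<Longrightarrow> x p \<in> L"
  using W_topspace x_in_L by blast

lemma e_tangent: "p \<in> W \<Longrightarrow> e1 p \<in> tangent_plane A x p" "p \<in> W \<Longrightarrow> e2 p \<in> tangent_plane A x p"
  using tangent by auto

lemma e_normal: "p \<in> W \<Longrightarrow> v \<in> tangent_plane A x p \<Longrightarrow> G (x p) (e3 p) v = 0"
  "p \<in> W \<Longrightarrow> v \<in> tangent_plane A x p \<Longrightarrow> G (x p) (e4 p) v = 0"
  using normal by (auto simp: normal_plane_def)

lemma e_inner:
  assumes "p \<in> W"
  shows "G (x p) (e1 p) (e1 p) = -1" "G (x p) (e2 p) (e2 p) = 1" "G (x p) (e3 p) (e3 p) = 1" "G (x p) (e4 p) (e4 p) = 1"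
    "G (x p) (e1 p) (e2 p) = 0" "G (x p) (e2 p) (e1 p) = 0" "G (x p) (e1 p) (e3 p) = 0" "G (x p) (e3 p) (e1 p) = 0"
    "G (x p) (e1 p) (e4 p) = 0" "G (x p) (e4 p) (e1 p) = 0" "G (x p) (e2 p) (e3 p) = 0" "G (x p) (e3 p) (e2 p) = 0"
    "G (x p) (e2 p) (e4 p) = 0" "G (x p) (e4 p) (e2 p) = 0" "G (x p) (e3 p) (e4 p) = 0" "G (x p) (e4 p) (e3 p) = 0"
  using assms unit orthogonal e_normal[OF assms] e_tangent[OF assms] G_commute by auto

lemma frame:
  assumes "p \<in> W" shows "frame (x p) (e1 p) (e2 p) (e3 p) (e4 p)"
proof -
  have "{e1 p, e2 p} \<subseteq> tangent_space L (x p)"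
    using e_tangent[OF assms] subspace_tangent_plane(2)[OF W_topspace[OF assms]] by blast
  then show ?thesis
    using e_inner[OF assms] normal assms by (simp add: frame_def normal_plane_def)
qed

lemmas expansion = frame_expansion[OF W_L frame]

lemma tfield_e: "tfield W e1" "tfield W e2" "tfield W e3" "tfield W e4"
  using smooth W frame by (auto simp: tfield_def frame_def)

lemma tangent_expansion:
  assumes "p \<in> W" "X \<in> tangent_plane A x p"
  shows "X = - G (x p) X (e1 p) *\<^sub>R e1 p + G (x p) X (e2 p) *\<^sub>R e2 p"
proof -
  have "X \<in> tangent_space L (x p)" using subspace_tangent_plane(2)[OF W_topspace] assms by blast
  from expansion[OF assms(1) assms(1) this] show ?thesis
    using e_normal[OF assms] G_commute[of "x p" X] by simp
qed

lemma normal_part_eq: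
  assumes p: "p \<in> W" and Z: "Z \<in> tangent_space L (x p)"
  shows "normal_part L G A x p Z = G (x p) Z (e3 p) *\<^sub>R e3 p + G (x p) Z (e4 p) *\<^sub>R e4 p"
  unfolding normal_part_def
proof (rule the_equality)
  let ?N = "G (x p) Z (e3 p) *\<^sub>R e3 p + G (x p) Z (e4 p) *\<^sub>R e4 p"
  note T = subspace_tangent_plane[OF W_topspace[OF p]]
  have "?N \<in> normal_plane L G A x p"
    using normal p subspace_tangent_L[OF W_L[OF p]]
    by (auto simp: normal_plane_def intro!: subspace_add subspace_scale)
  moreover have "Z - ?N = - G (x p) Z (e1 p) *\<^sub>R e1 p + G (x p) Z (e2 p) *\<^sub>R e2 p"
    using expansion[OF p p Z] by (simp add: algebra_simps)
  moreover have "\<dots> \<in> tangent_plane A x p"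
    by (intro subspace_add[OF T(1)] subspace_scale[OF T(1)] e_tangent p)
  ultimately show "?N \<in> normal_plane L G A x p \<and> Z - ?N \<in> tangent_plane A x p" by simp
  fix N assume N: "N \<in> normal_plane L G A x p \<and> Z - N \<in> tangent_plane A x p"
  then have "N \<in> tangent_space L (x p)" "G (x p) N (e1 p) = 0" "G (x p) N (e2 p) = 0"
    using e_tangent[OF p] by (auto simp: normal_plane_def)
  moreover have "G (x p) N (e3 p) = G (x p) Z (e3 p)" "G (x p) N (e4 p) = G (x p) Z (e4 p)"
    using e_normal[OF p, of "Z - N"] N G_commute[of "x p" "e3 p"] G_commute[of "x p" "e4 p"] by simp_all
  ultimately show "N = ?N" using expansion[OF p p, of N] by simp
qed

lemma sinh_nonzero:
  assumes p: "p \<in> W" shows "sinh (\<theta> p) \<noteq> 0"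
proof
  assume "sinh (\<theta> p) = 0"
  then have eq: "partial_t = cosh (\<theta> p) *\<^sub>R e1 p" using angle p by force
  have "normal_part L G A x p partial_t = 0"
    unfolding normal_part_eq[OF p partial_t_tangent[OF W_L[OF p]]] unfolding eq
    using e_inner[OF p] by simp
  then show False using \<eta> p by blast
qed

lemma G_partial_t_e:
  assumes p: "p \<in> W"
  shows "G (x p) partial_t v = cosh (\<theta> p) * G (x p) (e1 p) v + sinh (\<theta> p) * G (x p) (e3 p) v"
proof -
  have "partial_t = cosh (\<theta> p) *\<^sub>R e1 p + sinh (\<theta> p) *\<^sub>R e3 p" using angle p by blast
  then show ?thesis by (metis G_simps(1,5))
qed

lemma fst_e:
  assumes p: "p \<in> W"
  shows "fst (e1 p) = cosh (\<theta> p)" "fst (e2 p) = 0" "fst (e3 p) = - sinh (\<theta> p)" "fst (e4 p) = 0"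
proof -
  have "fst v = - (cosh (\<theta> p) * G (x p) (e1 p) v + sinh (\<theta> p) * G (x p) (e3 p) v)" for v
    using G_partial_t[of "x p" v] G_partial_t_e[OF p, of v] G_commute[of "x p" v] by simp
  then show "fst (e1 p) = cosh (\<theta> p)" "fst (e2 p) = 0" "fst (e3 p) = - sinh (\<theta> p)" "fst (e4 p) = 0"
    using e_inner[OF p] by simp_all
qed

lemma nab_e_tangent:
  assumes "p \<in> W" "X \<in> tangent_plane A x p"
  shows "nab e1 p X \<in> tangent_space L (x p)" "nab e2 p X \<in> tangent_space L (x p)"
    "nab e3 p X \<in> tangent_space L (x p)" "nab e4 p X \<in> tangent_space L (x p)"
  using tfield_e[THEN nab_tangent] assms by blast+

lemma nab_skew:
  assumes p: "p \<in> W" and X: "X \<in> tangent_plane A x p" and e: "e \<in> {e1, e2, e3, e4}" "e' \<in> {e1, e2, e3, e4}"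
  shows "G (x p) (nab e p X) (e' p) = - G (x p) (nab e' p X) (e p)"
proof -
  have "tfield W e" "tfield W e'" using e tfield_e by auto
  moreover have "\<exists>k. \<forall>q\<in>W. G (x q) (e q) (e' q) = k" using e e_inner by auto
  ultimately show ?thesis using nab_compatible[of W e p e' X] p X G_commute by metis
qed

text \<open>Differentiates \<langle>\<partial>_t, e\<rangle> = 0, valid for \<open>e2\<close> and
  \<open>e4\<close>. It ties the \<open>e3\<close> component of the derivative to its
  \<open>e1\<close> component.\<close>

lemma nab_partial_t_e:
  assumes p: "p \<in> W" and X: "X \<in> tangent_plane A x p" and e: "e = e2 \<or> e = e4"
  shows "cosh (\<theta> p) * G (x p) (nab e p X) (e1 p) + sinh (\<theta> p) * G (x p) (nab e p X) (e3 p) =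
    - (deriv f (fst (x p)) / f (fst (x p))) * G (x p) X (e p)"
proof -
  have te: "tfield W e" using e tfield_e by auto
  have 0: "G (x q) partial_t (e q) = 0" if "q \<in> W" for q
    using G_partial_t[of "x q" "e q"] G_commute fst_e[OF that] e by auto
  have "G (x p) (nab (\<lambda>_. partial_t) p X) (e p) = - G (x p) partial_t (nab e p X)"
    using nab_compatible[OF tfield_partial_t[OF W] p te X 0] .
  then show ?thesis
    unfolding nab_partial_t[OF W_topspace[OF p] X]
    using 0[OF p] G_partial_t_e[OF p, of "nab e p X"] G_commute[of "x p" "nab e p X"] by simp
qed

text \<open>Moving the derivative from the extension \<open>V\<close> to the normal fields leaves
  only the value \<open>V p = Y\<close>, so the extension does not matter.\<close>

lemma second_fundamental_form_eq:
  assumes p: "p \<in> W" and X: "X \<in> tangent_plane A x p" and Y: "Y \<in> tangent_plane A x p"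
  shows "second_fundamental_form L G M A x p X Y =
    - G (x p) (nab e3 p X) Y *\<^sub>R e3 p - G (x p) (nab e4 p X) Y *\<^sub>R e4 p"
  unfolding second_fundamental_form_def
proof (rule the_equality)
  let ?N = "- G (x p) (nab e3 p X) Y *\<^sub>R e3 p - G (x p) (nab e4 p X) Y *\<^sub>R e4 p"
  show "\<forall>W' V. openin M W' \<and> p \<in> W' \<and> smooth_map_on A W' V \<and> (\<forall>q\<in>W'. V q \<in> tangent_plane A x q) \<and> V p = Y \<longrightarrow>
     ?N = normal_part L G A x p (nab V p X)"
  proof (intro allI impI, elim conjE)
    fix W' V assume W': "openin M W'" "p \<in> W'" and V: "smooth_map_on A W' V" "\<forall>q\<in>W'. V q \<in> tangent_plane A x q" "V p = Y"
    have WW: "openin M (W \<inter> W')" "p \<in> W \<inter> W'" using W W' p by auto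
    have tV: "tfield (W \<inter> W') V"
      by (rule tangent_tfield[OF WW(1) smooth_map_on_subset[OF V(1)]]) (use V(2) in auto)
    have te: "tfield (W \<inter> W') e3" "tfield (W \<inter> W') e4"
      using tfield_subset[OF tfield_e(3) WW(1)] tfield_subset[OF tfield_e(4) WW(1)] by auto
    have 0: "G (x q) (e3 q) (V q) = 0" "G (x q) (e4 q) (V q) = 0" if "q \<in> W \<inter> W'" for q
      using e_normal[of q "V q"] V(2) that by auto
    have "G (x p) (nab e3 p X) Y = - G (x p) (e3 p) (nab V p X)" "G (x p) (nab e4 p X) Y = - G (x p) (e4 p) (nab V p X)"
      using nab_compatible[OF te(1) WW(2) tV X 0(1)] nab_compatible[OF te(2) WW(2) tV X 0(2)] V(3) by simp_all
    then show "?N = normal_part L G A x p (nab V p X)"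
      using normal_part_eq[OF p nab_tangent[OF tV WW(2) X]] G_commute[of "x p" "nab V p X"] by simp
  qed
  fix N assume N: "\<forall>W' V. openin M W' \<and> p \<in> W' \<and> smooth_map_on A W' V \<and> (\<forall>q\<in>W'. V q \<in> tangent_plane A x q) \<and> V p = Y \<longrightarrow>
     N = normal_part L G A x p (nab V p X)"
  \<comment> \<open>Some smooth tangent extension of \<open>Y\<close> must exist, or the description
    would hold vacuously for every \<open>N\<close>; a combination of \<open>e1\<close> and
    \<open>e2\<close> with constant coefficients is one.\<close>
  define V where "V = (\<lambda>q. (- G (x p) Y (e1 p)) *\<^sub>R e1 q + G (x p) Y (e2 p) *\<^sub>R e2 q)"
  have sV: "smooth_map_on A W V"
    unfolding smooth_map_on_def V_def o_def
  proof safe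
    fix U \<phi> assume a: "(U, \<phi>) \<in> A"
    have "smooth_on {u \<in> U. \<phi> u \<in> W} (\<lambda>u. e1 (\<phi> u))" "smooth_on {u \<in> U. \<phi> u \<in> W} (\<lambda>u. e2 (\<phi> u))"
      using tfield_e(1,2) smooth_map_onD[OF _ a] by (auto simp: tfield_def o_def)
    then show "smooth_on {u \<in> U. \<phi> u \<in> W} (\<lambda>u. (- G (x p) Y (e1 p)) *\<^sub>R e1 (\<phi> u) + G (x p) Y (e2 p) *\<^sub>R e2 (\<phi> u))"
      by (intro smooth_on_add smooth_on_scaleR smooth_on_const chart_preimage_open[OF a W])
  qed
  have tV: "\<forall>q\<in>W. V q \<in> tangent_plane A x q"
  proof
    fix q assume q: "q \<in> W"
    note T = subspace_tangent_plane(1)[OF W_topspace[OF q]]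
    show "V q \<in> tangent_plane A x q"
      unfolding V_def by (intro subspace_add[OF T] subspace_scale[OF T] e_tangent q)
  qed
  have Vp: "V p = Y" using tangent_expansion[OF p Y] by (simp add: V_def)
  have te: "tfield W V" using tangent_tfield[OF W sV] tV by blast
  have 0: "G (x q) (e3 q) (V q) = 0" "G (x q) (e4 q) (V q) = 0" if "q \<in> W" for q
    using e_normal[of q "V q"] tV that by auto
  have "G (x p) (nab e3 p X) Y = - G (x p) (e3 p) (nab V p X)" "G (x p) (nab e4 p X) Y = - G (x p) (e4 p) (nab V p X)"
    using nab_compatible[OF tfield_e(3) p te X 0(1)] nab_compatible[OF tfield_e(4) p te X 0(2)] Vp by simp_all
  moreover have "N = normal_part L G A x p (nab V p X)" using N W p sV tV Vp by blast
  ultimately show "N = ?N"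
    using normal_part_eq[OF p nab_tangent[OF te p X]] G_commute[of "x p" "nab V p X"] by simp
qed

text \<open>The normal component is not free: by \<open>nab_partial_t_e\<close> and
  \<open>sinh (\<theta> p) \<noteq> 0\<close> the \<open>e3\<close> component vanishes with the
  \<open>e1\<close> component.\<close>

lemma nab_e4_eq_0:
  assumes p: "p \<in> W" and X: "X \<in> tangent_plane A x p"
    and 0: "G (x p) (nab e4 p X) (e1 p) = 0" "G (x p) (nab e4 p X) (e2 p) = 0"
  shows "nab e4 p X = 0"
proof -
  have "G (x p) X (e4 p) = 0" using e_normal(2)[OF p X] G_commute by metis
  then have "G (x p) (nab e4 p X) (e3 p) = 0"
    using nab_partial_t_e[OF p X, of e4] 0 sinh_nonzero[OF p] by simp
  moreover have "G (x p) (nab e4 p X) (e4 p) = 0" using nab_skew[OF p X, of e4 e4] by simp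
  ultimately show ?thesis using expansion[OF p p nab_e_tangent(4)[OF p X]] 0 by simp
qed

text \<open>A vanishing second fundamental form only removes the tangential parts of the two
  derivatives. The normal part goes by \<open>nab_e4_eq_0\<close> for \<open>e4\<close>, and then by
  skew symmetry for \<open>e3\<close>.\<close>

lemma null_iff:
  assumes p: "p \<in> W"
  shows "X \<in> relative_null_space L G M A x p \<longleftrightarrow>
    X \<in> tangent_plane A x p \<and> nab e3 p X = 0 \<and> nab e4 p X = 0"
proof (intro iffI conjI)
  assume N: "X \<in> relative_null_space L G M A x p"
  then show X: "X \<in> tangent_plane A x p" by (simp add: relative_null_space_def)
  have 0: "G (x p) (nab e3 p X) Y = 0 \<and> G (x p) (nab e4 p X) Y = 0" if "Y \<in> tangent_plane A x p" for Y
  proof -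
    have "- G (x p) (nab e3 p X) Y *\<^sub>R e3 p - G (x p) (nab e4 p X) Y *\<^sub>R e4 p = 0" (is "?v = 0")
      using N that second_fundamental_form_eq[OF p X that] by (simp add: relative_null_space_def)
    then have "G (x p) ?v (e3 p) = 0" "G (x p) ?v (e4 p) = 0" by (metis G_simps(9))+
    then show ?thesis using e_inner[OF p] by simp
  qed
  then show 4: "nab e4 p X = 0" using nab_e4_eq_0[OF p X] e_tangent[OF p] by blast
  have "G (x p) (nab e3 p X) (e4 p) = 0" using nab_skew[OF p X, of e3 e4] 4 by simp
  moreover have "G (x p) (nab e3 p X) (e3 p) = 0" using nab_skew[OF p X, of e3 e3] by simp
  ultimately show "nab e3 p X = 0"
    using expansion[OF p p nab_e_tangent(3)[OF p X]] 0 e_tangent[OF p] by simp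
next
  assume "X \<in> tangent_plane A x p \<and> nab e3 p X = 0 \<and> nab e4 p X = 0"
  then show "X \<in> relative_null_space L G M A x p"
    using second_fundamental_form_eq[OF p] by (simp add: relative_null_space_def)
qed

text \<open>At a point where the null direction \<open>N\<close> is not that of \<open>e1\<close>, the Codazzi equation for
  \<open>e3\<close>, whose curvature term does not vanish, shows that the derivative of \<open>N\<close> along itself is not
  a multiple of \<open>N\<close>; the Codazzi equation for \<open>e4\<close>, whose curvature term does vanish, then
  forces \<open>e4\<close> to be parallel.\<close>

lemma e4_parallel:
  assumes K: "\<forall>t\<in>I. deriv (deriv f) t / f t - ((deriv f t)\<^sup>2 + c) / (f t)\<^sup>2 \<noteq> 0"
    and N: "tfield W' N" "W' \<subseteq> W" "\<forall>q\<in>W'. N q \<in> relative_null_space L G M A x q"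
    and p: "p \<in> W'" "G (x p) (N p) (e2 p) \<noteq> 0" and Z: "Z \<in> tangent_plane A x p"
  shows "nab e4 p Z = 0"
proof -
  have W': "openin M W'" using N by (simp add: tfield_def)
  have pW: "p \<in> W" using p N by auto
  have tN: "N q \<in> tangent_plane A x q" if "q \<in> W'" for q
    using N(3) that by (simp add: relative_null_space_def)
  obtain U \<phi> u a where ch: "(U, \<phi>) \<in> A" "u \<in> U" "\<phi> u = p" and a: "N p = frechet_derivative (x \<circ> \<phi>) (at u) a"
    using nab_obtain_chart[OF N(1) p(1) tN[OF p(1)]] by blast
  obtain b where b: "e1 p = frechet_derivative (x \<circ> \<phi>) (at u) b"
    using e_tangent(1)[OF pW] tangent_plane_chart[OF ch(1,2)] ch(3) by blast
  let ?U = "{u\<in>U. \<phi> u \<in> W'}"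
  interpret rw_map c I f L G ?U "x \<circ> \<phi>" by (rule chart_rw_map) fact+
  have u: "u \<in> ?U" using ch p by simp
  have vN: "vfield (N \<circ> \<phi>)" by (rule tfield_chart) fact+
  define n1 n2 where "n1 = - G (x p) (N p) (e1 p)" and "n2 = G (x p) (N p) (e2 p)"
  have Np: "N p = n1 *\<^sub>R e1 p + n2 *\<^sub>R e2 p"
    using tangent_expansion[OF pW tN[OF p(1)]] by (simp add: n1_def n2_def)
  have n2: "n2 \<noteq> 0" using p by (simp add: n2_def)
  have e: "tfield W' e" "vfield (e \<circ> \<phi>)" if "e = e3 \<or> e = e4" for e
  proof -
    show "tfield W' e" using that tfield_subset[OF _ W' N(2)] tfield_e by auto
    then show "vfield (e \<circ> \<phi>)" by (rule tfield_chart) fact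
  qed
  have norm: "G (x q) (e q) v = 0" if "e = e3 \<or> e = e4" "q \<in> W'" "v \<in> tangent_plane A x q" for e q v
    using that e_normal[of q v] N(2) by auto
  have ea: "cov (e \<circ> \<phi>) u a = 0" if "e = e3 \<or> e = e4" for e
  proof -
    have "nab e p (N p) = 0" using null_iff[OF pW] N(3) p(1) that by blast
    then show ?thesis using nab_chart[OF e(1)[OF that] ch(1,2), of a] p(1) ch(3) a by simp
  qed
  \<comment> \<open>Symmetry of the shape operator moves the null vector into the direction slot.
    The equation holds on all of \<open>?U\<close> and may therefore be differentiated.\<close>
  have eN: "G ((x \<circ> \<phi>) v) (cov (e \<circ> \<phi>) v d) ((N \<circ> \<phi>) v) = 0" if e': "e = e3 \<or> e = e4" and v: "v \<in> ?U" for e v d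
  proof -
    have q: "\<phi> v \<in> W'" "\<phi> v \<in> W" and d: "dx v d \<in> tangent_plane A x (\<phi> v)"
      using v N(2) tangent_plane_chart[OF ch(1), of v] by auto
    have "nab e (\<phi> v) (N (\<phi> v)) = 0" using null_iff[OF q(2)] N(3) q(1) e' by blast
    then have "G (x (\<phi> v)) (nab e (\<phi> v) (dx v d)) (N (\<phi> v)) = 0"
      using nab_normal_symmetric[OF e(1)[OF e'] q(1) d tN[OF q(1)] norm[OF e']] by simp
    then show ?thesis using nab_chart[OF e(1)[OF e'] ch(1), of v d] v by simp
  qed
  \<comment> \<open>This is \<nabla>_N N at \<open>p\<close>. That \<open>a\<close> represents
    \<open>N\<close> at \<open>u\<close> only is enough, since a covariant derivative depends on its
    direction pointwise.\<close>
  define D where "D = cov (N \<circ> \<phi>) u a"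
  \<comment> \<open>Both second derivatives are paired with \<open>N\<close>, and \<open>eN\<close>
    shifts the outer derivative onto \<open>N\<close>. The second one vanishes because
    \<open>cov (e \<circ> \<phi>) u a = 0\<close>.\<close>
  have curv_e: "G (x p) (curv (x p) (N p) (e1 p) (e p)) (N p) = - G (x p) (cov (e \<circ> \<phi>) u b) D" if e': "e = e3 \<or> e = e4" for e
  proof -
    note ve = e(2)[OF e']
    have "G (x p) (cov (\<lambda>v. cov (e \<circ> \<phi>) v b) u a) (N p) = - G (x p) (cov (e \<circ> \<phi>) u b) D"
      using cov_compatible[where W="N \<circ> \<phi>", OF u vfield_cov[OF ve] vN eN[OF e'], of b a] ch(3) by (simp add: D_def)
    moreover have "G (x p) (cov (\<lambda>v. cov (e \<circ> \<phi>) v a) u b) (N p) = 0"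
      using cov_compatible[where W="N \<circ> \<phi>", OF u vfield_cov[OF ve] vN eN[OF e'], of a b] ea[OF e'] ch(3) by simp
    moreover have "curv (x p) (N p) (e1 p) (e p) = cov (\<lambda>v. cov (e \<circ> \<phi>) v b) u a - cov (\<lambda>v. cov (e \<circ> \<phi>) v a) u b"
      using curvature[OF u ve, of b a] ch(3) a b by simp
    ultimately show ?thesis by simp
  qed
  \<comment> \<open>\<open>D\<close> has no normal part: \<open>N\<close> is orthogonal to
    \<open>e\<close>, and \<open>e\<close> is parallel along \<open>N\<close>.\<close>
  have "G (x p) D (e p) = 0" if e': "e = e3 \<or> e = e4" for e
  proof -
    have "G ((x \<circ> \<phi>) v) ((N \<circ> \<phi>) v) ((e \<circ> \<phi>) v) = 0" if "v \<in> ?U" for v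
      using norm[OF e' _ tN, of "\<phi> v"] that G_commute[of _ "N (\<phi> v)"] by simp
    then show ?thesis using cov_compatible[OF u vN e(2)[OF e'], of 0 a] ea[OF e'] ch(3) by (simp add: D_def)
  qed
  moreover have "D \<in> tangent_space L (x p)" using cov_tangent[OF u vN, of a] ch(3) by (simp add: D_def)
  ultimately have D: "D = - G (x p) D (e1 p) *\<^sub>R e1 p + G (x p) D (e2 p) *\<^sub>R e2 p"
    using expansion[OF pW pW, of D] by simp
  \<comment> \<open>Coordinates of \<open>D\<close> in the basis \<open>N p\<close>,
    \<open>e1 p\<close> of the tangent plane, a basis because \<open>n2 \<noteq> 0\<close>. Only
    \<open>\<beta>\<close> survives pairing with the derivative of \<open>e\<close>, by
    \<open>eN\<close>.\<close>
  define \<alpha> where "\<alpha> = G (x p) D (e2 p) / n2"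
  define \<beta> where "\<beta> = - G (x p) D (e1 p) - \<alpha> * n1"
  have "D = \<alpha> *\<^sub>R N p + \<beta> *\<^sub>R e1 p"
    by (subst D) (use n2 in \<open>simp add: Np \<alpha>_def \<beta>_def algebra_simps\<close>)
  then have De: "G (x p) (cov (e \<circ> \<phi>) u b) D = \<beta> * G (x p) (cov (e \<circ> \<phi>) u b) (e1 p)" if "e = e3 \<or> e = e4" for e
    using eN[OF that u, of b] ch(3) by simp
  define \<kappa> where "\<kappa> = deriv (deriv f) (fst (x p)) / f (fst (x p)) - ((deriv f (fst (x p)))\<^sup>2 + c) / (f (fst (x p)))\<^sup>2"
  have \<kappa>: "\<kappa> \<noteq> 0" using K fst_L[OF W_L[OF pW]] by (simp add: \<kappa>_def)
  have cd: "fst (e p) * \<kappa> * (cosh (\<theta> p) * n2\<^sup>2) = \<beta> * G (x p) (cov (e \<circ> \<phi>) u b) (e1 p)" if e': "e = e3 \<or> e = e4" for e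
  proof -
    have t: "N p \<in> tangent_space L (x p)" "e1 p \<in> tangent_space L (x p)" "e p \<in> tangent_space L (x p)"
      using N(1) p(1) tfield_e pW e' by (auto simp: tfield_def)
    have n: "G (x p) (N p) (e p) = 0" "G (x p) (e1 p) (e p) = 0"
      using norm[OF e' p(1) tN[OF p(1)]] norm[OF e' p(1) e_tangent(1)[OF pW]] G_commute by metis+
    \<comment> \<open>The last factor of \<open>G_curv_normal\<close>; the two terms in
      \<open>n1\<close> cancel because \<open>e1\<close> is time-like.\<close>
    have "fst (N p) * G (x p) (N p) (e1 p) - fst (e1 p) * G (x p) (N p) (N p) = - (cosh (\<theta> p) * n2\<^sup>2)"
      unfolding Np using fst_e[OF pW] e_inner[OF pW] by (simp add: algebra_simps power2_eq_square)
    then show ?thesis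
      using curv_e[OF e'] De[OF e'] G_curv_normal[OF W_L[OF pW] t n, folded \<kappa>_def] by simp
  qed
  have "cosh (\<theta> p) \<noteq> 0" by (metis cosh_real_pos less_irrefl)
  then have "\<beta> \<noteq> 0" using cd[of e3] fst_e[OF pW] \<kappa> n2 sinh_nonzero[OF pW] by auto
  then have 1: "G (x p) (cov (e4 \<circ> \<phi>) u b) (e1 p) = 0" using cd[of e4] fst_e[OF pW] by simp
  then have 2: "G (x p) (cov (e4 \<circ> \<phi>) u b) (e2 p) = 0"
    using eN[of e4 u b] u ch(3) n2 by (simp add: Np)
  obtain z where z: "Z = dx u z" using Z tangent_plane_chart[OF ch(1,2)] ch(3) by blast
  define s where "s = G (x p) Z (e2 p) / n2"
  define r where "r = - G (x p) Z (e1 p) - s * n1"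
  have "Z = s *\<^sub>R N p + r *\<^sub>R e1 p"
    by (subst tangent_expansion[OF pW Z]) (use n2 in \<open>simp add: Np s_def r_def algebra_simps\<close>)
  then have "Z = dx u (s *\<^sub>R a + r *\<^sub>R b)"
    using a b has_derivative_linear[OF dx_has_derivative[OF u]] by (simp add: linear_add linear_cmul)
  then have "nab e4 p Z = cov (e4 \<circ> \<phi>) u (s *\<^sub>R a + r *\<^sub>R b)"
    using nab_chart[OF e(1) ch(1,2)] ch(3) p(1) by simp
  also have "\<dots> = r *\<^sub>R cov (e4 \<circ> \<phi>) u b"
    using linear_cov[OF u e(2)[of e4]] ea[of e4] by (simp add: linear_add linear_cmul)
  finally show ?thesis using nab_e4_eq_0[OF pW Z] 1 2 by simp
qed

text \<open>If \<open>N\<close> had an \<open>e2\<close> component at \<open>p\<close>, it would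
  have one nearby; there \<open>e4\<close> would be parallel by \<open>e4_parallel\<close>, and
  \<open>parallel_normal_slice\<close> would put an open piece of the surface into a totally
  geodesic hypersurface.\<close>

lemma e1_null:
  assumes K: "\<forall>t\<in>I. deriv (deriv f) t / f t - ((deriv f t)\<^sup>2 + c) / (f t)\<^sup>2 \<noteq> 0"
    and ntg: "\<not> (\<exists>O' S. openin M O' \<and> O' \<noteq> {} \<and> hypersurface L S \<and> totally_geodesic L G S \<and> x ` O' \<subseteq> S)"
    and dist: "smooth_line_distribution M A (relative_null_space L G M A x)"
    and p: "p \<in> W"
  shows "e1 p \<in> relative_null_space L G M A x p"
proof -
  obtain W0 N where W0: "openin M W0" "p \<in> W0" and N0: "smooth_map_on A W0 N"
    and N: "\<forall>q\<in>W0. N q \<noteq> 0 \<and> relative_null_space L G M A x q = span {N q}"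
    using dist W_topspace[OF p] unfolding smooth_line_distribution_def by metis
  define W' where "W' = W \<inter> W0"
  have W': "openin M W'" "p \<in> W'" "W' \<subseteq> W" using W0 p W by (auto simp: W'_def)
  have nN: "\<forall>q\<in>W'. N q \<in> relative_null_space L G M A x q"
    using N by (auto simp: W'_def intro: span_base)
  then have "\<forall>q\<in>W'. N q \<in> tangent_plane A x q" by (simp add: relative_null_space_def)
  then have tN: "tfield W' N"
    by (intro tangent_tfield W'(1) smooth_map_on_subset[OF N0]) (auto simp: W'_def)
  have "G (x p) (N p) (e2 p) = 0"
  proof (rule ccontr)
    assume n2: "G (x p) (N p) (e2 p) \<noteq> 0"
    obtain U \<phi> u where ch: "(U, \<phi>) \<in> A" "u \<in> U" "\<phi> u = p"
      using chart_exists[OF W_topspace[OF p]] by blast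
    let ?U = "{u\<in>U. \<phi> u \<in> W'}"
    interpret rw_map c I f L G ?U "x \<circ> \<phi>" by (rule chart_rw_map) fact+
    have u: "u \<in> ?U" using ch W' by simp
    define g where "g = (\<lambda>u. G ((x \<circ> \<phi>) u) ((N \<circ> \<phi>) u) ((e2 \<circ> \<phi>) u))"
    have "continuous_on ?U g" unfolding g_def
      by (intro smooth_on_continuous smooth_on_G vfield_smooth tfield_chart[OF tN] ch(1)
            tfield_chart[OF tfield_subset[OF tfield_e(2) W'(1,3)]])
    then have "open (?U \<inter> g -` (- {0}))" by (rule continuous_open_preimage[OF _ U]) auto
    moreover have "u \<in> ?U \<inter> g -` (- {0})" using u n2 ch(3) by (simp add: g_def)
    \<comment> \<open>A ball supplies the connected domain that \<open>parallel_normal_slice\<close>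
      requires.\<close>
    ultimately obtain r where r: "r > 0" "ball u r \<subseteq> ?U \<inter> g -` (- {0})"
      unfolding open_contains_ball by blast
    have BU: "ball u r \<subseteq> ?U" using r by blast
    have BW: "\<phi> v \<in> W'" "\<phi> v \<in> W" if "v \<in> ball u r" for v using that BU W'(3) by auto
    interpret B: rw_map c I f L G "ball u r" "x \<circ> \<phi>"
      by unfold_locales (use BU smooth_on_subset[OF x(1) BU] x(2) in auto)
    have "vfield (e4 \<circ> \<phi>)" by (rule tfield_chart[OF tfield_subset[OF tfield_e(4) W'(1,3)] ch(1)])
    then have "B.vfield (e4 \<circ> \<phi>)"
      using BU smooth_on_subset by (auto simp: vfield_def B.vfield_def)
    moreover have "cov (e4 \<circ> \<phi>) v d = 0" if v: "v \<in> ball u r" for v d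
    proof -
      have vU: "v \<in> U" and gv: "g v \<noteq> 0" using v r by auto
      have "nab e4 (\<phi> v) (dx v d) = 0"
        by (rule e4_parallel[OF K tN W'(3) nN BW(1)[OF v]])
           (use gv tangent_plane_chart[OF ch(1) vU] in \<open>auto simp: g_def\<close>)
      then show ?thesis using nab_chart[OF tfield_e(4) ch(1) vU BW(2)[OF v]] by simp
    qed
    moreover have "fst ((e4 \<circ> \<phi>) v) = 0" if "v \<in> ball u r" for v
      using fst_e(4)[OF BW(2)[OF that]] by simp
    moreover have "G ((x \<circ> \<phi>) v) ((e4 \<circ> \<phi>) v) ((e4 \<circ> \<phi>) v) = 1" if "v \<in> ball u r" for v
      using e_inner(4)[OF BW(2)[OF that]] by simp
    moreover have "G ((x \<circ> \<phi>) v) ((e4 \<circ> \<phi>) v) (dx v d) = 0" if v: "v \<in> ball u r" for v d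
      using e_normal(2)[OF BW(2)[OF v], of "dx v d"] tangent_plane_chart[OF ch(1), of v] v BU by auto
    ultimately obtain S where S: "hypersurface L S" "totally_geodesic L G S" "(x \<circ> \<phi>) ` ball u r \<subseteq> S"
      using B.parallel_normal_slice[of "e4 \<circ> \<phi>"] r(1) by (metis ball_eq_empty connected_ball not_le)
    have "openin M (\<phi> ` ball u r)" using chart_image_open[OF ch(1) open_ball] BU by blast
    moreover have "\<phi> ` ball u r \<noteq> {}" using r by simp
    ultimately show False using ntg S by (metis image_comp)
  qed
  \<comment> \<open>\<open>N p\<close> is a multiple of \<open>e1 p\<close>, and the factor is
    nonzero because \<open>N p\<close> is; hence \<open>e1 p\<close> lies in the null line.\<close>
  then have "N p = - G (x p) (N p) (e1 p) *\<^sub>R e1 p"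
    using tangent_expansion[OF p, of "N p"] nN W'(2) by (simp add: relative_null_space_def)
  moreover have "N p \<noteq> 0" and null: "relative_null_space L G M A x p = span {N p}" using N W0 by auto
  ultimately have "e1 p = (- inverse (G (x p) (N p) (e1 p))) *\<^sub>R N p"
    by (metis (no_types, lifting) minus_mult_minus left_inverse scaleR_one scaleR_scaleR scaleR_zero_left minus_zero)
  then show ?thesis unfolding null by (metis span_base span_scale singletonI)
qed

text \<open>The coefficients are the frame components of the derivatives. Nullity of
  \<open>e1\<close> removes the derivatives of the normals along \<open>e1\<close>; skew symmetry,
  symmetry of the shape operators and \<open>nab_partial_t_e\<close> remove the remaining
  components.\<close>

lemma structure_equations:
  assumes null: "\<And>p. p \<in> W \<Longrightarrow> e1 p \<in> relative_null_space L G M A x p"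
  shows "\<exists>\<omega> h3 h4 :: 'm \<Rightarrow> real.
      smooth_map_on A W \<omega> \<and> smooth_map_on A W h3 \<and> smooth_map_on A W h4 \<and>
      (\<forall>p\<in>W. nab e1 p (e1 p) = 0 \<and> nab e1 p (e2 p) = \<omega> p *\<^sub>R e2 p \<and>
        nab e2 p (e1 p) = 0 \<and> nab e2 p (e2 p) = \<omega> p *\<^sub>R e1 p + h3 p *\<^sub>R e3 p + h4 p *\<^sub>R e4 p \<and>
        nab e3 p (e1 p) = 0 \<and> nab e3 p (e2 p) = - h3 p *\<^sub>R e2 p \<and>
        nab e4 p (e1 p) = 0 \<and> nab e4 p (e2 p) = - h4 p *\<^sub>R e2 p)"
proof (intro exI conjI ballI)
  let ?\<omega> = "\<lambda>p. G (x p) (nab e1 p (e2 p)) (e2 p)"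
  let ?h3 = "\<lambda>p. G (x p) (nab e2 p (e2 p)) (e3 p)" and ?h4 = "\<lambda>p. G (x p) (nab e2 p (e2 p)) (e4 p)"
  have "smooth_map_on A W e2" using smooth by simp
  from smooth_map_on_G_nab[OF W this e_tangent(2)]
  show "smooth_map_on A W ?\<omega>" "smooth_map_on A W ?h3" "smooth_map_on A W ?h4"
    using tfield_e by blast+
  fix p assume p: "p \<in> W"
  note t = e_tangent[OF p]
  note exp = nab_e_tangent[OF p, THEN expansion[OF p p]]
  have n: "nab e3 p (e1 p) = 0" "nab e4 p (e1 p) = 0" using null[OF p] null_iff[OF p] by auto
  then show "nab e3 p (e1 p) = 0" "nab e4 p (e1 p) = 0" .
  have sk: "G (x p) (nab e p X) (e p) = 0" if "X \<in> tangent_plane A x p" "e \<in> {e1, e2, e3, e4}" for X e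
    using nab_skew[OF p that(1,2,2)] by simp
  have z1: "G (x p) (nab e p (e1 p)) (e3 p) = 0" "G (x p) (nab e p (e1 p)) (e4 p) = 0" if "e \<in> {e1, e2, e3, e4}" for e
    using nab_skew[OF p t(1) that, of e3] nab_skew[OF p t(1) that, of e4] n by simp_all
  \<comment> \<open>The \<open>e3\<close> component is already zero and \<open>e1\<close> is
    orthogonal to \<open>e2\<close>, so only the \<open>e1\<close> component is left in
    \<open>nab_partial_t_e\<close>.\<close>
  have "cosh (\<theta> p) * G (x p) (nab e2 p (e1 p)) (e1 p) = 0"
    using nab_partial_t_e[OF p t(1), of e2] z1[of e2] e_inner[OF p] by simp
  then have z2: "G (x p) (nab e2 p (e1 p)) (e1 p) = 0" by simp
  then have z3: "G (x p) (nab e1 p (e1 p)) (e2 p) = 0" using nab_skew[OF p t(1), of e1 e2] by simp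
  show "nab e1 p (e1 p) = 0" "nab e2 p (e1 p) = 0"
    using exp(1)[OF t(1)] exp(2)[OF t(1)] sk[OF t(1), of e1] sk[OF t(1), of e2] z1[of e1] z1[of e2] z2 z3 by simp_all
  \<comment> \<open>Symmetry of the shape operators exchanges \<open>e2\<close> and
    \<open>e1\<close>, and the derivatives of the normals along \<open>e1\<close> vanish.\<close>
  have s3: "G (x p) (nab e3 p (e2 p)) (e1 p) = 0" and s4: "G (x p) (nab e4 p (e2 p)) (e1 p) = 0"
    using nab_normal_symmetric[OF tfield_e(3) p t(2,1) e_normal(1)] nab_normal_symmetric[OF tfield_e(4) p t(2,1) e_normal(2)] n by simp_all
  then have r: "G (x p) (nab e1 p (e2 p)) (e3 p) = 0" "G (x p) (nab e1 p (e2 p)) (e4 p) = 0"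
    using nab_skew[OF p t(2), of e1 e3] nab_skew[OF p t(2), of e1 e4] by simp_all
  have "sinh (\<theta> p) * G (x p) (nab e4 p (e2 p)) (e3 p) = 0"
    using nab_partial_t_e[OF p t(2), of e4] s4 e_inner[OF p] by simp
  then have r4: "G (x p) (nab e4 p (e2 p)) (e3 p) = 0" using sinh_nonzero[OF p] by simp
  then have r3: "G (x p) (nab e3 p (e2 p)) (e4 p) = 0" using nab_skew[OF p t(2), of e3 e4] by simp
  show "nab e1 p (e2 p) = ?\<omega> p *\<^sub>R e2 p"
    using exp(1)[OF t(2)] sk[OF t(2), of e1] r by simp
  \<comment> \<open>Skew symmetry makes the inner product with \<open>e1\<close> equal to minus
    \<open>?\<omega> p\<close>; the minus sign of the time-like vector in the expansion turns it
    back.\<close>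
  show "nab e2 p (e2 p) = ?\<omega> p *\<^sub>R e1 p + ?h3 p *\<^sub>R e3 p + ?h4 p *\<^sub>R e4 p"
    using exp(2)[OF t(2)] sk[OF t(2), of e2] nab_skew[OF p t(2), of e1 e2] by simp
  show "nab e3 p (e2 p) = - ?h3 p *\<^sub>R e2 p"
    using exp(3)[OF t(2)] sk[OF t(2), of e3] s3 r3 nab_skew[OF p t(2), of e3 e2] by simp
  show "nab e4 p (e2 p) = - ?h4 p *\<^sub>R e2 p"
    using exp(4)[OF t(2)] sk[OF t(2), of e4] s4 r4 nab_skew[OF p t(2), of e4 e2] by simp
qed

end

text \<open>Nullity is a condition on all of \<open>M\<close> while frames are local, hence a family
  of frames whose domains cover \<open>M\<close>. The forward direction treats each frame
  separately; the converse takes a frame around each point.\<close>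

theorem lemma3p7:
  fixes c :: real and I :: "real set" and f :: "real \<Rightarrow> real"
    and L :: "R5 set" and G :: "R5 \<Rightarrow> R5 \<Rightarrow> R5 \<Rightarrow> real"
    and M :: "'m topology" and A :: "'m atlas" and x :: "'m \<Rightarrow> R5"
    and J :: "'j set" and W :: "'j \<Rightarrow> 'm set"
    and e1 e2 e3 e4 :: "'j \<Rightarrow> 'm \<Rightarrow> R5" and \<theta> :: "'j \<Rightarrow> 'm \<Rightarrow> real"
  assumes c: "c \<in> {-1, 0, 1}"
    and I: "open I" "is_interval I" "I \<noteq> {}"
    and f: "smooth_on I f" "\<forall>t\<in>I. f t \<noteq> 0"
    and L: "L = rw_space I c" and G: "G = rw_metric f c"
    and curvature: "\<forall>t\<in>I. deriv (deriv f) t / f t - ((deriv f t)\<^sup>2 + c) / (f t)\<^sup>2 \<noteq> 0"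
    and M: "smooth_surface M A" "immersion M A x L" "timelike G M A x"
    and T: "\<forall>p\<in>topspace M. tangent_part L G A x p partial_t \<noteq> 0"
    and distribution: "positive_relative_nullity L G M A x \<longrightarrow>
      smooth_line_distribution M A (relative_null_space L G M A x)"
    and connected: "connected_space M"
    and not_tot_geo: "\<not> (\<exists>O' S. openin M O' \<and> O' \<noteq> {} \<and> hypersurface L S \<and>
      totally_geodesic L G S \<and> x ` O' \<subseteq> S)"
    and \<eta>: "\<forall>p\<in>topspace M. normal_part L G A x p partial_t \<noteq> 0"
    and cover: "\<forall>j\<in>J. openin M (W j)" "(\<Union>j\<in>J. W j) = topspace M"
    and frame_smooth: "\<forall>j\<in>J. \<forall>e\<in>{e1 j, e2 j, e3 j, e4 j}. smooth_map_on A (W j) e"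
    and frame_tangent: "\<forall>j\<in>J. \<forall>p\<in>W j. e1 j p \<in> tangent_plane A x p \<and> e2 j p \<in> tangent_plane A x p"
    and frame_normal: "\<forall>j\<in>J. \<forall>p\<in>W j. e3 j p \<in> normal_plane L G A x p \<and> e4 j p \<in> normal_plane L G A x p"
    and frame_unit: "\<forall>j\<in>J. \<forall>p\<in>W j.
      G (x p) (e1 j p) (e1 j p) = -1 \<and> G (x p) (e2 j p) (e2 j p) = 1 \<and>
      G (x p) (e3 j p) (e3 j p) = 1 \<and> G (x p) (e4 j p) (e4 j p) = 1"
    and frame_orthogonal: "\<forall>j\<in>J. \<forall>p\<in>W j.
      G (x p) (e1 j p) (e2 j p) = 0 \<and> G (x p) (e3 j p) (e4 j p) = 0"
    and angle: "\<forall>j\<in>J. \<forall>p\<in>W j.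
      partial_t = cosh (\<theta> j p) *\<^sub>R e1 j p + sinh (\<theta> j p) *\<^sub>R e3 j p"
  shows "positive_relative_nullity L G M A x \<longleftrightarrow>
    (\<forall>j\<in>J. \<exists>\<omega> h3 h4 :: 'm \<Rightarrow> real.
      smooth_map_on A (W j) \<omega> \<and> smooth_map_on A (W j) h3 \<and> smooth_map_on A (W j) h4 \<and>
      (\<forall>p\<in>W j.
        nabla L G A x (e1 j) (e1 j) p = 0 \<and>
        nabla L G A x (e2 j) (e1 j) p = \<omega> p *\<^sub>R e2 j p \<and>
        nabla L G A x (e1 j) (e2 j) p = 0 \<and>
        nabla L G A x (e2 j) (e2 j) p = \<omega> p *\<^sub>R e1 j p + h3 p *\<^sub>R e3 j p + h4 p *\<^sub>R e4 j p \<and>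
        nabla L G A x (e1 j) (e3 j) p = 0 \<and>
        nabla L G A x (e2 j) (e3 j) p = - h3 p *\<^sub>R e2 j p \<and>
        nabla L G A x (e1 j) (e4 j) p = 0 \<and>
        nabla L G A x (e2 j) (e4 j) p = - h4 p *\<^sub>R e2 j p))"
proof -
  interpret rw_surface c I f L G M A x
    by unfold_locales (use c I f L G M in auto)
  have fr: "rw_frame c I f L G M A x (W j) (e1 j) (e2 j) (e3 j) (e4 j) (\<theta> j)" if j: "j \<in> J" for j
  proof unfold_locales
    show "\<forall>p\<in>W j. normal_part L G A x p partial_t \<noteq> 0" using \<eta> cover j by blast
  qed (use cover frame_smooth frame_tangent frame_normal frame_unit frame_orthogonal angle j in auto)
  show ?thesis
  proof (intro iffI ballI)
    fix j assume j: "j \<in> J"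
    assume pos: "positive_relative_nullity L G M A x"
    interpret F: rw_frame c I f L G M A x "W j" "e1 j" "e2 j" "e3 j" "e4 j" "\<theta> j"
      by (rule fr[OF j])
    have "e1 j p \<in> relative_null_space L G M A x p" if "p \<in> W j" for p
      using F.e1_null[OF curvature not_tot_geo _ that] distribution pos by blast
    from F.structure_equations[OF this]
    show "\<exists>\<omega> h3 h4 :: 'm \<Rightarrow> real.
      smooth_map_on A (W j) \<omega> \<and> smooth_map_on A (W j) h3 \<and> smooth_map_on A (W j) h4 \<and>
      (\<forall>p\<in>W j.
        nabla L G A x (e1 j) (e1 j) p = 0 \<and>
        nabla L G A x (e2 j) (e1 j) p = \<omega> p *\<^sub>R e2 j p \<and>
        nabla L G A x (e1 j) (e2 j) p = 0 \<and>
        nabla L G A x (e2 j) (e2 j) p = \<omega> p *\<^sub>R e1 j p + h3 p *\<^sub>R e3 j p + h4 p *\<^sub>R e4 j p \<and>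
        nabla L G A x (e1 j) (e3 j) p = 0 \<and>
        nabla L G A x (e2 j) (e3 j) p = - h3 p *\<^sub>R e2 j p \<and>
        nabla L G A x (e1 j) (e4 j) p = 0 \<and>
        nabla L G A x (e2 j) (e4 j) p = - h4 p *\<^sub>R e2 j p)"
      unfolding nabla_eq_nab[of "e1 j"] nabla_eq_nab[of "e2 j"] by blast
  next
    assume R: "\<forall>j\<in>J. \<exists>\<omega> h3 h4 :: 'm \<Rightarrow> real.
      smooth_map_on A (W j) \<omega> \<and> smooth_map_on A (W j) h3 \<and> smooth_map_on A (W j) h4 \<and>
      (\<forall>p\<in>W j.
        nabla L G A x (e1 j) (e1 j) p = 0 \<and>
        nabla L G A x (e2 j) (e1 j) p = \<omega> p *\<^sub>R e2 j p \<and>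
        nabla L G A x (e1 j) (e2 j) p = 0 \<and>
        nabla L G A x (e2 j) (e2 j) p = \<omega> p *\<^sub>R e1 j p + h3 p *\<^sub>R e3 j p + h4 p *\<^sub>R e4 j p \<and>
        nabla L G A x (e1 j) (e3 j) p = 0 \<and>
        nabla L G A x (e2 j) (e3 j) p = - h3 p *\<^sub>R e2 j p \<and>
        nabla L G A x (e1 j) (e4 j) p = 0 \<and>
        nabla L G A x (e2 j) (e4 j) p = - h4 p *\<^sub>R e2 j p)"
    show "positive_relative_nullity L G M A x"
      unfolding positive_relative_nullity_def
    proof
      fix p assume "p \<in> topspace M"
      then obtain j where j: "j \<in> J" "p \<in> W j" using cover(2) by blast
      interpret F: rw_frame c I f L G M A x "W j" "e1 j" "e2 j" "e3 j" "e4 j" "\<theta> j"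
        by (rule fr[OF j(1)])
      \<comment> \<open>By \<open>null_iff\<close> these two equations say that \<open>e1\<close> is
        a relative null vector.\<close>
      have "nabla L G A x (e1 j) (e3 j) p = 0" "nabla L G A x (e1 j) (e4 j) p = 0" using R j by blast+
      then have "e1 j p \<in> relative_null_space L G M A x p"
        using F.null_iff[OF j(2)] F.e_tangent[OF j(2)] by (simp add: nabla_eq_nab[of "e1 j"])
      moreover have "e1 j p \<noteq> 0" using F.e_inner(1)[OF j(2)] by auto
      \<comment> \<open>\<open>e1\<close> is nonzero because its square is -1, and dimension 0 would
        mean containment in \<open>{0}\<close>.\<close>
      ultimately have "\<not> relative_null_space L G M A x p \<subseteq> {0}" by blast
      then show "dim (relative_null_space L G M A x p) > 0" using dim_eq_0 by blast
    qed
  qed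
qed

end
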